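(* Let $R$ be an associative ring with identity and let $\mathcal I$ be an ideal in the category $R\text{-}\mathrm{Mod}$ of left $R$-modules which is closed under direct limits. If there is a set of morphisms $\mathcal I_0\subseteq\mathcal I$ such that $\mathcal I$ is the closure under direct limits of $\mathcal I_0$, then $\mathcal I$ is a covering ideal of $R\text{-}\mathrm{Mod}$, that is, every left $R$-module has an $\mathcal I$-cover.
   Context: All modules are unitary left modules over $R$. An ideal $\mathcal I$ of $R\text{-}\mathrm{Mod}$ is an additive subbifunctor of the bifunctor $\mathrm{Hom}:R\text{-}\mathrm{Mod}^{op}\times R\text{-}\mathrm{Mod}\to \mathrm{Ab}$. That is, a class of morphisms such that for all modules $M,N$ the morphisms $M\to N$ in $\mathcal I$ form a subgroup of $\mathrm{Hom}_R(M,N)$, and $h\circ f\circ t\in\mathcal I$ whenever $f\in\mathcal I$ and $h,t$ are $R$-homomorphisms for which the composition is defined. $\mathcal I$ is closed under direct limits if, for every directed set $I$ and every morphism $\{f_i:M_i\to N_i\}_{i\in I}$ between directed systems $\{g_{ij}:M_i\to M_j\}_{i\le j}$ and $\{h_{ij}:N_i\to N_j\}_{i\le j}$ of modules (so $h_{ij}f_i=f_jg_{ij}$ for $i\le j$) with $f_i\in\mathcal I$ for every $i\in I$, the induced morphism $\varinjlim f_i:\varinjlim M_i\to\varinjlim N_i$ belongs to $\mathcal I$. $\mathcal I$ is the closure under direct limits of a set of morphisms $\mathcal I_0\subseteq \mathcal I$ if every $f\in\mathcal I$ can be obtained as the induced morphism $\varinjlim f_i:\varinjlim M_i\to\varinjlim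 N_i$ for some directed set $I$ and some morphism $\{f_i:M_i\to N_i\}_{i\in I}$ between directed systems $\{g_{ij}:M_i\to M_j\}_{i\le j}$ and $\{h_{ij}:N_i\to N_j\}_{i\le j}$ of modules (so $h_{ij}f_i=f_jg_{ij}$ for $i\le j$) with each $f_i\in\mathcal I_0$. An $\mathcal I$-precover of a module $M$ is a morphism $i:I\to M$ in $\mathcal I$ such that every morphism $i':I'\to M$ in $\mathcal I$ factors through $i$ (there is $k:I'\to I$ with $i\circ k=i'$). It is an $\mathcal I$-cover if, moreover, every $j:I\to I$ with $i\circ j=i$ is an automorphism. *)

theory Defs
  imports "HOL-Algebra.Module" "HOL-Library.FuncSet"
begin

unbundle cardinal_syntax

text \<open>
  HOL has no type of all sets, so the set/class distinction is expressed relative to a type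
  \<open>'u\<close> playing the role of the class of all sets: a set (over any type) is small if it has
  strictly fewer elements than \<open>'u\<close>, arbitrary sets over \<open>'u\<close> are classes, and the
  predicate \<open>universe\<close> below states that small sets satisfy infinity, power set, and
  replacement with union. Equivalently, the cardinality of \<open>'u\<close> is a strongly inaccessible
  (uncountable) cardinal, i.e. small sets form a Grothendieck universe.
\<close>

definition small :: "'u itself \<Rightarrow> 'a set \<Rightarrow> bool" where
  "small _ A \<longleftrightarrow> |A| <o |UNIV :: 'u set|"

definition universe :: "'u itself \<Rightarrow> bool" where
  "universe U \<longleftrightarrow>
     (\<exists>A :: 'u set. infinite A \<and> small U A) \<and>
     (\<forall>A :: 'u set. small U A \<longrightarrow> small U (Pow A)) \<and>
     (\<forall>(A :: 'u set) (B :: 'u \<Rightarrow> 'u set).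
        small U A \<and> (\<forall>a\<in>A. small U (B a)) \<longrightarrow> small U (\<Union>a\<in>A. B a))"


text \<open>
  The library locale \<^locale>\<open>module\<close> requires a commutative ring. The record type is reused; as
  there, the fields \<open>one\<close> and \<open>mult\<close> of a module carry no meaning.
\<close>

locale left_module = R?: ring R + M?: abelian_group M
  for R :: "('r, 's) ring_scheme" (structure) and M :: "('r, 'm, 't) module_scheme" (structure) +
  assumes smult_closed:
      "\<lbrakk>a \<in> carrier R; x \<in> carrier M\<rbrakk> \<Longrightarrow> a \<odot>\<^bsub>M\<^esub> x \<in> carrier M"
    and smult_l_distr:
      "\<lbrakk>a \<in> carrier R; b \<in> carrier R; x \<in> carrier M\<rbrakk> \<Longrightarrow>
         (a \<oplus> b) \<odot>\<^bsub>M\<^esub> x = a \<odot>\<^bsub>M\<^esub> x \<oplus>\<^bsub>M\<^esub> b \<odot>\<^bsub>M\<^esub> x"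
    and smult_r_distr:
      "\<lbrakk>a \<in> carrier R; x \<in> carrier M; y \<in> carrier M\<rbrakk> \<Longrightarrow>
         a \<odot>\<^bsub>M\<^esub> (x \<oplus>\<^bsub>M\<^esub> y) = a \<odot>\<^bsub>M\<^esub> x \<oplus>\<^bsub>M\<^esub> a \<odot>\<^bsub>M\<^esub> y"
    and smult_assoc:
      "\<lbrakk>a \<in> carrier R; b \<in> carrier R; x \<in> carrier M\<rbrakk> \<Longrightarrow>
         (a \<otimes> b) \<odot>\<^bsub>M\<^esub> x = a \<odot>\<^bsub>M\<^esub> (b \<odot>\<^bsub>M\<^esub> x)"
    and smult_one:
      "x \<in> carrier M \<Longrightarrow> \<one> \<odot>\<^bsub>M\<^esub> x = x"

text \<open>
  \<open>R-Mod\<close>: the objects are the modules on small subsets of \<open>'u\<close> (every small module over any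
  type is isomorphic to such a one). Homomorphisms are extensional, so that two of them are
  equal iff they agree on the carrier; a morphism is a triple (domain, map, codomain).
\<close>

definition Mod_obj :: "('r, 's) ring_scheme \<Rightarrow> ('r, 'u) module \<Rightarrow> bool" where
  "Mod_obj R M \<longleftrightarrow> left_module R M \<and> small TYPE('u) (carrier M)"

definition Mod_hom ::
  "('r, 's) ring_scheme \<Rightarrow> ('r, 'm) module \<Rightarrow> ('r, 'n) module \<Rightarrow> ('m \<Rightarrow> 'n) set" where
  "Mod_hom R M N = {f \<in> carrier M \<rightarrow>\<^sub>E carrier N.
     (\<forall>x\<in>carrier M. \<forall>y\<in>carrier M. f (x \<oplus>\<^bsub>M\<^esub> y) = f x \<oplus>\<^bsub>N\<^esub> f y) \<and>
     (\<forall>a\<in>carrier R. \<forall>x\<in>carrier M. f (a \<odot>\<^bsub>M\<^esub> x) = a \<odot>\<^bsub>N\<^esub> f x)}"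

definition Mod_id :: "('r, 'm) module \<Rightarrow> 'm \<Rightarrow> 'm" where
  "Mod_id M = (\<lambda>x\<in>carrier M. x)"

definition Hom_group ::
  "('r, 's) ring_scheme \<Rightarrow> ('r, 'm) module \<Rightarrow> ('r, 'n) module \<Rightarrow> ('m \<Rightarrow> 'n) monoid" where
  "Hom_group R M N =
     \<lparr>carrier = Mod_hom R M N,
      mult = (\<lambda>f g. \<lambda>x\<in>carrier M. f x \<oplus>\<^bsub>N\<^esub> g x),
      one = (\<lambda>x\<in>carrier M. \<zero>\<^bsub>N\<^esub>)\<rparr>"

type_synonym ('r, 'u) morphism = "('r, 'u) module \<times> ('u \<Rightarrow> 'u) \<times> ('r, 'u) module"

definition Mod_ideal :: "('r, 's) ring_scheme \<Rightarrow> ('r, 'u) morphism set \<Rightarrow> bool" where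
  "Mod_ideal R \<I> \<longleftrightarrow>
     (\<forall>(M, f, N)\<in>\<I>. Mod_obj R M \<and> Mod_obj R N \<and> f \<in> Mod_hom R M N) \<and>
     (\<forall>M N. Mod_obj R M \<and> Mod_obj R N \<longrightarrow> subgroup {f. (M, f, N) \<in> \<I>} (Hom_group R M N)) \<and>
     (\<forall>K L M N t f h.
        Mod_obj R K \<and> Mod_obj R N \<and> t \<in> Mod_hom R K L \<and> (L, f, M) \<in> \<I> \<and> h \<in> Mod_hom R M N \<longrightarrow>
        (K, compose (carrier K) h (compose (carrier K) f t), N) \<in> \<I>)"


text \<open>
  Since every small set is equipotent to a subset of \<open>'u\<close>, index sets can be taken in \<open>'u\<close>.
\<close>

definition directed_set :: "'u set \<Rightarrow> 'u rel \<Rightarrow> bool" where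
  "directed_set I r \<longleftrightarrow> preorder_on I r \<and> I \<noteq> {} \<and> small TYPE('u) I \<and>
     (\<forall>i\<in>I. \<forall>j\<in>I. \<exists>k\<in>I. (i, k) \<in> r \<and> (j, k) \<in> r)"

definition directed_system ::
  "('r, 's) ring_scheme \<Rightarrow> 'u set \<Rightarrow> 'u rel \<Rightarrow>
   ('u \<Rightarrow> ('r, 'u) module) \<Rightarrow> ('u \<Rightarrow> 'u \<Rightarrow> 'u \<Rightarrow> 'u) \<Rightarrow> bool" where
  "directed_system R I r M g \<longleftrightarrow>
     (\<forall>i\<in>I. Mod_obj R (M i)) \<and>
     (\<forall>(i, j)\<in>r. g i j \<in> Mod_hom R (M i) (M j)) \<and>
     (\<forall>i\<in>I. g i i = Mod_id (M i)) \<and>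
     (\<forall>i j k. (i, j) \<in> r \<and> (j, k) \<in> r \<longrightarrow> compose (carrier (M i)) (g j k) (g i j) = g i k)"

definition system_morphism ::
  "('r, 's) ring_scheme \<Rightarrow> 'u set \<Rightarrow> 'u rel \<Rightarrow>
   ('u \<Rightarrow> ('r, 'u) module) \<Rightarrow> ('u \<Rightarrow> 'u \<Rightarrow> 'u \<Rightarrow> 'u) \<Rightarrow>
   ('u \<Rightarrow> ('r, 'u) module) \<Rightarrow> ('u \<Rightarrow> 'u \<Rightarrow> 'u \<Rightarrow> 'u) \<Rightarrow> ('u \<Rightarrow> 'u \<Rightarrow> 'u) \<Rightarrow> bool" where
  "system_morphism R I r M g N h f \<longleftrightarrow>
     (\<forall>i\<in>I. f i \<in> Mod_hom R (M i) (N i)) \<and>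
     (\<forall>(i, j)\<in>r. compose (carrier (M i)) (h i j) (f i) = compose (carrier (M i)) (f j) (g i j))"

definition cocone ::
  "('r, 's) ring_scheme \<Rightarrow> 'u set \<Rightarrow> 'u rel \<Rightarrow>
   ('u \<Rightarrow> ('r, 'u) module) \<Rightarrow> ('u \<Rightarrow> 'u \<Rightarrow> 'u \<Rightarrow> 'u) \<Rightarrow>
   ('r, 'u) module \<Rightarrow> ('u \<Rightarrow> 'u \<Rightarrow> 'u) \<Rightarrow> bool" where
  "cocone R I r M g L \<mu> \<longleftrightarrow>
     Mod_obj R L \<and>
     (\<forall>i\<in>I. \<mu> i \<in> Mod_hom R (M i) L) \<and>
     (\<forall>(i, j)\<in>r. compose (carrier (M i)) (\<mu> j) (g i j) = \<mu> i)"

definition direct_limit ::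
  "('r, 's) ring_scheme \<Rightarrow> 'u set \<Rightarrow> 'u rel \<Rightarrow>
   ('u \<Rightarrow> ('r, 'u) module) \<Rightarrow> ('u \<Rightarrow> 'u \<Rightarrow> 'u \<Rightarrow> 'u) \<Rightarrow>
   ('r, 'u) module \<Rightarrow> ('u \<Rightarrow> 'u \<Rightarrow> 'u) \<Rightarrow> bool" where
  "direct_limit R I r M g L \<mu> \<longleftrightarrow>
     cocone R I r M g L \<mu> \<and>
     (\<forall>X \<xi>. cocone R I r M g X \<xi> \<longrightarrow>
        (\<exists>!u. u \<in> Mod_hom R L X \<and> (\<forall>i\<in>I. compose (carrier (M i)) u (\<mu> i) = \<xi> i)))"

text \<open>
  \<open>limit_morphism R I r M g N h f (A, \<phi>, B)\<close>: \<open>A\<close> and \<open>B\<close> are direct limits of the two systems,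
  with respect to some limit cocones, and \<open>\<phi>\<close> is the morphism induced by \<open>f\<close>. Direct limits are
  thus understood up to isomorphism.
\<close>

definition limit_morphism ::
  "('r, 's) ring_scheme \<Rightarrow> 'u set \<Rightarrow> 'u rel \<Rightarrow>
   ('u \<Rightarrow> ('r, 'u) module) \<Rightarrow> ('u \<Rightarrow> 'u \<Rightarrow> 'u \<Rightarrow> 'u) \<Rightarrow>
   ('u \<Rightarrow> ('r, 'u) module) \<Rightarrow> ('u \<Rightarrow> 'u \<Rightarrow> 'u \<Rightarrow> 'u) \<Rightarrow> ('u \<Rightarrow> 'u \<Rightarrow> 'u) \<Rightarrow>
   ('r, 'u) morphism \<Rightarrow> bool" where
  "limit_morphism R I r M g N h f = (\<lambda>(A, \<phi>, B).
     directed_set I r \<and> directed_system R I r M g \<and> directed_system R I r N h \<and>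
     system_morphism R I r M g N h f \<and>
     (\<exists>\<mu> \<nu>. direct_limit R I r M g A \<mu> \<and> direct_limit R I r N h B \<nu> \<and>
        \<phi> \<in> Mod_hom R A B \<and>
        (\<forall>i\<in>I. compose (carrier (M i)) \<phi> (\<mu> i) = compose (carrier (M i)) (\<nu> i) (f i))))"

definition closed_under_direct_limits ::
  "('r, 's) ring_scheme \<Rightarrow> ('r, 'u) morphism set \<Rightarrow> bool" where
  "closed_under_direct_limits R \<I> \<longleftrightarrow>
     (\<forall>I r M g N h f F.
        limit_morphism R I r M g N h f F \<and> (\<forall>i\<in>I. (M i, f i, N i) \<in> \<I>) \<longrightarrow> F \<in> \<I>)"

definition is_closure_under_direct_limits ::
  "('r, 's) ring_scheme \<Rightarrow> ('r, 'u) morphism set \<Rightarrow> ('r, 'u) morphism set \<Rightarrow> bool" where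
  "is_closure_under_direct_limits R \<I>0 \<I> \<longleftrightarrow>
     \<I>0 \<subseteq> \<I> \<and>
     (\<forall>F\<in>\<I>. \<exists>I r M g N h f.
        limit_morphism R I r M g N h f F \<and> (\<forall>i\<in>I. (M i, f i, N i) \<in> \<I>0))"


definition precover ::
  "('r, 's) ring_scheme \<Rightarrow> ('r, 'u) morphism set \<Rightarrow> ('r, 'u) morphism \<Rightarrow> bool" where
  "precover R \<I> = (\<lambda>(X, p, M). (X, p, M) \<in> \<I> \<and>
     (\<forall>X' p'. (X', p', M) \<in> \<I> \<longrightarrow> (\<exists>k\<in>Mod_hom R X' X. compose (carrier X') p k = p')))"

definition Mod_automorphism ::
  "('r, 's) ring_scheme \<Rightarrow> ('r, 'm) module \<Rightarrow> ('m \<Rightarrow> 'm) \<Rightarrow> bool" where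
  "Mod_automorphism R M j \<longleftrightarrow> j \<in> Mod_hom R M M \<and>
     (\<exists>k\<in>Mod_hom R M M.
        compose (carrier M) k j = Mod_id M \<and> compose (carrier M) j k = Mod_id M)"

definition cover ::
  "('r, 's) ring_scheme \<Rightarrow> ('r, 'u) morphism set \<Rightarrow> ('r, 'u) morphism \<Rightarrow> bool" where
  "cover R \<I> = (\<lambda>(X, p, M). precover R \<I> (X, p, M) \<and>
     (\<forall>j\<in>Mod_hom R X X. compose (carrier X) p j = p \<longrightarrow> Mod_automorphism R X j))"

definition covering_ideal ::
  "('r, 's) ring_scheme \<Rightarrow> ('r, 'u) morphism set \<Rightarrow> bool" where
  "covering_ideal R \<I> \<longleftrightarrow> Mod_ideal R \<I> \<and> (\<forall>M. Mod_obj R M \<longrightarrow> (\<exists>X p. cover R \<I> (X, p, M)))"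

end

theory Submission
  imports Defs
begin

text \<open>
  Fix a module \<open>M\<close> and call \<open>(X, f)\<close> an object over \<open>M\<close> if \<open>f : X \<rightarrow> M\<close> belongs to the ideal \<open>\<I>\<close>. Maps of
  such objects are the homomorphisms that commute with the maps to \<open>M\<close>. A precover of \<open>M\<close> is a weakly
  terminal object over \<open>M\<close>, and the proof finds one all of whose endomorphisms are bijective.

  \<^emph>\<open>Membership in \<open>\<I>\<close> is a local property.\<close> A module \<open>X\<close> is the direct limit of the modules that are presented
  by the finite sets \<open>E\<close> of linear equations which are true in \<open>X\<close>. As \<open>\<I>\<close> is closed under direct limits, a
  homomorphism \<open>f : X \<rightarrow> M\<close> is in \<open>\<I>\<close> as soon as its restriction to each of these finitely presented modules is,
  and for that it is enough that the restriction factors through some other object over \<open>M\<close>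
  (\<open>over_if_locally_over\<close>). A condition on finitely many elements and equations survives unions of
  chains: both the union of a chain of objects over \<open>M\<close> and the quotient of an object over \<open>M\<close> by the union of a
  chain of congruences are again over \<open>M\<close>.

  \<^emph>\<open>Rigid objects.\<close> Call an object over \<open>M\<close> rigid if every map from it to an object over \<open>M\<close> is
  injective. By Zorn's lemma, applied to the kernels of maps over \<open>M\<close>, every object over \<open>M\<close> has a map to a
  rigid one (\<open>rigid_quotient\<close>).

  \<^emph>\<open>Rigid objects are bounded in size.\<close> Let \<open>(X, f)\<close> be rigid and \<open>z \<noteq> 0\<close> in the kernel of \<open>f\<close>. Then \<open>X/Rz \<rightarrow> M\<close> is
  not in \<open>\<I>\<close>, and by locality this is witnessed by a finite system of equations that is solvable modulo
  \<open>Rz\<close>. The system, the images in \<open>M\<close> of its solution, and the coefficients of \<open>z\<close> in the error terms form a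
  label. There is only a small set of labels, independent of \<open>X\<close>. The elements \<open>z\<close> with a given label form a
  set \<open>D\<close> that is closed under \<open>x - y + z\<close> and does not contain \<open>0\<close>, so that the graph joining \<open>x\<close> and \<open>y\<close> when
  \<open>x - y \<in> D\<close> can be coloured with three colours (\<open>affine_colouring\<close>). The colours of \<open>x\<close> for all labels,
  together with \<open>f x\<close>, determine \<open>x\<close> (\<open>rigid_bounded\<close>).

  \<^emph>\<open>A maximal rigid object is a cover.\<close> Because of the bound, all rigid objects fit with room to spare
  into one small set, and the union of a chain of rigid objects is rigid. Zorn's lemma gives a rigid
  \<open>U\<close> such that every map from \<open>U\<close> to a rigid object is bijective (\<open>maximal_rigid\<close>). In particular the
  endomorphisms of \<open>U\<close> over \<open>M\<close> are automorphisms. Given any \<open>X'\<close> over \<open>M\<close>, a rigid quotient of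
  \<open>U \<oplus> X'\<close> receives a bijection from \<open>U\<close>, and its inverse yields a map \<open>X' \<rightarrow> U\<close> over \<open>M\<close>.
\<close>

section \<open>Small sets\<close>

lemma small_if_inj_on:
  assumes "small U B" and "inj_on f A" and "f ` A \<subseteq> B"
  shows "small U A"
  using ordLeq_ordLess_trans[OF card_of_ordLeqI[of f A B]] assms unfolding small_def
  by (simp add: image_subset_iff)

lemma small_subset: "small U B \<Longrightarrow> A \<subseteq> B \<Longrightarrow> small U A"
  by (rule small_if_inj_on[of U B id]) auto

lemma small_image: "small U A \<Longrightarrow> small U (f ` A)"
  unfolding small_def by (rule ordLeq_ordLess_trans[OF card_of_image])

lemma small_embedding:
  assumes "small TYPE('u) A"
  obtains e :: "'a \<Rightarrow> 'u" where "inj_on e A"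
proof -
  have "|A| \<le>o |UNIV :: 'u set|"
    using assms unfolding small_def by (rule ordLess_imp_ordLeq)
  then obtain e :: "'a \<Rightarrow> 'u" where "inj_on e A"
    unfolding card_of_ordLeq[symmetric] by blast
  then show ?thesis by (rule that)
qed

lemma small_Pow:
  assumes "universe TYPE('u)" and "small TYPE('u) A"
  shows "small TYPE('u) (Pow A)"
proof -
  obtain e :: "_ \<Rightarrow> 'u" where e: "inj_on e A" using small_embedding[OF assms(2)] by blast
  have "small TYPE('u) (Pow (e ` A))"
    using assms(1) small_image[OF assms(2), of e] unfolding universe_def by blast
  then show ?thesis
    by (rule small_if_inj_on[of _ _ "image e"]) (auto intro: inj_on_image_Pow[OF e])
qed

lemma small_nat:
  assumes "universe TYPE('u)"
  shows "small TYPE('u) (UNIV :: nat set)"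
proof -
  obtain A :: "'u set" where "infinite A" "small TYPE('u) A"
    using assms unfolding universe_def by blast
  then show ?thesis
    unfolding small_def infinite_iff_card_of_nat by (rule ordLeq_ordLess_trans)
qed

lemma small_Times:
  assumes "universe TYPE('u)" and "small TYPE('u) A" and "small TYPE('u) B"
  shows "small TYPE('u) (A \<times> B)"
proof -
  have U: "infinite (UNIV :: 'u set)"
    using assms(1) unfolding universe_def by (meson infinite_super subset_UNIV)
  have *: "small TYPE('u) (C \<times> C)" if C: "small TYPE('u) C" for C :: "'c set"
  proof (cases "finite C")
    case True
    then have "\<not> |UNIV :: 'u set| \<le>o |C \<times> C|" using U card_of_ordLeq_finite by blast
    then show ?thesis
      unfolding small_def by (simp add: not_ordLeq_iff_ordLess card_of_Well_order)
  next
    case False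
    then show ?thesis
      using ordIso_ordLess_trans[OF card_of_Times_same_infinite] C by (simp add: small_def)
  qed
  have "|A| \<le>o |B| \<or> |B| \<le>o |A|"
    by (rule ordLeq_total) (rule card_of_Well_order)+
  then show ?thesis
  proof
    assume "|A| \<le>o |B|"
    then have "|A \<times> B| \<le>o |B \<times> B|" by (rule card_of_Times_mono1)
    then show ?thesis using *[OF assms(3)] unfolding small_def by (rule ordLeq_ordLess_trans)
  next
    assume "|B| \<le>o |A|"
    then have "|A \<times> B| \<le>o |A \<times> A|" by (rule card_of_Times_mono2)
    then show ?thesis using *[OF assms(2)] unfolding small_def by (rule ordLeq_ordLess_trans)
  qed
qed

lemma small_lists:
  assumes "universe TYPE('u)" and "small TYPE('u) A"
  shows "small TYPE('u) (lists A)"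
proof (rule small_if_inj_on)
  show "small TYPE('u) (Pow ((UNIV :: nat set) \<times> A))"
    by (intro small_Pow small_Times small_nat assms)
  \<comment> \<open>a list is determined by the graph of its entries\<close>
  let ?f = "\<lambda>xs :: 'a list. {(i, xs ! i) |i. i < length xs}"
  show "inj_on ?f (lists A)"
  proof (rule inj_onI)
    fix xs ys :: "'a list"
    assume eq: "?f xs = ?f ys"
    have mem: "(i, x) \<in> ?f zs \<longleftrightarrow> i < length zs \<and> x = zs ! i" for i x zs by auto
    have *: "i < length xs \<and> x = xs ! i \<longleftrightarrow> i < length ys \<and> x = ys ! i" for i x
      using mem[of i x xs] mem[of i x ys] unfolding eq by blast
    then have "i < length xs \<longleftrightarrow> i < length ys" for i by blast
    then have "length xs = length ys" by (metis linorder_neqE_nat nat_less_le)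
    then show "xs = ys" using * by (metis nth_equalityI)
  qed
  show "?f ` lists A \<subseteq> Pow (UNIV \<times> A)" by auto
qed

lemma small_PiE:
  assumes "universe TYPE('u)" and "small TYPE('u) A" and "small TYPE('u) B"
  shows "small TYPE('u) (A \<rightarrow>\<^sub>E B)"
proof (rule small_if_inj_on)
  show "small TYPE('u) (Pow (A \<times> B))" by (intro small_Pow small_Times assms)
  let ?G = "\<lambda>f. {(x, f x) |x. x \<in> A}"
  show "inj_on ?G (A \<rightarrow>\<^sub>E B)"
  proof (rule inj_onI)
    fix f g assume fg: "f \<in> A \<rightarrow>\<^sub>E B" "g \<in> A \<rightarrow>\<^sub>E B" and eq: "?G f = ?G g"
    show "f = g"
    proof (rule PiE_ext[OF fg])
      fix x assume "x \<in> A"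
      then have "(x, f x) \<in> ?G g" unfolding eq[symmetric] by blast
      then show "f x = g x" by blast
    qed
  qed
  show "?G ` (A \<rightarrow>\<^sub>E B) \<subseteq> Pow (A \<times> B)" by auto
qed

text \<open>
  A set of equivalence classes of a small set over any type can be realised inside \<open>'u\<close>. This is how
  modules built over other types (terms, pairs) are turned into objects of \<open>R-Mod\<close>.
\<close>

lemma small_classes:
  assumes "small TYPE('u) A" and "equiv A \<theta>"
  obtains q :: "'a \<Rightarrow> 'u" where "\<And>x y. x \<in> A \<Longrightarrow> y \<in> A \<Longrightarrow> q x = q y \<longleftrightarrow> (x, y) \<in> \<theta>"
proof -
  obtain e :: "'a \<Rightarrow> 'u" where e: "inj_on e A" using small_embedding[OF assms(1)] by blast
  define c where "c x = (SOME y. y \<in> \<theta> `` {x})" for x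
  have c: "(x, c x) \<in> \<theta>" if "x \<in> A" for x
    using equiv_class_self[OF assms(2) that] someI[of "\<lambda>y. y \<in> \<theta> `` {x}" x]
    unfolding c_def by simp
  have sym: "sym \<theta>" and trans: "trans \<theta>" and sub: "\<theta> \<subseteq> A \<times> A"
    using assms(2) unfolding equiv_def by auto
  have "e (c x) = e (c y) \<longleftrightarrow> (x, y) \<in> \<theta>" if "x \<in> A" "y \<in> A" for x y
  proof
    assume "e (c x) = e (c y)"
    moreover have "c x \<in> A" "c y \<in> A" using c[OF that(1)] c[OF that(2)] sub by auto
    ultimately have "c x = c y" by (rule inj_onD[OF e])
    then show "(x, y) \<in> \<theta>"
      using transD[OF trans c[OF that(1)]] symD[OF sym c[OF that(2)]] by simp
  next
    assume "(x, y) \<in> \<theta>"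
    then have "\<theta> `` {x} = \<theta> `` {y}" by (rule equiv_class_eq[OF assms(2)])
    then show "e (c x) = e (c y)" by (simp add: c_def)
  qed
  from that[OF this] show ?thesis .
qed

section \<open>Homomorphisms, congruences and quotients\<close>

lemma Mod_homI:
  assumes "f \<in> carrier X \<rightarrow>\<^sub>E carrier Y"
    and "\<And>x y. x \<in> carrier X \<Longrightarrow> y \<in> carrier X \<Longrightarrow> f (x \<oplus>\<^bsub>X\<^esub> y) = f x \<oplus>\<^bsub>Y\<^esub> f y"
    and "\<And>a x. a \<in> carrier R \<Longrightarrow> x \<in> carrier X \<Longrightarrow> f (a \<odot>\<^bsub>X\<^esub> x) = a \<odot>\<^bsub>Y\<^esub> f x"
  shows "f \<in> Mod_hom R X Y"
  using assms unfolding Mod_hom_def by blast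

lemma
  assumes "f \<in> Mod_hom R X Y"
  shows Mod_hom_PiE: "f \<in> carrier X \<rightarrow>\<^sub>E carrier Y"
    and Mod_hom_closed: "x \<in> carrier X \<Longrightarrow> f x \<in> carrier Y"
    and Mod_hom_add: "x \<in> carrier X \<Longrightarrow> y \<in> carrier X \<Longrightarrow> f (x \<oplus>\<^bsub>X\<^esub> y) = f x \<oplus>\<^bsub>Y\<^esub> f y"
    and Mod_hom_smult: "a \<in> carrier R \<Longrightarrow> x \<in> carrier X \<Longrightarrow> f (a \<odot>\<^bsub>X\<^esub> x) = a \<odot>\<^bsub>Y\<^esub> f x"
  using assms unfolding Mod_hom_def by auto

lemma Mod_hom_eqI:
  assumes "f \<in> Mod_hom R X Y" and "g \<in> Mod_hom R X Z"
    and "\<And>x. x \<in> carrier X \<Longrightarrow> f x = g x"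
  shows "f = g"
  using Mod_hom_PiE[OF assms(1)] Mod_hom_PiE[OF assms(2)] assms(3)
  by (intro extensionalityI[of f "carrier X" g]) (auto simp: PiE_def)

text \<open>
  Quotients are formed of structures which satisfy the module laws only up to a congruence, as is the
  case for an algebra of terms. The predicate below is what such a raw structure satisfies on its own.
\<close>

definition op_closed :: "('r, 's) ring_scheme \<Rightarrow> ('r, 'm) module \<Rightarrow> bool" where
  "op_closed R A \<longleftrightarrow> \<zero>\<^bsub>A\<^esub> \<in> carrier A \<and>
     (\<forall>x\<in>carrier A. \<forall>y\<in>carrier A. x \<oplus>\<^bsub>A\<^esub> y \<in> carrier A) \<and>
     (\<forall>a\<in>carrier R. \<forall>x\<in>carrier A. a \<odot>\<^bsub>A\<^esub> x \<in> carrier A)"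

lemma left_module_op_closed:
  assumes "left_module R X" shows "op_closed R X"
proof -
  interpret X: left_module R X by fact
  show ?thesis unfolding op_closed_def by (auto simp: X.smult_closed)
qed

lemma Mod_hom_compose:
  assumes "f \<in> Mod_hom R X Y" and "g \<in> Mod_hom R Y Z" and "op_closed R X"
  shows "compose (carrier X) g f \<in> Mod_hom R X Z"
  using assms by (intro Mod_homI)
    (auto simp: compose_def op_closed_def Mod_hom_closed Mod_hom_add Mod_hom_smult)

lemma Mod_hom_id: "op_closed R X \<Longrightarrow> Mod_id X \<in> Mod_hom R X X"
  by (intro Mod_homI) (auto simp: Mod_id_def op_closed_def)

lemma Mod_hom_zero:
  assumes "left_module R X" and "left_module R Y" and "f \<in> Mod_hom R X Y"
  shows "f \<zero>\<^bsub>X\<^esub> = \<zero>\<^bsub>Y\<^esub>"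
proof -
  interpret X: left_module R X by fact
  interpret Y: left_module R Y by fact
  have "f \<zero>\<^bsub>X\<^esub> \<oplus>\<^bsub>Y\<^esub> f \<zero>\<^bsub>X\<^esub> = f \<zero>\<^bsub>X\<^esub>"
    by (metis Mod_hom_add[OF assms(3)] X.M.zero_closed X.M.r_zero)
  then show ?thesis using Mod_hom_closed[OF assms(3)]
    by (metis X.M.zero_closed Y.M.add.l_cancel_one' Y.M.zero_closed)
qed

lemma left_module_zero_smult:
  assumes "left_module R X" and "x \<in> carrier X"
  shows "\<zero>\<^bsub>R\<^esub> \<odot>\<^bsub>X\<^esub> x = \<zero>\<^bsub>X\<^esub>"
proof -
  interpret X: left_module R X by fact
  have "\<zero>\<^bsub>R\<^esub> \<odot>\<^bsub>X\<^esub> x = \<zero>\<^bsub>R\<^esub> \<odot>\<^bsub>X\<^esub> x \<oplus>\<^bsub>X\<^esub> \<zero>\<^bsub>R\<^esub> \<odot>\<^bsub>X\<^esub> x"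
    using assms(2) X.smult_l_distr[of "\<zero>\<^bsub>R\<^esub>" "\<zero>\<^bsub>R\<^esub>" x] by simp
  then show ?thesis
    using assms(2) X.smult_closed[of "\<zero>\<^bsub>R\<^esub>" x] by (metis X.M.add.l_cancel_one X.R.zero_closed)
qed

lemma left_module_smult_zero:
  assumes "left_module R X" and "a \<in> carrier R"
  shows "a \<odot>\<^bsub>X\<^esub> \<zero>\<^bsub>X\<^esub> = \<zero>\<^bsub>X\<^esub>"
proof -
  interpret X: left_module R X by fact
  have "a \<odot>\<^bsub>X\<^esub> \<zero>\<^bsub>X\<^esub> = a \<odot>\<^bsub>X\<^esub> \<zero>\<^bsub>X\<^esub> \<oplus>\<^bsub>X\<^esub> a \<odot>\<^bsub>X\<^esub> \<zero>\<^bsub>X\<^esub>"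
    using assms(2) X.smult_r_distr[of a "\<zero>\<^bsub>X\<^esub>" "\<zero>\<^bsub>X\<^esub>"] by simp
  then show ?thesis
    using assms(2) X.smult_closed[of a "\<zero>\<^bsub>X\<^esub>"] by (metis X.M.add.l_cancel_one X.M.zero_closed)
qed

lemma left_module_minus:
  assumes "left_module R X" and "x \<in> carrier X"
  shows "(\<ominus>\<^bsub>R\<^esub> \<one>\<^bsub>R\<^esub>) \<odot>\<^bsub>X\<^esub> x = \<ominus>\<^bsub>X\<^esub> x"
proof -
  interpret X: left_module R X by fact
  have "(\<ominus>\<^bsub>R\<^esub> \<one>\<^bsub>R\<^esub>) \<odot>\<^bsub>X\<^esub> x \<oplus>\<^bsub>X\<^esub> x = (\<ominus>\<^bsub>R\<^esub> \<one>\<^bsub>R\<^esub> \<oplus>\<^bsub>R\<^esub> \<one>\<^bsub>R\<^esub>) \<odot>\<^bsub>X\<^esub> x"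
    using assms(2) by (simp add: X.smult_l_distr X.smult_one)
  also have "\<dots> = \<zero>\<^bsub>X\<^esub>"
    using left_module_zero_smult[OF assms] by (simp add: X.R.l_neg)
  finally show ?thesis
    using assms(2) by (simp add: X.M.minus_equality X.smult_closed)
qed

lemma Mod_hom_minus:
  assumes "left_module R X" and "left_module R Y" and "f \<in> Mod_hom R X Y" and "x \<in> carrier X"
  shows "f (\<ominus>\<^bsub>X\<^esub> x) = \<ominus>\<^bsub>Y\<^esub> f x"
proof -
  interpret X: left_module R X by fact
  show ?thesis
    using Mod_hom_smult[OF assms(3) _ assms(4), of "\<ominus>\<^bsub>R\<^esub> \<one>\<^bsub>R\<^esub>"]
      left_module_minus[OF assms(1,4)] left_module_minus[OF assms(2) Mod_hom_closed[OF assms(3,4)]]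
    by simp
qed

lemma Mod_hom_diff:
  assumes "left_module R X" and "left_module R Y" and "f \<in> Mod_hom R X Y"
    and "x \<in> carrier X" and "y \<in> carrier X"
  shows "f (x \<ominus>\<^bsub>X\<^esub> y) = f x \<ominus>\<^bsub>Y\<^esub> f y"
proof -
  interpret X: left_module R X by fact
  show ?thesis
    unfolding a_minus_def using assms by (simp add: Mod_hom_add[OF assms(3)] Mod_hom_minus)
qed

text \<open>
  The map on \<open>q ` carrier A\<close> through which \<open>\<phi>\<close> factors, provided that \<open>q\<close> identifies no more elements than \<open>\<phi>\<close>
  does.
\<close>

definition factor :: "('r, 'm) module \<Rightarrow> ('m \<Rightarrow> 'n) \<Rightarrow> ('m \<Rightarrow> 'k) \<Rightarrow> 'n \<Rightarrow> 'k" where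
  "factor A q \<phi> = (\<lambda>u\<in>q ` carrier A. \<phi> (inv_into (carrier A) q u))"

lemma factor_apply:
  assumes "\<And>s t. s \<in> carrier A \<Longrightarrow> t \<in> carrier A \<Longrightarrow> q s = q t \<Longrightarrow> \<phi> s = \<phi> t"
    and "t \<in> carrier A"
  shows "factor A q \<phi> (q t) = \<phi> t"
proof -
  have "\<phi> (inv_into (carrier A) q (q t)) = \<phi> t"
    using assms(2) by (intro assms(1) inv_into_into f_inv_into_f) simp_all
  then show ?thesis using assms(2) by (simp add: factor_def)
qed

lemma factor_Mod_hom:
  assumes "op_closed R A" and "q \<in> Mod_hom R A Q" and "q ` carrier A = carrier Q"
    and "\<phi> \<in> Mod_hom R A Y"
    and "\<And>s t. s \<in> carrier A \<Longrightarrow> t \<in> carrier A \<Longrightarrow> q s = q t \<Longrightarrow> \<phi> s = \<phi> t"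
  shows "factor A q \<phi> \<in> Mod_hom R Q Y"
proof (rule Mod_homI)
  note fa = factor_apply[of A q \<phi>, OF assms(5)]
  show "factor A q \<phi> \<in> carrier Q \<rightarrow>\<^sub>E carrier Y"
    using Mod_hom_closed[OF assms(4)] assms(3) unfolding factor_def
    by (auto simp: inv_into_into)
  fix u assume u: "u \<in> carrier Q"
  then obtain x where x: "x \<in> carrier A" "u = q x" using assms(3) by blast
  {
    fix v assume "v \<in> carrier Q"
    then obtain y where y: "y \<in> carrier A" "v = q y" using assms(3) by blast
    have c: "x \<oplus>\<^bsub>A\<^esub> y \<in> carrier A" using x y assms(1) unfolding op_closed_def by blast
    have "u \<oplus>\<^bsub>Q\<^esub> v = q (x \<oplus>\<^bsub>A\<^esub> y)" using x y Mod_hom_add[OF assms(2)] by simp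
    then show "factor A q \<phi> (u \<oplus>\<^bsub>Q\<^esub> v) = factor A q \<phi> u \<oplus>\<^bsub>Y\<^esub> factor A q \<phi> v"
      using x y c Mod_hom_add[OF assms(4)] by (simp add: fa)
  }
  fix a assume a: "a \<in> carrier R"
  have c: "a \<odot>\<^bsub>A\<^esub> x \<in> carrier A" using x a assms(1) unfolding op_closed_def by blast
  have "a \<odot>\<^bsub>Q\<^esub> u = q (a \<odot>\<^bsub>A\<^esub> x)" using x a Mod_hom_smult[OF assms(2)] by simp
  then show "factor A q \<phi> (a \<odot>\<^bsub>Q\<^esub> u) = a \<odot>\<^bsub>Y\<^esub> factor A q \<phi> u"
    using x a c Mod_hom_smult[OF assms(4)] by (simp add: fa)
qed

lemma Mod_hom_inverse:
  assumes "left_module R X" and k: "k \<in> Mod_hom R X Y" "inj_on k (carrier X)" "k ` carrier X = carrier Y"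
  obtains k' where "k' \<in> Mod_hom R Y X" "\<And>x. x \<in> carrier X \<Longrightarrow> k' (k x) = x" "\<And>y. y \<in> carrier Y \<Longrightarrow> k (k' y) = y"
proof -
  note op = left_module_op_closed[OF assms(1)]
  have eq: "Mod_id X s = Mod_id X t" if "s \<in> carrier X" "t \<in> carrier X" "k s = k t" for s t
    using inj_onD[OF k(2) that(3,1,2)] by simp
  let ?k = "factor X k (Mod_id X)"
  have kx: "?k (k x) = x" if "x \<in> carrier X" for x
  proof -
    have "?k (k x) = Mod_id X x" by (rule factor_apply[OF eq that])
    then show ?thesis using that by (simp add: Mod_id_def)
  qed
  show ?thesis
  proof (rule that[of ?k])
    show "?k \<in> Mod_hom R Y X" by (rule factor_Mod_hom[OF op k(1,3) Mod_hom_id[OF op] eq])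
    show "?k (k x) = x" if "x \<in> carrier X" for x using that by (rule kx)
    show "k (?k y) = y" if "y \<in> carrier Y" for y
      using that kx k(3) by (metis imageE)
  qed
qed

text \<open>The structure that a map \<open>q\<close> transports from \<open>A\<close> to its image.\<close>

definition image_module :: "('r, 'm) module \<Rightarrow> ('m \<Rightarrow> 'n) \<Rightarrow> ('r, 'n) module" where
  "image_module A q =
     \<lparr>carrier = q ` carrier A, mult = undefined, one = undefined, zero = q \<zero>\<^bsub>A\<^esub>,
      add = (\<lambda>u v. q (inv_into (carrier A) q u \<oplus>\<^bsub>A\<^esub> inv_into (carrier A) q v)),
      smult = (\<lambda>a u. q (a \<odot>\<^bsub>A\<^esub> inv_into (carrier A) q u))\<rparr>"

definition congruence :: "('r, 's) ring_scheme \<Rightarrow> ('r, 'm) module \<Rightarrow> ('m \<times> 'm) set \<Rightarrow> bool" where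
  "congruence R A \<theta> \<longleftrightarrow> equiv (carrier A) \<theta> \<and>
     (\<forall>(x, x')\<in>\<theta>. \<forall>(y, y')\<in>\<theta>. (x \<oplus>\<^bsub>A\<^esub> y, x' \<oplus>\<^bsub>A\<^esub> y') \<in> \<theta>) \<and>
     (\<forall>a\<in>carrier R. \<forall>(x, x')\<in>\<theta>. (a \<odot>\<^bsub>A\<^esub> x, a \<odot>\<^bsub>A\<^esub> x') \<in> \<theta>)"

definition module_laws :: "('r, 's) ring_scheme \<Rightarrow> ('r, 'm) module \<Rightarrow> ('m \<times> 'm) set \<Rightarrow> bool" where
  "module_laws R A \<theta> \<longleftrightarrow>
     (\<forall>x\<in>carrier A. \<forall>y\<in>carrier A. \<forall>z\<in>carrier A.
        (x \<oplus>\<^bsub>A\<^esub> y \<oplus>\<^bsub>A\<^esub> z, x \<oplus>\<^bsub>A\<^esub> (y \<oplus>\<^bsub>A\<^esub> z)) \<in> \<theta>) \<and>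
     (\<forall>x\<in>carrier A. \<forall>y\<in>carrier A. (x \<oplus>\<^bsub>A\<^esub> y, y \<oplus>\<^bsub>A\<^esub> x) \<in> \<theta>) \<and>
     (\<forall>x\<in>carrier A. (\<zero>\<^bsub>A\<^esub> \<oplus>\<^bsub>A\<^esub> x, x) \<in> \<theta>) \<and>
     (\<forall>x\<in>carrier A. \<exists>y\<in>carrier A. (y \<oplus>\<^bsub>A\<^esub> x, \<zero>\<^bsub>A\<^esub>) \<in> \<theta>) \<and>
     (\<forall>a\<in>carrier R. \<forall>b\<in>carrier R. \<forall>x\<in>carrier A.
        ((a \<oplus>\<^bsub>R\<^esub> b) \<odot>\<^bsub>A\<^esub> x, a \<odot>\<^bsub>A\<^esub> x \<oplus>\<^bsub>A\<^esub> b \<odot>\<^bsub>A\<^esub> x) \<in> \<theta>) \<and>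
     (\<forall>a\<in>carrier R. \<forall>x\<in>carrier A. \<forall>y\<in>carrier A.
        (a \<odot>\<^bsub>A\<^esub> (x \<oplus>\<^bsub>A\<^esub> y), a \<odot>\<^bsub>A\<^esub> x \<oplus>\<^bsub>A\<^esub> a \<odot>\<^bsub>A\<^esub> y) \<in> \<theta>) \<and>
     (\<forall>a\<in>carrier R. \<forall>b\<in>carrier R. \<forall>x\<in>carrier A.
        ((a \<otimes>\<^bsub>R\<^esub> b) \<odot>\<^bsub>A\<^esub> x, a \<odot>\<^bsub>A\<^esub> (b \<odot>\<^bsub>A\<^esub> x)) \<in> \<theta>) \<and>
     (\<forall>x\<in>carrier A. (\<one>\<^bsub>R\<^esub> \<odot>\<^bsub>A\<^esub> x, x) \<in> \<theta>)"

lemma left_module_laws: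
  assumes "left_module R X" and "refl_on (carrier X) \<theta>" shows "module_laws R X \<theta>"
proof -
  interpret X: left_module R X by fact
  have r: "x = y \<Longrightarrow> x \<in> carrier X \<Longrightarrow> (x, y) \<in> \<theta>" for x y
    using assms(2) unfolding refl_on_def by auto
  have neg: "\<exists>y\<in>carrier X. (y \<oplus>\<^bsub>X\<^esub> x, \<zero>\<^bsub>X\<^esub>) \<in> \<theta>" if "x \<in> carrier X" for x
    using that by (intro bexI[of _ "\<ominus>\<^bsub>X\<^esub> x"] r) (simp_all add: X.M.l_neg)
  show ?thesis unfolding module_laws_def
  proof (intro conjI ballI)
    fix x y assume "x \<in> carrier X" "y \<in> carrier X"
    then show "(x \<oplus>\<^bsub>X\<^esub> y, y \<oplus>\<^bsub>X\<^esub> x) \<in> \<theta>" by (intro r X.M.a_comm) simp_all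
  qed (rule neg r; simp add: X.M.a_assoc X.smult_closed X.smult_l_distr X.smult_r_distr
        X.smult_assoc X.smult_one)+
qed

lemma left_module_image:
  assumes R: "ring R" and A: "op_closed R A" and th: "congruence R A \<theta>" and L: "module_laws R A \<theta>"
    and q: "\<And>x y. x \<in> carrier A \<Longrightarrow> y \<in> carrier A \<Longrightarrow> q x = q y \<longleftrightarrow> (x, y) \<in> \<theta>"
  shows "left_module R (image_module A q)"
    and "restrict q (carrier A) \<in> Mod_hom R A (image_module A q)"
proof -
  let ?I = "image_module A q" and ?i = "inv_into (carrier A) q"
  have i: "?i (q x) \<in> carrier A" "(?i (q x), x) \<in> \<theta>" if "x \<in> carrier A" for x
    using that q[of "?i (q x)" x] by (simp_all add: inv_into_into f_inv_into_f)
  have cl: "\<zero>\<^bsub>A\<^esub> \<in> carrier A"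
    "\<And>x y. x \<in> carrier A \<Longrightarrow> y \<in> carrier A \<Longrightarrow> x \<oplus>\<^bsub>A\<^esub> y \<in> carrier A"
    "\<And>a x. a \<in> carrier R \<Longrightarrow> x \<in> carrier A \<Longrightarrow> a \<odot>\<^bsub>A\<^esub> x \<in> carrier A"
    using A unfolding op_closed_def by auto
  have car: "carrier ?I = q ` carrier A" "\<zero>\<^bsub>?I\<^esub> = q \<zero>\<^bsub>A\<^esub>"
    by (simp_all add: image_module_def)
  have add: "q x \<oplus>\<^bsub>?I\<^esub> q y = q (x \<oplus>\<^bsub>A\<^esub> y)" if "x \<in> carrier A" "y \<in> carrier A" for x y
  proof -
    have "(?i (q x) \<oplus>\<^bsub>A\<^esub> ?i (q y), x \<oplus>\<^bsub>A\<^esub> y) \<in> \<theta>"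
      using i that th unfolding congruence_def by blast
    then show ?thesis using that i cl q by (simp add: image_module_def)
  qed
  have sm: "a \<odot>\<^bsub>?I\<^esub> q x = q (a \<odot>\<^bsub>A\<^esub> x)" if "a \<in> carrier R" "x \<in> carrier A" for a x
  proof -
    have "(a \<odot>\<^bsub>A\<^esub> ?i (q x), a \<odot>\<^bsub>A\<^esub> x) \<in> \<theta>"
      using i that th unfolding congruence_def by blast
    then show ?thesis using that i cl q by (simp add: image_module_def)
  qed
  note ops = car add sm cl
  have laws:
    "\<And>x y z. x \<in> carrier A \<Longrightarrow> y \<in> carrier A \<Longrightarrow> z \<in> carrier A \<Longrightarrow>
        q (x \<oplus>\<^bsub>A\<^esub> y \<oplus>\<^bsub>A\<^esub> z) = q (x \<oplus>\<^bsub>A\<^esub> (y \<oplus>\<^bsub>A\<^esub> z))"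
    "\<And>x y. x \<in> carrier A \<Longrightarrow> y \<in> carrier A \<Longrightarrow> q (x \<oplus>\<^bsub>A\<^esub> y) = q (y \<oplus>\<^bsub>A\<^esub> x)"
    "\<And>x. x \<in> carrier A \<Longrightarrow> q (\<zero>\<^bsub>A\<^esub> \<oplus>\<^bsub>A\<^esub> x) = q x"
    "\<And>x. x \<in> carrier A \<Longrightarrow> \<exists>y\<in>carrier A. q (y \<oplus>\<^bsub>A\<^esub> x) = q \<zero>\<^bsub>A\<^esub>"
    "\<And>a b x. a \<in> carrier R \<Longrightarrow> b \<in> carrier R \<Longrightarrow> x \<in> carrier A \<Longrightarrow>
       q ((a \<oplus>\<^bsub>R\<^esub> b) \<odot>\<^bsub>A\<^esub> x) = q (a \<odot>\<^bsub>A\<^esub> x \<oplus>\<^bsub>A\<^esub> b \<odot>\<^bsub>A\<^esub> x)"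
    "\<And>a x y. a \<in> carrier R \<Longrightarrow> x \<in> carrier A \<Longrightarrow> y \<in> carrier A \<Longrightarrow>
       q (a \<odot>\<^bsub>A\<^esub> (x \<oplus>\<^bsub>A\<^esub> y)) = q (a \<odot>\<^bsub>A\<^esub> x \<oplus>\<^bsub>A\<^esub> a \<odot>\<^bsub>A\<^esub> y)"
    "\<And>a b x. a \<in> carrier R \<Longrightarrow> b \<in> carrier R \<Longrightarrow> x \<in> carrier A \<Longrightarrow>
       q ((a \<otimes>\<^bsub>R\<^esub> b) \<odot>\<^bsub>A\<^esub> x) = q (a \<odot>\<^bsub>A\<^esub> (b \<odot>\<^bsub>A\<^esub> x))"
    "\<And>x. x \<in> carrier A \<Longrightarrow> q (\<one>\<^bsub>R\<^esub> \<odot>\<^bsub>A\<^esub> x) = q x"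
    using L cl ring.ring_simprules(1,6)[OF R] ring.ring_simprules(5)[OF R] monoid.m_closed[OF ring.is_monoid[OF R]]
    unfolding module_laws_def by (simp_all add: q)
  have "abelian_group ?I"
  proof (rule abelian_groupI)
    fix u assume "u \<in> carrier ?I"
    then obtain x where x: "x \<in> carrier A" "u = q x" using car by auto
    show "\<zero>\<^bsub>?I\<^esub> \<oplus>\<^bsub>?I\<^esub> u = u" using x laws(3) by (simp add: ops)
    show "\<exists>v\<in>carrier ?I. v \<oplus>\<^bsub>?I\<^esub> u = \<zero>\<^bsub>?I\<^esub>" using x laws(4)[of x] by (auto simp: ops)
    fix v assume "v \<in> carrier ?I"
    then obtain y where y: "y \<in> carrier A" "v = q y" using car by auto
    show "u \<oplus>\<^bsub>?I\<^esub> v \<in> carrier ?I" using x y by (simp add: ops)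
    show "u \<oplus>\<^bsub>?I\<^esub> v = v \<oplus>\<^bsub>?I\<^esub> u" using x y laws(2) by (simp add: ops)
    fix w assume "w \<in> carrier ?I"
    then obtain z where z: "z \<in> carrier A" "w = q z" using car by auto
    show "u \<oplus>\<^bsub>?I\<^esub> v \<oplus>\<^bsub>?I\<^esub> w = u \<oplus>\<^bsub>?I\<^esub> (v \<oplus>\<^bsub>?I\<^esub> w)"
      using x y z laws(1) by (simp add: ops)
  qed (simp add: ops)
  moreover have "left_module_axioms R ?I"
  proof
    fix a u assume a: "a \<in> carrier R" and "u \<in> carrier ?I"
    then obtain x where x: "x \<in> carrier A" "u = q x" using car by auto
    show "a \<odot>\<^bsub>?I\<^esub> u \<in> carrier ?I" using a x by (simp add: ops)
    {
      fix b assume b: "b \<in> carrier R"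
      show "(a \<oplus>\<^bsub>R\<^esub> b) \<odot>\<^bsub>?I\<^esub> u = a \<odot>\<^bsub>?I\<^esub> u \<oplus>\<^bsub>?I\<^esub> b \<odot>\<^bsub>?I\<^esub> u"
        using a b x laws(5) ring.ring_simprules(1)[OF R] by (simp add: ops)
      show "(a \<otimes>\<^bsub>R\<^esub> b) \<odot>\<^bsub>?I\<^esub> u = a \<odot>\<^bsub>?I\<^esub> (b \<odot>\<^bsub>?I\<^esub> u)"
        using a b x laws(7) monoid.m_closed[OF ring.is_monoid[OF R]] by (simp add: ops)
    }
    fix v assume "v \<in> carrier ?I"
    then obtain y where y: "y \<in> carrier A" "v = q y" using car by auto
    show "a \<odot>\<^bsub>?I\<^esub> (u \<oplus>\<^bsub>?I\<^esub> v) = a \<odot>\<^bsub>?I\<^esub> u \<oplus>\<^bsub>?I\<^esub> a \<odot>\<^bsub>?I\<^esub> v"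
      using a x y laws(6) by (simp add: ops)
  next
    fix u assume "u \<in> carrier ?I"
    then obtain x where x: "x \<in> carrier A" "u = q x" using car by auto
    then show "\<one>\<^bsub>R\<^esub> \<odot>\<^bsub>?I\<^esub> u = u" using laws(8) monoid.one_closed[OF ring.is_monoid[OF R]] by (simp add: ops)
  qed
  ultimately show "left_module R ?I" using R by (simp add: left_module_def)
  show "restrict q (carrier A) \<in> Mod_hom R A ?I"
    by (rule Mod_homI) (auto simp: ops)
qed

lemma small_quotient:
  assumes "ring R" and "small TYPE('u) (carrier A)" and "op_closed R A"
    and th: "congruence R A \<theta>" and "module_laws R A \<theta>"
  obtains Q :: "('r, 'u) module" and q where "Mod_obj R Q" "q \<in> Mod_hom R A Q"
    "q ` carrier A = carrier Q"
    "\<And>x y. x \<in> carrier A \<Longrightarrow> y \<in> carrier A \<Longrightarrow> q x = q y \<longleftrightarrow> (x, y) \<in> \<theta>"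
proof -
  have "equiv (carrier A) \<theta>" using th unfolding congruence_def by blast
  then obtain q :: "_ \<Rightarrow> 'u" where q: "\<And>x y. x \<in> carrier A \<Longrightarrow> y \<in> carrier A \<Longrightarrow> q x = q y \<longleftrightarrow> (x, y) \<in> \<theta>"
    using small_classes[OF assms(2)] by blast
  note im = left_module_image[OF assms(1,3,4,5) q]
  show ?thesis
  proof (rule that[OF _ im(2)])
    show "Mod_obj R (image_module A q)"
      using im(1) small_image[OF assms(2), of q] by (simp add: Mod_obj_def image_module_def)
  qed (auto simp: q image_module_def)
qed

text \<open>
  The module laws hold modulo any congruence that is cut out by homomorphisms to modules. So no
  computation with representatives is needed to see that terms modulo the consequences of some
  equations form a module, or that pairs do.
\<close>

lemma kernel_congruence:
  assumes A: "op_closed R A" and R: "ring R"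
    and \<Phi>: "\<And>Y \<phi>. (Y, \<phi>) \<in> \<Phi> \<Longrightarrow> left_module R Y \<and> \<phi> \<in> Mod_hom R A Y \<and> \<phi> \<zero>\<^bsub>A\<^esub> = \<zero>\<^bsub>Y\<^esub>"
  defines "\<theta> \<equiv> {(s, t). s \<in> carrier A \<and> t \<in> carrier A \<and> (\<forall>(Y, \<phi>)\<in>\<Phi>. \<phi> s = \<phi> t)}"
  shows "congruence R A \<theta>" and "module_laws R A \<theta>"
proof -
  have cl: "\<zero>\<^bsub>A\<^esub> \<in> carrier A"
    "\<And>x y. x \<in> carrier A \<Longrightarrow> y \<in> carrier A \<Longrightarrow> x \<oplus>\<^bsub>A\<^esub> y \<in> carrier A"
    "\<And>a x. a \<in> carrier R \<Longrightarrow> x \<in> carrier A \<Longrightarrow> a \<odot>\<^bsub>A\<^esub> x \<in> carrier A"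
    using A unfolding op_closed_def by auto
  have iff: "(s, t) \<in> \<theta> \<longleftrightarrow> s \<in> carrier A \<and> t \<in> carrier A \<and> (\<forall>Y \<phi>. (Y, \<phi>) \<in> \<Phi> \<longrightarrow> \<phi> s = \<phi> t)" for s t
    unfolding \<theta>_def by auto
  have hom: "\<phi> (x \<oplus>\<^bsub>A\<^esub> y) = \<phi> x \<oplus>\<^bsub>Y\<^esub> \<phi> y" "\<phi> (a \<odot>\<^bsub>A\<^esub> x) = a \<odot>\<^bsub>Y\<^esub> \<phi> x" "\<phi> x \<in> carrier Y"
      "\<phi> \<zero>\<^bsub>A\<^esub> = \<zero>\<^bsub>Y\<^esub>" "left_module R Y"
    if "(Y, \<phi>) \<in> \<Phi>" "x \<in> carrier A" "y \<in> carrier A" "a \<in> carrier R" for Y \<phi> x y a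
    using \<Phi>[OF that(1)] that(2-) by (auto simp: Mod_hom_def)
  interpret R: ring R by fact
  show "congruence R A \<theta>"
    unfolding congruence_def
  proof (intro conjI)
    have "trans \<theta>"
    proof (rule transI)
      fix x y z assume xy: "(x, y) \<in> \<theta>" and yz: "(y, z) \<in> \<theta>"
      have "\<phi> x = \<phi> z" if "(Y, \<phi>) \<in> \<Phi>" for Y \<phi>
        by (rule trans[of _ "\<phi> y"]) (use xy yz that iff in blast)+
      then show "(x, z) \<in> \<theta>" using xy yz by (simp add: iff)
    qed
    moreover have "sym \<theta>"
    proof (rule symI)
      fix x y assume xy: "(x, y) \<in> \<theta>"
      have "\<phi> y = \<phi> x" if "(Y, \<phi>) \<in> \<Phi>" for Y \<phi>
        by (rule sym) (use xy that iff in blast)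
      then show "(y, x) \<in> \<theta>" using xy by (simp add: iff)
    qed
    ultimately show "equiv (carrier A) \<theta>"
      unfolding equiv_def refl_on_def by (auto simp: iff)
    have "(x \<oplus>\<^bsub>A\<^esub> y, x' \<oplus>\<^bsub>A\<^esub> y') \<in> \<theta>" if x: "(x, x') \<in> \<theta>" and y: "(y, y') \<in> \<theta>" for x x' y y'
    proof -
      have "\<phi> (x \<oplus>\<^bsub>A\<^esub> y) = \<phi> (x' \<oplus>\<^bsub>A\<^esub> y')" if Y: "(Y, \<phi>) \<in> \<Phi>" for Y \<phi>
      proof -
        have "\<phi> x = \<phi> x'" "\<phi> y = \<phi> y'" using x y Y iff by blast+
        then show ?thesis using x y hom(1)[OF Y _ _ R.zero_closed] by (simp add: iff)
      qed
      then show ?thesis using x y by (simp add: iff cl)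
    qed
    then show "\<forall>(x, x')\<in>\<theta>. \<forall>(y, y')\<in>\<theta>. (x \<oplus>\<^bsub>A\<^esub> y, x' \<oplus>\<^bsub>A\<^esub> y') \<in> \<theta>" by blast
    have "(a \<odot>\<^bsub>A\<^esub> x, a \<odot>\<^bsub>A\<^esub> x') \<in> \<theta>" if x: "(x, x') \<in> \<theta>" and a: "a \<in> carrier R" for a x x'
    proof -
      have "\<phi> (a \<odot>\<^bsub>A\<^esub> x) = \<phi> (a \<odot>\<^bsub>A\<^esub> x')" if Y: "(Y, \<phi>) \<in> \<Phi>" for Y \<phi>
      proof -
        have "\<phi> x = \<phi> x'" using x Y iff by blast
        then show ?thesis using x a hom(2)[OF Y _ cl(1)] by (simp add: iff)
      qed
      then show ?thesis using x a by (simp add: iff cl)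
    qed
    then show "\<forall>a\<in>carrier R. \<forall>(x, x')\<in>\<theta>. (a \<odot>\<^bsub>A\<^esub> x, a \<odot>\<^bsub>A\<^esub> x') \<in> \<theta>" by blast
  qed
  have I: "(s, t) \<in> \<theta>" if "s \<in> carrier A" "t \<in> carrier A"
    "\<And>Y \<phi>. (Y, \<phi>) \<in> \<Phi> \<Longrightarrow> left_module R Y \<Longrightarrow> \<phi> s = \<phi> t" for s t
    using that \<Phi> by (auto simp: iff)
  note homs = hom(1)[OF _ _ _ R.zero_closed] hom(2)[OF _ _ cl(1)] hom(3)[OF _ _ cl(1) R.zero_closed]
    hom(4)[OF _ cl(1) cl(1) R.zero_closed]
  show "module_laws R A \<theta>"
    unfolding module_laws_def
  proof (intro conjI ballI)
    fix x assume x: "x \<in> carrier A"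
    show "\<exists>y\<in>carrier A. (y \<oplus>\<^bsub>A\<^esub> x, \<zero>\<^bsub>A\<^esub>) \<in> \<theta>"
    proof (rule bexI[of _ "(\<ominus>\<^bsub>R\<^esub> \<one>\<^bsub>R\<^esub>) \<odot>\<^bsub>A\<^esub> x"], rule I)
      fix Y \<phi> assume Y: "(Y, \<phi>) \<in> \<Phi>" and M: "left_module R Y"
      interpret Y: left_module R Y by (rule M)
      show "\<phi> ((\<ominus>\<^bsub>R\<^esub> \<one>\<^bsub>R\<^esub>) \<odot>\<^bsub>A\<^esub> x \<oplus>\<^bsub>A\<^esub> x) = \<phi> \<zero>\<^bsub>A\<^esub>"
        using x by (simp add: homs[OF Y] cl left_module_minus[OF M] Y.M.l_neg)
    qed (use x cl in auto)
    show "(\<zero>\<^bsub>A\<^esub> \<oplus>\<^bsub>A\<^esub> x, x) \<in> \<theta>"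
    proof (rule I)
      fix Y \<phi> assume Y: "(Y, \<phi>) \<in> \<Phi>" and M: "left_module R Y"
      interpret Y: left_module R Y by (rule M)
      show "\<phi> (\<zero>\<^bsub>A\<^esub> \<oplus>\<^bsub>A\<^esub> x) = \<phi> x" using x by (simp add: homs[OF Y] cl)
    qed (use x cl in auto)
    show "(\<one>\<^bsub>R\<^esub> \<odot>\<^bsub>A\<^esub> x, x) \<in> \<theta>"
    proof (rule I)
      fix Y \<phi> assume Y: "(Y, \<phi>) \<in> \<Phi>" and M: "left_module R Y"
      interpret Y: left_module R Y by (rule M)
      show "\<phi> (\<one>\<^bsub>R\<^esub> \<odot>\<^bsub>A\<^esub> x) = \<phi> x" using x by (simp add: homs[OF Y] cl Y.smult_one)
    qed (use x cl in auto)
    fix y assume y: "y \<in> carrier A"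
    show "(x \<oplus>\<^bsub>A\<^esub> y, y \<oplus>\<^bsub>A\<^esub> x) \<in> \<theta>"
    proof (rule I)
      fix Y \<phi> assume Y: "(Y, \<phi>) \<in> \<Phi>" and M: "left_module R Y"
      interpret Y: left_module R Y by (rule M)
      show "\<phi> (x \<oplus>\<^bsub>A\<^esub> y) = \<phi> (y \<oplus>\<^bsub>A\<^esub> x)" using x y by (simp add: homs[OF Y] cl Y.M.a_comm)
    qed (use x y cl in auto)
    fix z assume z: "z \<in> carrier A"
    show "(x \<oplus>\<^bsub>A\<^esub> y \<oplus>\<^bsub>A\<^esub> z, x \<oplus>\<^bsub>A\<^esub> (y \<oplus>\<^bsub>A\<^esub> z)) \<in> \<theta>"
    proof (rule I)
      fix Y \<phi> assume Y: "(Y, \<phi>) \<in> \<Phi>" and M: "left_module R Y"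
      interpret Y: left_module R Y by (rule M)
      show "\<phi> (x \<oplus>\<^bsub>A\<^esub> y \<oplus>\<^bsub>A\<^esub> z) = \<phi> (x \<oplus>\<^bsub>A\<^esub> (y \<oplus>\<^bsub>A\<^esub> z))"
        using x y z by (simp add: homs[OF Y] cl Y.M.a_assoc)
    qed (use x y z cl in auto)
  next
    fix a x assume a: "a \<in> carrier R" and x: "x \<in> carrier A"
    {
      fix b assume b: "b \<in> carrier R"
      show "((a \<oplus>\<^bsub>R\<^esub> b) \<odot>\<^bsub>A\<^esub> x, a \<odot>\<^bsub>A\<^esub> x \<oplus>\<^bsub>A\<^esub> b \<odot>\<^bsub>A\<^esub> x) \<in> \<theta>"
      proof (rule I)
        fix Y \<phi> assume Y: "(Y, \<phi>) \<in> \<Phi>" and M: "left_module R Y"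
        interpret Y: left_module R Y by (rule M)
        show "\<phi> ((a \<oplus>\<^bsub>R\<^esub> b) \<odot>\<^bsub>A\<^esub> x) = \<phi> (a \<odot>\<^bsub>A\<^esub> x \<oplus>\<^bsub>A\<^esub> b \<odot>\<^bsub>A\<^esub> x)"
          using x a b by (simp add: homs[OF Y] cl Y.smult_l_distr)
      qed (use x a b cl in auto)
      show "((a \<otimes>\<^bsub>R\<^esub> b) \<odot>\<^bsub>A\<^esub> x, a \<odot>\<^bsub>A\<^esub> (b \<odot>\<^bsub>A\<^esub> x)) \<in> \<theta>"
      proof (rule I)
        fix Y \<phi> assume Y: "(Y, \<phi>) \<in> \<Phi>" and M: "left_module R Y"
        interpret Y: left_module R Y by (rule M)
        show "\<phi> ((a \<otimes>\<^bsub>R\<^esub> b) \<odot>\<^bsub>A\<^esub> x) = \<phi> (a \<odot>\<^bsub>A\<^esub> (b \<odot>\<^bsub>A\<^esub> x))"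
          using x a b by (simp add: homs[OF Y] cl Y.smult_assoc)
      qed (use x a b cl in auto)
    }
    fix y assume y: "y \<in> carrier A"
    show "(a \<odot>\<^bsub>A\<^esub> (x \<oplus>\<^bsub>A\<^esub> y), a \<odot>\<^bsub>A\<^esub> x \<oplus>\<^bsub>A\<^esub> a \<odot>\<^bsub>A\<^esub> y) \<in> \<theta>"
    proof (rule I)
      fix Y \<phi> assume Y: "(Y, \<phi>) \<in> \<Phi>" and M: "left_module R Y"
      interpret Y: left_module R Y by (rule M)
      show "\<phi> (a \<odot>\<^bsub>A\<^esub> (x \<oplus>\<^bsub>A\<^esub> y)) = \<phi> (a \<odot>\<^bsub>A\<^esub> x \<oplus>\<^bsub>A\<^esub> a \<odot>\<^bsub>A\<^esub> y)"
        using x a y by (simp add: homs[OF Y] cl Y.smult_r_distr)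
    qed (use x a y cl in auto)
  qed
qed

definition kern :: "('r, 'm) module \<Rightarrow> ('m \<Rightarrow> 'n) \<Rightarrow> ('m \<times> 'm) set" where
  "kern X k = {(x, y). x \<in> carrier X \<and> y \<in> carrier X \<and> k x = k y}"

lemma congruence_kern:
  assumes "left_module R X" and "left_module R Y" and "k \<in> Mod_hom R X Y"
  shows "congruence R X (kern X k)"
proof -
  interpret X: left_module R X by fact
  have "kern X k = {(s, t). s \<in> carrier X \<and> t \<in> carrier X \<and> (\<forall>(Y', \<phi>)\<in>{(Y, k)}. \<phi> s = \<phi> t)}"
    by (simp add: kern_def)
  also have "congruence R X \<dots>"
    by (rule kernel_congruence(1)[OF left_module_op_closed[OF assms(1)] X.R.ring_axioms])
      (use assms Mod_hom_zero[OF assms] in simp)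
  finally show ?thesis .
qed

lemma congruence_Union:
  assumes "\<C> \<noteq> {}" and "subset.chain \<A> \<C>" and "\<And>\<theta>. \<theta> \<in> \<C> \<Longrightarrow> congruence R X \<theta>"
  shows "congruence R X (\<Union>\<C>)"
proof -
  have eq: "equiv (carrier X) \<theta>" if "\<theta> \<in> \<C>" for \<theta>
    using assms(3)[OF that] by (simp add: congruence_def)
  have common: "\<exists>\<theta>\<in>\<C>. p \<in> \<theta> \<and> p' \<in> \<theta>" if "p \<in> \<Union>\<C>" "p' \<in> \<Union>\<C>" for p p'
    using that assms(2) unfolding subset_chain_def by blast
  have "\<Union>\<C> \<subseteq> carrier X \<times> carrier X" using eq unfolding equiv_def by blast
  moreover have "refl_on (carrier X) (\<Union>\<C>)"
    using eq assms(1) unfolding equiv_def refl_on_def by blast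
  moreover have "sym (\<Union>\<C>)"
    using eq unfolding equiv_def sym_def by blast
  moreover have "trans (\<Union>\<C>)"
  proof (rule transI)
    fix x y z assume "(x, y) \<in> \<Union>\<C>" "(y, z) \<in> \<Union>\<C>"
    then obtain \<theta> where "\<theta> \<in> \<C>" "(x, y) \<in> \<theta>" "(y, z) \<in> \<theta>" using common by blast
    then show "(x, z) \<in> \<Union>\<C>" using eq unfolding equiv_def by (blast dest: transD)
  qed
  moreover have "(x \<oplus>\<^bsub>X\<^esub> y, x' \<oplus>\<^bsub>X\<^esub> y') \<in> \<Union>\<C>" if xy: "(x, x') \<in> \<Union>\<C>" "(y, y') \<in> \<Union>\<C>" for x x' y y'
  proof -
    obtain \<theta> where \<theta>: "\<theta> \<in> \<C>" "(x, x') \<in> \<theta>" "(y, y') \<in> \<theta>" using common[OF xy] by blast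
    then have "(x \<oplus>\<^bsub>X\<^esub> y, x' \<oplus>\<^bsub>X\<^esub> y') \<in> \<theta>"
      using assms(3) unfolding congruence_def by blast
    then show ?thesis using \<theta>(1) by blast
  qed
  moreover have "(a \<odot>\<^bsub>X\<^esub> x, a \<odot>\<^bsub>X\<^esub> x') \<in> \<Union>\<C>" if a: "a \<in> carrier R" and x: "(x, x') \<in> \<Union>\<C>" for a x x'
  proof -
    obtain \<theta> where \<theta>: "\<theta> \<in> \<C>" "(x, x') \<in> \<theta>" using x by blast
    then have "(a \<odot>\<^bsub>X\<^esub> x, a \<odot>\<^bsub>X\<^esub> x') \<in> \<theta>"
      using assms(3) a unfolding congruence_def by blast
    then show ?thesis using \<theta>(1) by blast
  qed
  ultimately show ?thesis unfolding congruence_def equiv_def by blast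
qed

lemma quotient_module:
  fixes X :: "('r, 'u) module"
  assumes X: "Mod_obj R X" and \<theta>: "congruence R X \<theta>"
  obtains Q :: "('r, 'u) module" and q where "Mod_obj R Q" "q \<in> Mod_hom R X Q"
    "q ` carrier X = carrier Q" "kern X q = \<theta>"
proof -
  have XM: "left_module R X" and sm: "small TYPE('u) (carrier X)" using X by (simp_all add: Mod_obj_def)
  interpret X: left_module R X by (rule XM)
  have eq: "equiv (carrier X) \<theta>" using \<theta> by (simp add: congruence_def)
  then have "refl_on (carrier X) \<theta>" by (simp add: equiv_def)
  then have laws: "module_laws R X \<theta>" by (rule left_module_laws[OF XM])
  obtain Q :: "('r, 'u) module" and q where Q: "Mod_obj R Q" "q \<in> Mod_hom R X Q"
    "q ` carrier X = carrier Q"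
    and q: "\<And>x y. x \<in> carrier X \<Longrightarrow> y \<in> carrier X \<Longrightarrow> q x = q y \<longleftrightarrow> (x, y) \<in> \<theta>"
    by (rule small_quotient[OF X.R.ring_axioms sm left_module_op_closed[OF XM] \<theta> laws]) (rule that)
  have "\<theta> \<subseteq> carrier X \<times> carrier X" using eq by (simp add: equiv_def)
  then have "kern X q = \<theta>" using q unfolding kern_def by blast
  then show ?thesis by (rule that[OF Q])
qed

lemma direct_sum:
  fixes X Y :: "('r, 'u) module"
  assumes "universe TYPE('u)" and R: "ring R" and X: "Mod_obj R X" and Y: "Mod_obj R Y"
  obtains S :: "('r, 'u) module" and \<iota>\<^sub>X \<iota>\<^sub>Y \<pi>\<^sub>X \<pi>\<^sub>Y where "Mod_obj R S"
    "\<iota>\<^sub>X \<in> Mod_hom R X S" "\<iota>\<^sub>Y \<in> Mod_hom R Y S" "\<pi>\<^sub>X \<in> Mod_hom R S X" "\<pi>\<^sub>Y \<in> Mod_hom R S Y"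
    "\<And>x. x \<in> carrier X \<Longrightarrow> \<pi>\<^sub>X (\<iota>\<^sub>X x) = x" "\<And>x. x \<in> carrier X \<Longrightarrow> \<pi>\<^sub>Y (\<iota>\<^sub>X x) = \<zero>\<^bsub>Y\<^esub>"
    "\<And>y. y \<in> carrier Y \<Longrightarrow> \<pi>\<^sub>X (\<iota>\<^sub>Y y) = \<zero>\<^bsub>X\<^esub>" "\<And>y. y \<in> carrier Y \<Longrightarrow> \<pi>\<^sub>Y (\<iota>\<^sub>Y y) = y"
proof -
  have XM: "left_module R X" and YM: "left_module R Y"
    and smX: "small TYPE('u) (carrier X)" and smY: "small TYPE('u) (carrier Y)"
    using X Y by (simp_all add: Mod_obj_def)
  interpret X: left_module R X by (rule XM)
  interpret Y: left_module R Y by (rule YM)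
  define A :: "('r, 'u \<times> 'u) module" where "A = \<lparr>carrier = carrier X \<times> carrier Y, mult = undefined, one = undefined,
     zero = (\<zero>\<^bsub>X\<^esub>, \<zero>\<^bsub>Y\<^esub>), add = (\<lambda>(x, y) (x', y'). (x \<oplus>\<^bsub>X\<^esub> x', y \<oplus>\<^bsub>Y\<^esub> y')),
     smult = (\<lambda>a (x, y). (a \<odot>\<^bsub>X\<^esub> x, a \<odot>\<^bsub>Y\<^esub> y))\<rparr>"
  have A: "carrier A = carrier X \<times> carrier Y" "\<zero>\<^bsub>A\<^esub> = (\<zero>\<^bsub>X\<^esub>, \<zero>\<^bsub>Y\<^esub>)"
    "\<And>x y x' y'. (x, y) \<oplus>\<^bsub>A\<^esub> (x', y') = (x \<oplus>\<^bsub>X\<^esub> x', y \<oplus>\<^bsub>Y\<^esub> y')"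
    "\<And>a x y. a \<odot>\<^bsub>A\<^esub> (x, y) = (a \<odot>\<^bsub>X\<^esub> x, a \<odot>\<^bsub>Y\<^esub> y)"
    by (simp_all add: A_def)
  have op: "op_closed R A"
    unfolding op_closed_def by (auto simp: A X.smult_closed Y.smult_closed)
  let ?f = "restrict fst (carrier A)" and ?s = "restrict snd (carrier A)"
  have fst: "?f \<in> Mod_hom R A X"
    by (rule Mod_homI) (auto simp: A X.smult_closed Y.smult_closed)
  have snd: "?s \<in> Mod_hom R A Y"
    by (rule Mod_homI) (auto simp: A X.smult_closed Y.smult_closed)
  let ?\<Phi> = "{(X, ?f), (Y, ?s)}"
  let ?\<theta> = "{(s, t). s \<in> carrier A \<and> t \<in> carrier A \<and> (\<forall>(Y, \<phi>)\<in>?\<Phi>. \<phi> s = \<phi> t)}"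
  have \<Phi>: "left_module R Z \<and> \<phi> \<in> Mod_hom R A Z \<and> \<phi> \<zero>\<^bsub>A\<^esub> = \<zero>\<^bsub>Z\<^esub>" if "(Z, \<phi>) \<in> ?\<Phi>" for Z \<phi>
    using that XM YM fst snd by (auto simp: A)
  have cong: "congruence R A ?\<theta>" by (rule kernel_congruence(1)[OF op R]) (rule \<Phi>)
  have laws: "module_laws R A ?\<theta>" by (rule kernel_congruence(2)[OF op R]) (rule \<Phi>)
  have sm: "small TYPE('u) (carrier A)" unfolding A by (rule small_Times[OF assms(1) smX smY])
  obtain S :: "('r, 'u) module" and q where S: "Mod_obj R S" "q \<in> Mod_hom R A S" "q ` carrier A = carrier S"
    and q: "\<And>x y. x \<in> carrier A \<Longrightarrow> y \<in> carrier A \<Longrightarrow> q x = q y \<longleftrightarrow> (x, y) \<in> ?\<theta>"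
    by (rule small_quotient[OF R sm op cong laws]) (rule that)
  have inj: "x = y" if "x \<in> carrier A" "y \<in> carrier A" "q x = q y" for x y
    using q[OF that(1,2)] that by (simp add: prod_eq_iff)
  have fq: "?f s = ?f t" "?s s = ?s t" if "s \<in> carrier A" "t \<in> carrier A" "q s = q t" for s t
    using inj[OF that] by simp_all
  have SM: "left_module R S" using S(1) by (simp add: Mod_obj_def)
  have fa: "factor A q ?f (q (x, y)) = x" "factor A q ?s (q (x, y)) = y"
    if "x \<in> carrier X" "y \<in> carrier Y" for x y
  proof -
    have xy: "(x, y) \<in> carrier A" using that by (simp add: A)
    have "factor A q ?f (q (x, y)) = ?f (x, y)" by (rule factor_apply[OF fq(1) xy])
    then show "factor A q ?f (q (x, y)) = x" using xy by simp
    have "factor A q ?s (q (x, y)) = ?s (x, y)" by (rule factor_apply[OF fq(2) xy])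
    then show "factor A q ?s (q (x, y)) = y" using xy by simp
  qed
  let ?i = "\<lambda>x\<in>carrier X. q (x, \<zero>\<^bsub>Y\<^esub>)" and ?j = "\<lambda>y\<in>carrier Y. q (\<zero>\<^bsub>X\<^esub>, y)"
  show ?thesis
  proof (rule that[OF S(1)])
    show "factor A q ?f \<in> Mod_hom R S X" by (rule factor_Mod_hom[OF op S(2,3) fst fq(1)])
    show "factor A q ?s \<in> Mod_hom R S Y" by (rule factor_Mod_hom[OF op S(2,3) snd fq(2)])
    show "?i \<in> Mod_hom R X S"
    proof (rule Mod_homI)
      show "?i \<in> carrier X \<rightarrow>\<^sub>E carrier S" using Mod_hom_closed[OF S(2)] by (auto simp: A)
      show "?i (x \<oplus>\<^bsub>X\<^esub> y) = ?i x \<oplus>\<^bsub>S\<^esub> ?i y" if "x \<in> carrier X" "y \<in> carrier X" for x y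
        using that Mod_hom_add[OF S(2), of "(x, \<zero>\<^bsub>Y\<^esub>)" "(y, \<zero>\<^bsub>Y\<^esub>)"] by (simp add: A)
      show "?i (a \<odot>\<^bsub>X\<^esub> x) = a \<odot>\<^bsub>S\<^esub> ?i x" if "a \<in> carrier R" "x \<in> carrier X" for a x
        using that Mod_hom_smult[OF S(2), of a "(x, \<zero>\<^bsub>Y\<^esub>)"] left_module_smult_zero[OF YM]
        by (simp add: A X.smult_closed)
    qed
    show "?j \<in> Mod_hom R Y S"
    proof (rule Mod_homI)
      show "?j \<in> carrier Y \<rightarrow>\<^sub>E carrier S" using Mod_hom_closed[OF S(2)] by (auto simp: A)
      show "?j (x \<oplus>\<^bsub>Y\<^esub> y) = ?j x \<oplus>\<^bsub>S\<^esub> ?j y" if "x \<in> carrier Y" "y \<in> carrier Y" for x y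
        using that Mod_hom_add[OF S(2), of "(\<zero>\<^bsub>X\<^esub>, x)" "(\<zero>\<^bsub>X\<^esub>, y)"] by (simp add: A)
      show "?j (a \<odot>\<^bsub>Y\<^esub> x) = a \<odot>\<^bsub>S\<^esub> ?j x" if "a \<in> carrier R" "x \<in> carrier Y" for a x
        using that Mod_hom_smult[OF S(2), of a "(\<zero>\<^bsub>X\<^esub>, x)"] left_module_smult_zero[OF XM]
        by (simp add: A Y.smult_closed)
    qed
  qed (simp_all add: fa)
qed

section \<open>Direct limits\<close>

lemma directed_setD:
  assumes "directed_set I r"
  shows "i \<in> I \<Longrightarrow> (i, i) \<in> r" and "(i, j) \<in> r \<Longrightarrow> i \<in> I" and "(i, j) \<in> r \<Longrightarrow> j \<in> I"
    and "(i, j) \<in> r \<Longrightarrow> (j, k) \<in> r \<Longrightarrow> (i, k) \<in> r"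
    and "i \<in> I \<Longrightarrow> j \<in> I \<Longrightarrow> \<exists>k\<in>I. (i, k) \<in> r \<and> (j, k) \<in> r"
  using assms unfolding directed_set_def preorder_on_def refl_on_def trans_def by blast+

lemma compose_eqD: "compose A g f = h \<Longrightarrow> x \<in> A \<Longrightarrow> g (f x) = h x"
  by (auto simp: compose_def)

text \<open>
  The usual recognition principle: a cocone is a direct limit if it is jointly surjective and only
  identifies elements that are already identified at a later stage.
\<close>

lemma direct_limitI:
  assumes dir: "directed_set I r" and sys: "directed_system R I r G g" and L: "cocone R I r G g L \<mu>"
    and surj: "\<And>x. x \<in> carrier L \<Longrightarrow> \<exists>i\<in>I. x \<in> \<mu> i ` carrier (G i)"
    and inj: "\<And>i x y. i \<in> I \<Longrightarrow> x \<in> carrier (G i) \<Longrightarrow> y \<in> carrier (G i) \<Longrightarrow> \<mu> i x = \<mu> i y \<Longrightarrow>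
      \<exists>j. (i, j) \<in> r \<and> g i j x = g i j y"
  shows "direct_limit R I r G g L \<mu>"
  unfolding direct_limit_def
proof (intro conjI allI impI L)
  fix X \<xi> assume X: "cocone R I r G g X \<xi>"
  note dirD = directed_setD[OF dir]
  have G: "left_module R (G i)" if "i \<in> I" for i
    using sys that unfolding directed_system_def Mod_obj_def by blast
  have g: "g i j \<in> Mod_hom R (G i) (G j)" if "(i, j) \<in> r" for i j
    using sys that unfolding directed_system_def by blast
  have \<mu>: "\<mu> i \<in> Mod_hom R (G i) L" if "i \<in> I" for i using L that unfolding cocone_def by blast
  have \<xi>: "\<xi> i \<in> Mod_hom R (G i) X" if "i \<in> I" for i using X that unfolding cocone_def by blast
  have \<mu>g: "\<mu> j (g i j x) = \<mu> i x" if "(i, j) \<in> r" "x \<in> carrier (G i)" for i j x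
    using L that unfolding cocone_def by (auto dest!: bspec intro: compose_eqD)
  have \<xi>g: "\<xi> j (g i j x) = \<xi> i x" if "(i, j) \<in> r" "x \<in> carrier (G i)" for i j x
    using X that unfolding cocone_def by (auto dest!: bspec intro: compose_eqD)
  have common: "\<xi> i x = \<xi> j y"
    if i: "i \<in> I" "x \<in> carrier (G i)" and j: "j \<in> I" "y \<in> carrier (G j)" and eq: "\<mu> i x = \<mu> j y" for i j x y
  proof -
    obtain k where k: "k \<in> I" "(i, k) \<in> r" "(j, k) \<in> r" using dirD(5) i j by blast
    have "g i k x \<in> carrier (G k)" "g j k y \<in> carrier (G k)"
      using Mod_hom_closed[OF g] i j k by blast+
    moreover have "\<mu> k (g i k x) = \<mu> k (g j k y)" using \<mu>g i j k eq by simp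
    ultimately obtain l where l: "(k, l) \<in> r" "g k l (g i k x) = g k l (g j k y)"
      using inj[OF k(1)] by blast
    have "\<xi> k (g i k x) = \<xi> k (g j k y)"
      using \<xi>g[OF l(1)] l(2) \<open>g i k x \<in> _\<close> \<open>g j k y \<in> _\<close> by metis
    then show ?thesis using \<xi>g i j k by simp
  qed
  define u where "u = (\<lambda>z\<in>carrier L. THE w. \<exists>i\<in>I. \<exists>x\<in>carrier (G i). \<mu> i x = z \<and> \<xi> i x = w)"
  have u: "u (\<mu> i x) = \<xi> i x" if "i \<in> I" "x \<in> carrier (G i)" for i x
  proof -
    have "(THE w. \<exists>j\<in>I. \<exists>y\<in>carrier (G j). \<mu> j y = \<mu> i x \<and> \<xi> j y = w) = \<xi> i x"
      by (rule the_equality) (use that common in blast)+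
    then show ?thesis using Mod_hom_closed[OF \<mu>] that by (simp add: u_def)
  qed
  have uhom: "u \<in> Mod_hom R L X"
  proof (rule Mod_homI)
    show "u \<in> carrier L \<rightarrow>\<^sub>E carrier X"
    proof (rule PiE_I)
      fix z assume "z \<in> carrier L"
      then obtain i x where "i \<in> I" "x \<in> carrier (G i)" "z = \<mu> i x" using surj by blast
      then show "u z \<in> carrier X" using u Mod_hom_closed[OF \<xi>] by simp
    qed (simp add: u_def)
    fix z assume "z \<in> carrier L"
    then obtain i x where x: "i \<in> I" "x \<in> carrier (G i)" "z = \<mu> i x" using surj by blast
    {
      fix w assume "w \<in> carrier L"
      then obtain j y where y: "j \<in> I" "y \<in> carrier (G j)" "w = \<mu> j y" using surj by blast
      obtain k where k: "k \<in> I" "(i, k) \<in> r" "(j, k) \<in> r" using dirD(5) x y by blast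
      let ?x = "g i k x" and ?y = "g j k y"
      interpret K: left_module R "G k" by (rule G[OF k(1)])
      have c: "?x \<in> carrier (G k)" "?y \<in> carrier (G k)"
        using Mod_hom_closed[OF g] x y k by blast+
      have z: "z = \<mu> k ?x" and w: "w = \<mu> k ?y" using \<mu>g x y k by simp_all
      have "z \<oplus>\<^bsub>L\<^esub> w = \<mu> k (?x \<oplus>\<^bsub>G k\<^esub> ?y)" unfolding z w using Mod_hom_add[OF \<mu>[OF k(1)]] c by simp
      then show "u (z \<oplus>\<^bsub>L\<^esub> w) = u z \<oplus>\<^bsub>X\<^esub> u w"
        using c by (simp add: z w u[OF k(1)] Mod_hom_add[OF \<xi>[OF k(1)]])
    }
    fix a assume a: "a \<in> carrier R"
    interpret K: left_module R "G i" by (rule G[OF x(1)])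
    have "a \<odot>\<^bsub>L\<^esub> z = \<mu> i (a \<odot>\<^bsub>G i\<^esub> x)" using Mod_hom_smult[OF \<mu>[OF x(1)] a x(2)] x(3) by simp
    then show "u (a \<odot>\<^bsub>L\<^esub> z) = a \<odot>\<^bsub>X\<^esub> u z"
      using a x by (simp add: u Mod_hom_smult[OF \<xi>[OF x(1)]] K.smult_closed)
  qed
  show "\<exists>!u. u \<in> Mod_hom R L X \<and> (\<forall>i\<in>I. compose (carrier (G i)) u (\<mu> i) = \<xi> i)"
  proof (rule ex1I)
    have "compose (carrier (G i)) u (\<mu> i) = \<xi> i" if "i \<in> I" for i
      using Mod_hom_PiE[OF \<xi>[OF that]] u[OF that]
      by (intro extensionalityI[of _ "carrier (G i)"]) (auto simp: compose_def PiE_def)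
    then show "u \<in> Mod_hom R L X \<and> (\<forall>i\<in>I. compose (carrier (G i)) u (\<mu> i) = \<xi> i)"
      using uhom by blast
  next
    fix v assume v: "v \<in> Mod_hom R L X \<and> (\<forall>i\<in>I. compose (carrier (G i)) v (\<mu> i) = \<xi> i)"
    show "v = u"
    proof (rule Mod_hom_eqI[OF _ uhom])
      show "v \<in> Mod_hom R L X" using v by blast
      fix z assume "z \<in> carrier L"
      then obtain i x where x: "i \<in> I" "x \<in> carrier (G i)" "z = \<mu> i x" using surj by blast
      have "v (\<mu> i x) = \<xi> i x" using v x by (blast intro: compose_eqD)
      then show "v z = u z" using x u by simp
    qed
  qed
qed

section \<open>Linear equations and presented modules\<close>

text \<open>
  A list \<open>[(a\<^sub>1, v\<^sub>1), \<dots>]\<close> stands for the linear combination \<open>a\<^sub>1 v\<^sub>1 + \<dots>\<close> of variables.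
\<close>

primrec ev :: "('r, 'm) module \<Rightarrow> ('v \<Rightarrow> 'm) \<Rightarrow> ('r \<times> 'v) list \<Rightarrow> 'm" where
  "ev X y [] = \<zero>\<^bsub>X\<^esub>"
| "ev X y (p # t) = fst p \<odot>\<^bsub>X\<^esub> y (snd p) \<oplus>\<^bsub>X\<^esub> ev X y t"

abbreviation terms :: "('r, 's) ring_scheme \<Rightarrow> 'v set \<Rightarrow> ('r \<times> 'v) list set" where
  "terms R V \<equiv> lists (carrier R \<times> V)"

definition term_algebra :: "('r, 's) ring_scheme \<Rightarrow> 'v set \<Rightarrow> ('r, ('r \<times> 'v) list) module" where
  "term_algebra R V = \<lparr>carrier = lists (carrier R \<times> V), mult = undefined, one = undefined,
     zero = [], add = (@), smult = (\<lambda>a. map (\<lambda>(b, v). (a \<otimes>\<^bsub>R\<^esub> b, v)))\<rparr>"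

lemma term_algebra_simps [simp]:
  "carrier (term_algebra R V) = lists (carrier R \<times> V)"
  "\<zero>\<^bsub>term_algebra R V\<^esub> = []"
  "s \<oplus>\<^bsub>term_algebra R V\<^esub> t = s @ t"
  "a \<odot>\<^bsub>term_algebra R V\<^esub> [] = []"
  "a \<odot>\<^bsub>term_algebra R V\<^esub> ((b, v) # t) = (a \<otimes>\<^bsub>R\<^esub> b, v) # (a \<odot>\<^bsub>term_algebra R V\<^esub> t)"
  by (simp_all add: term_algebra_def)

lemma term_algebra_smult_closed:
  assumes "ring R" and "a \<in> carrier R" and "t \<in> lists (carrier R \<times> V)"
  shows "a \<odot>\<^bsub>term_algebra R V\<^esub> t \<in> lists (carrier R \<times> V)"
  using assms(3)
proof (induction t)
  case (Cons p t)
  then show ?case using monoid.m_closed[OF ring.is_monoid[OF assms(1)] assms(2)] by (cases p) auto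
qed simp

lemma op_closed_term_algebra: "ring R \<Longrightarrow> op_closed R (term_algebra R V)"
  unfolding op_closed_def by (auto simp: term_algebra_smult_closed simp del: in_lists_conv_set)

lemma ev_closed:
  assumes "left_module R X" and "t \<in> lists (carrier R \<times> V)" and "y ` V \<subseteq> carrier X"
  shows "ev X y t \<in> carrier X"
proof -
  interpret X: left_module R X by fact
  show ?thesis using assms(2)
  proof (induction t)
    case (Cons p t)
    then show ?case using assms(3) by (cases p) (auto simp: X.smult_closed image_subset_iff)
  qed simp
qed

lemma ev_Mod_hom:
  assumes "left_module R X" and "y ` V \<subseteq> carrier X"
  shows "restrict (ev X y) (lists (carrier R \<times> V)) \<in> Mod_hom R (term_algebra R V) X"
proof (rule Mod_homI)
  interpret X: left_module R X by fact
  have cl: "ev X y t \<in> carrier X" if "t \<in> lists (carrier R \<times> V)" for t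
    by (rule ev_closed[OF assms(1) that assms(2)])
  show "restrict (ev X y) (lists (carrier R \<times> V)) \<in> carrier (term_algebra R V) \<rightarrow>\<^sub>E carrier X"
    using cl by (simp del: in_lists_conv_set)
  fix t assume t: "t \<in> carrier (term_algebra R V)"
  {
    fix s assume s: "s \<in> carrier (term_algebra R V)"
    have "ev X y (t @ s) = ev X y t \<oplus>\<^bsub>X\<^esub> ev X y s" using t unfolding term_algebra_simps
    proof (induction t)
      case Nil then show ?case using cl s by (simp del: in_lists_conv_set)
    next
      case (Cons p t)
      then have "fst p \<odot>\<^bsub>X\<^esub> y (snd p) \<in> carrier X" using assms(2)
        by (auto simp: X.smult_closed image_subset_iff)
      then show ?case using Cons cl[of t] cl[of s] s
        by (simp add: X.M.a_assoc del: in_lists_conv_set)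
    qed
    then show "restrict (ev X y) (lists (carrier R \<times> V)) (t \<oplus>\<^bsub>term_algebra R V\<^esub> s) =
       restrict (ev X y) (lists (carrier R \<times> V)) t \<oplus>\<^bsub>X\<^esub> restrict (ev X y) (lists (carrier R \<times> V)) s"
      using t s by (simp add: append_in_lists_conv del: in_lists_conv_set)
  }
  fix a assume a: "a \<in> carrier R"
  have "ev X y (a \<odot>\<^bsub>term_algebra R V\<^esub> t) = a \<odot>\<^bsub>X\<^esub> ev X y t" using t unfolding term_algebra_simps
  proof (induction t)
    case Nil then show ?case using left_module_smult_zero[OF assms(1) a] by simp
  next
    case (Cons p t)
    obtain b v where p: "p = (b, v)" "b \<in> carrier R" "v \<in> V" using Cons by auto
    have v: "y v \<in> carrier X" using assms(2) p by (auto simp: image_subset_iff)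
    then show ?case using Cons cl[of t] a p
      by (simp add: X.smult_r_distr X.smult_closed X.smult_assoc del: in_lists_conv_set)
  qed
  then show "restrict (ev X y) (lists (carrier R \<times> V)) (a \<odot>\<^bsub>term_algebra R V\<^esub> t) =
       a \<odot>\<^bsub>X\<^esub> restrict (ev X y) (lists (carrier R \<times> V)) t"
    using t term_algebra_smult_closed[OF X.R.ring_axioms a, of t V] by (simp del: in_lists_conv_set)
qed

lemma ev_hom:
  assumes "left_module R X" and "left_module R Y" and "h \<in> Mod_hom R X Y"
    and "t \<in> lists (carrier R \<times> V)" and "y ` V \<subseteq> carrier X"
  shows "h (ev X y t) = ev Y (h \<circ> y) t"
proof -
  interpret X: left_module R X by fact
  show ?thesis using assms(4)
  proof (induction t)
    case Nil then show ?case using Mod_hom_zero[OF assms(1-3)] by simp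
  next
    case (Cons p t)
    have "ev X y t \<in> carrier X" using ev_closed[OF assms(1) _ assms(5)] Cons by blast
    moreover have "y (snd p) \<in> carrier X" "fst p \<in> carrier R" using Cons assms(5) by auto
    ultimately show ?case using Cons
      by (simp add: Mod_hom_add[OF assms(3)] Mod_hom_smult[OF assms(3)] X.smult_closed)
  qed
qed

lemma ev_cong:
  assumes "\<And>v. v \<in> snd ` set t \<Longrightarrow> y v = z v" shows "ev X y t = ev X z t"
  using assms by (induction t) auto

lemma ev_map: "ev X y (map (map_prod id g) t) = ev X (y \<circ> g) t"
  by (induction t) auto

text \<open>A pair \<open>(s, t)\<close> of terms stands for the equation \<open>s = t\<close>.\<close>

definition vars :: "(('r \<times> 'v) list \<times> ('r \<times> 'v) list) set \<Rightarrow> 'v set" where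
  "vars E = (\<Union>(s, t)\<in>E. snd ` set s \<union> snd ` set t)"

definition solves :: "('r, 'm) module \<Rightarrow> ('v \<Rightarrow> 'm) \<Rightarrow> (('r \<times> 'v) list \<times> ('r \<times> 'v) list) set \<Rightarrow> bool" where
  "solves X y E \<longleftrightarrow> (\<forall>(s, t)\<in>E. ev X y s = ev X y t)"

lemma vars_subset:
  assumes "E \<subseteq> terms R V \<times> terms R V" shows "vars E \<subseteq> V"
proof
  fix v assume "v \<in> vars E"
  then obtain s t where st: "(s, t) \<in> E" "v \<in> snd ` set s \<union> snd ` set t"
    unfolding vars_def by auto
  then have "s \<in> terms R V" "t \<in> terms R V" using assms by auto
  then show "v \<in> V" using st(2) by (auto simp: subset_iff)
qed

lemma terms_vars:
  assumes "E \<subseteq> terms R V \<times> terms R V"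
  shows "E \<subseteq> terms R (vars E) \<times> terms R (vars E)"
proof (rule subrelI)
  fix s t assume st: "(s, t) \<in> E"
  then have "snd ` set s \<union> snd ` set t \<subseteq> vars E" unfolding vars_def by blast
  moreover have "s \<in> terms R V" "t \<in> terms R V" using st assms by auto
  ultimately show "(s, t) \<in> terms R (vars E) \<times> terms R (vars E)"
    by (auto simp: image_subset_iff)
qed

text \<open>
  Two terms are identified in the module presented by \<open>E\<close> iff every solution of \<open>E\<close> in every object of
  \<open>R-Mod\<close> gives them the same value. The semantic form makes the universal property immediate and avoids
  free modules.
\<close>

definition consequence ::
  "('r, 's) ring_scheme \<Rightarrow> 'u itself \<Rightarrow> (('r \<times> 'v) list \<times> ('r \<times> 'v) list) set \<Rightarrow> ('r \<times> 'v) list \<Rightarrow> ('r \<times> 'v) list \<Rightarrow> bool"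
  where "consequence R U E s t \<longleftrightarrow> (\<forall>(Y :: ('r, 'u) module) y.
     Mod_obj R Y \<and> y ` vars E \<subseteq> carrier Y \<and> solves Y y E \<longrightarrow> ev Y y s = ev Y y t)"

lemma presented_module:
  fixes E :: "(('r \<times> 'v) list \<times> ('r \<times> 'v) list) set"
  assumes "universe TYPE('u)" and R: "ring R" and "small TYPE('u) (carrier R)" and "small TYPE('u) (vars E)"
  obtains C :: "('r, 'u) module" and q where "Mod_obj R C" "q \<in> Mod_hom R (term_algebra R (vars E)) C"
    "q ` terms R (vars E) = carrier C"
    "\<And>s t. s \<in> terms R (vars E) \<Longrightarrow> t \<in> terms R (vars E) \<Longrightarrow> q s = q t \<longleftrightarrow> consequence R TYPE('u) E s t"
proof -
  let ?A = "term_algebra R (vars E)"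
  define \<Phi> where "\<Phi> = {(Y :: ('r, 'u) module, restrict (ev Y y) (terms R (vars E))) |Y y.
     Mod_obj R Y \<and> y ` vars E \<subseteq> carrier Y \<and> solves Y y E}"
  have \<Phi>: "left_module R Y \<and> \<phi> \<in> Mod_hom R ?A Y \<and> \<phi> \<zero>\<^bsub>?A\<^esub> = \<zero>\<^bsub>Y\<^esub>" if "(Y, \<phi>) \<in> \<Phi>" for Y \<phi>
  proof -
    from that obtain y where y: "\<phi> = restrict (ev Y y) (terms R (vars E))" "left_module R Y"
        "y ` vars E \<subseteq> carrier Y"
      unfolding \<Phi>_def Mod_obj_def by blast
    show ?thesis using ev_Mod_hom[OF y(2,3)] y(2) by (simp add: y(1))
  qed
  let ?\<theta> = "{(s, t). s \<in> carrier ?A \<and> t \<in> carrier ?A \<and> (\<forall>(Y, \<phi>)\<in>\<Phi>. \<phi> s = \<phi> t)}"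
  note A = op_closed_term_algebra[OF R]
  have sm: "small TYPE('u) (carrier ?A)"
    using small_lists[OF assms(1) small_Times[OF assms(1,3,4)]] by (simp only: term_algebra_simps)
  obtain C :: "('r, 'u) module" and q where C: "Mod_obj R C" "q \<in> Mod_hom R ?A C"
    "q ` carrier ?A = carrier C" and
    q: "\<And>s t. s \<in> carrier ?A \<Longrightarrow> t \<in> carrier ?A \<Longrightarrow> q s = q t \<longleftrightarrow> (s, t) \<in> ?\<theta>"
    by (rule small_quotient[OF R sm A kernel_congruence[OF A R \<Phi>]]) blast+
  have \<theta>: "(s, t) \<in> ?\<theta> \<longleftrightarrow> consequence R TYPE('u) E s t"
    if "s \<in> terms R (vars E)" "t \<in> terms R (vars E)" for s t
  proof
    assume *: "(s, t) \<in> ?\<theta>"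
    show "consequence R TYPE('u) E s t" unfolding consequence_def
    proof (intro allI impI)
      fix Y :: "('r, 'u) module" and y
      assume "Mod_obj R Y \<and> y ` vars E \<subseteq> carrier Y \<and> solves Y y E"
      then have "(Y, restrict (ev Y y) (terms R (vars E))) \<in> \<Phi>" unfolding \<Phi>_def by blast
      then have "restrict (ev Y y) (terms R (vars E)) s = restrict (ev Y y) (terms R (vars E)) t"
        using * by blast
      then show "ev Y y s = ev Y y t" using that by (simp del: in_lists_conv_set)
    qed
  next
    assume "consequence R TYPE('u) E s t"
    then show "(s, t) \<in> ?\<theta>"
      using that unfolding \<Phi>_def consequence_def by (auto simp del: in_lists_conv_set)
  qed
  show ?thesis
    by (rule that[OF C(1,2)]) (use C(3) q \<theta> in \<open>simp_all del: in_lists_conv_set\<close>)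
qed

section \<open>A local criterion for membership in the ideal\<close>

locale limit_closed_ideal =
  fixes R :: "'r ring" and \<I> :: "('r, 'u) morphism set" and M :: "('r, 'u) module"
  assumes universe: "universe TYPE('u)"
    and ring: "ring R" and small_ring: "small TYPE('u) (carrier R)"
    and ideal: "Mod_ideal R \<I>"
    and limits: "closed_under_direct_limits R \<I>"
    and M: "Mod_obj R M"
begin

lemma M_module: "left_module R M" using M by (simp add: Mod_obj_def)

lemma
  assumes "(X, f, M) \<in> \<I>"
  shows over_obj: "Mod_obj R X" and over_hom: "f \<in> Mod_hom R X M" and over_module: "left_module R X"
proof -
  from assms show "Mod_obj R X" "f \<in> Mod_hom R X M"
    using ideal unfolding Mod_ideal_def by (auto dest!: bspec)
  then show "left_module R X" by (simp add: Mod_obj_def)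
qed

lemma over_pullback:
  assumes "Mod_obj R K" and k: "k \<in> Mod_hom R K X" and X: "(X, f, M) \<in> \<I>"
    and g: "g \<in> Mod_hom R K M" and eq: "\<And>x. x \<in> carrier K \<Longrightarrow> f (k x) = g x"
  shows "(K, g, M) \<in> \<I>"
proof -
  have "(K, compose (carrier K) (Mod_id M) (compose (carrier K) f k), M) \<in> \<I>"
    using ideal assms(1) k X M Mod_hom_id[OF left_module_op_closed[OF M_module]]
    unfolding Mod_ideal_def by blast
  moreover have "compose (carrier K) (Mod_id M) (compose (carrier K) f k) = g"
    using Mod_hom_PiE[OF g] Mod_hom_closed[OF g] eq
    by (intro extensionalityI[of _ "carrier K"]) (auto simp: compose_def Mod_id_def PiE_def)
  ultimately show ?thesis by simp
qed

text \<open>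
  Tuples are total sequences, but only the variables that occur in \<open>E\<close> matter. A finite system is
  realizable by \<open>m\<close> iff the module it presents, mapped to \<open>M\<close> by \<open>m\<close>, is an object over \<open>M\<close>.
\<close>

definition realizable :: "(('r \<times> nat) list \<times> ('r \<times> nat) list) set \<Rightarrow> (nat \<Rightarrow> 'u) \<Rightarrow> bool" where
  "realizable E m \<longleftrightarrow> (\<exists>Y h y. (Y, h, M) \<in> \<I> \<and> range y \<subseteq> carrier Y \<and> solves Y y E \<and>
     (\<forall>i\<in>vars E. h (y i) = m i))"

text \<open>
  The finite sets \<open>E\<close> of true equations of \<open>X\<close>, with the elements of \<open>X\<close> themselves as variables, are
  directed by inclusion, and the modules they present have \<open>X\<close> as their limit: each element is named by a
  variable, and two terms with the same value become equal as soon as that equation is added to \<open>E\<close>.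
  Realizability of \<open>E\<close> lets the map from such a module to \<open>M\<close> factor through an object over \<open>M\<close>. The
  limit of these maps, over a constant system on the side of \<open>M\<close>, is \<open>f\<close>.
\<close>

lemma over_if_locally_over:
  assumes X: "Mod_obj R X" and f: "f \<in> Mod_hom R X M"
    and loc: "\<And>E x. finite E \<Longrightarrow> E \<subseteq> terms R UNIV \<times> terms R UNIV \<Longrightarrow> range x \<subseteq> carrier X \<Longrightarrow>
      solves X x E \<Longrightarrow> realizable E (f \<circ> x)"
  shows "(X, f, M) \<in> \<I>"
proof -
  interpret R: ring R by (rule ring)
  have XM: "left_module R X" and smX: "small TYPE('u) (carrier X)" using X by (simp_all add: Mod_obj_def)
  interpret X: left_module R X by (rule XM)
  \<comment> \<open>the index set: finite sets of true equations between elements of \<open>X\<close>\<close>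
  define J where "J = {E. finite E \<and> E \<subseteq> terms R (carrier X) \<times> terms R (carrier X) \<and> solves X id E}"
  have smT: "small TYPE('u) (terms R (carrier X))"
    by (intro small_lists small_Times universe small_ring smX)
  have smJ: "small TYPE('u) J"
    by (rule small_subset[OF small_Pow[OF universe small_Times[OF universe smT smT]]])
      (auto simp: J_def)
  have vars: "vars E \<subseteq> carrier X" if "E \<in> J" for E
    using that vars_subset[of E R "carrier X"] by (simp add: J_def)
  let ?A = "\<lambda>E. term_algebra R (vars E)" and ?T = "\<lambda>E. terms R (vars E)"
  note opA = op_closed_term_algebra[OF ring]
  have subT: "E \<subseteq> ?T E \<times> ?T E" if "E \<in> J" for E
    using that terms_vars[of E R "carrier X"] by (simp add: J_def)
  have Tmono: "?T E \<subseteq> ?T E'" if "E \<subseteq> E'" for E E'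
    by (intro lists_mono Sigma_mono subset_refl) (use that in \<open>auto simp: vars_def\<close>)
  have "\<forall>E\<in>J. \<exists>Cq :: ('r, 'u) module \<times> _. Mod_obj R (fst Cq) \<and> snd Cq \<in> Mod_hom R (?A E) (fst Cq) \<and>
     snd Cq ` ?T E = carrier (fst Cq) \<and>
     (\<forall>s\<in>?T E. \<forall>t\<in>?T E. snd Cq s = snd Cq t \<longleftrightarrow> consequence R TYPE('u) E s t)"
  proof
    fix E assume "E \<in> J"
    then have sm: "small TYPE('u) (vars E)" using vars small_subset[OF smX] by blast
    obtain C :: "('r, 'u) module" and q where "Mod_obj R C" "q \<in> Mod_hom R (?A E) C" "q ` ?T E = carrier C"
      "\<And>s t. s \<in> ?T E \<Longrightarrow> t \<in> ?T E \<Longrightarrow> q s = q t \<longleftrightarrow> consequence R TYPE('u) E s t"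
      by (rule presented_module[OF universe ring small_ring sm]) (rule that)
    then show "\<exists>Cq :: ('r, 'u) module \<times> _. Mod_obj R (fst Cq) \<and> snd Cq \<in> Mod_hom R (?A E) (fst Cq) \<and>
     snd Cq ` ?T E = carrier (fst Cq) \<and>
     (\<forall>s\<in>?T E. \<forall>t\<in>?T E. snd Cq s = snd Cq t \<longleftrightarrow> consequence R TYPE('u) E s t)"
      by (intro exI[of _ "(C, q)"]) simp
  qed
  then obtain Cq :: "_ \<Rightarrow> ('r, 'u) module \<times> _" where Cq: "\<forall>E\<in>J. Mod_obj R (fst (Cq E)) \<and> snd (Cq E) \<in> Mod_hom R (?A E) (fst (Cq E)) \<and>
     snd (Cq E) ` ?T E = carrier (fst (Cq E)) \<and>
     (\<forall>s\<in>?T E. \<forall>t\<in>?T E. snd (Cq E) s = snd (Cq E) t \<longleftrightarrow> consequence R TYPE('u) E s t)"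
    by (rule bchoice[THEN exE]) (rule that)
  define C where "C E = fst (Cq E)" for E
  define q where "q E = snd (Cq E)" for E
  have C: "Mod_obj R (C E)" and q: "q E \<in> Mod_hom R (?A E) (C E)"
    and qsurj: "q E ` carrier (?A E) = carrier (C E)"
    and qeq: "\<And>s t. s \<in> ?T E \<Longrightarrow> t \<in> ?T E \<Longrightarrow> q E s = q E t \<longleftrightarrow> consequence R TYPE('u) E s t"
    if "E \<in> J" for E
    using Cq that unfolding C_def q_def term_algebra_simps by blast+
  have qrep: "\<exists>s\<in>?T E. u = q E s" if "E \<in> J" "u \<in> carrier (C E)" for E u
    using qsurj[OF that(1)] that(2) unfolding term_algebra_simps by blast
  \<comment> \<open>a solution in a module gives a map out of the presented module\<close>
  define out where "out E \<phi> = factor (?A E) (q E) (restrict \<phi> (?T E))"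
    for E and \<phi> :: "('r \<times> 'u) list \<Rightarrow> 'u"
  have out: "out E \<phi> \<in> Mod_hom R (C E) Y" "\<And>s. s \<in> ?T E \<Longrightarrow> out E \<phi> (q E s) = \<phi> s"
    if E: "E \<in> J" and \<phi>: "restrict \<phi> (?T E) \<in> Mod_hom R (?A E) Y"
      and eq: "\<And>s t. s \<in> ?T E \<Longrightarrow> t \<in> ?T E \<Longrightarrow> consequence R TYPE('u) E s t \<Longrightarrow> \<phi> s = \<phi> t" for E \<phi> Y
  proof -
    have eq': "restrict \<phi> (?T E) s = restrict \<phi> (?T E) t"
      if "s \<in> carrier (?A E)" "t \<in> carrier (?A E)" "q E s = q E t" for s t
      using eq that qeq[OF E] by (simp del: in_lists_conv_set)
    show "out E \<phi> \<in> Mod_hom R (C E) Y"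
      unfolding out_def by (rule factor_Mod_hom[OF opA q[OF E] qsurj[OF E] \<phi> eq'])
    show "out E \<phi> (q E s) = \<phi> s" if "s \<in> ?T E" for s
    proof -
      have "factor (?A E) (q E) (restrict \<phi> (?T E)) (q E s) = restrict \<phi> (?T E) s"
        by (rule factor_apply[OF eq']) (use that in \<open>simp_all only: term_algebra_simps\<close>)
      then show ?thesis using that by (simp only: out_def restrict_apply if_True)
    qed
  qed
  have solE: "Mod_obj R Y \<Longrightarrow> y ` vars E \<subseteq> carrier Y \<Longrightarrow> solves Y y E \<Longrightarrow> E \<in> J \<Longrightarrow>
      out E (ev Y y) \<in> Mod_hom R (C E) Y \<and> (\<forall>s\<in>?T E. out E (ev Y y) (q E s) = ev Y y s)"
    for E and Y :: "('r, 'u) module" and y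
    using out[OF _ ev_Mod_hom[of R Y y "vars E"]] unfolding consequence_def Mod_obj_def
    by blast
  \<comment> \<open>the transition maps send the class of a term to its class for the larger system\<close>
  define g where "g E E' = out E (q E')" for E E'
  have g: "g E E' \<in> Mod_hom R (C E) (C E')" "\<And>s. s \<in> ?T E \<Longrightarrow> g E E' (q E s) = q E' s"
    if "E \<in> J" "E' \<in> J" "E \<subseteq> E'" for E E'
  proof -
    note T = Tmono[OF that(3)]
    have v: "vars E \<subseteq> vars E'" using that(3) by (auto simp: vars_def)
    have h: "restrict (q E') (?T E) \<in> Mod_hom R (?A E) (C E')"
    proof (rule Mod_homI)
      show "restrict (q E') (?T E) \<in> carrier (?A E) \<rightarrow>\<^sub>E carrier (C E')"
        unfolding term_algebra_simps restrict_PiE_iff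
        using T Mod_hom_closed[OF q[OF that(2)], unfolded term_algebra_simps] by blast
    next
      fix s t assume "s \<in> carrier (?A E)" "t \<in> carrier (?A E)"
      then show "restrict (q E') (?T E) (s \<oplus>\<^bsub>?A E\<^esub> t) = restrict (q E') (?T E) s \<oplus>\<^bsub>C E'\<^esub> restrict (q E') (?T E) t"
        using Mod_hom_add[OF q[OF that(2)], of s t] T
        by (simp add: subset_iff del: in_lists_conv_set)
    next
      fix a s assume a: "a \<in> carrier R" "s \<in> carrier (?A E)"
      have "a \<odot>\<^bsub>?A E\<^esub> s = a \<odot>\<^bsub>?A E'\<^esub> s" by (simp add: term_algebra_def)
      moreover have "a \<odot>\<^bsub>?A E\<^esub> s \<in> ?T E" using a by (intro term_algebra_smult_closed[OF ring]) simp_all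
      ultimately show "restrict (q E') (?T E) (a \<odot>\<^bsub>?A E\<^esub> s) = a \<odot>\<^bsub>C E'\<^esub> restrict (q E') (?T E) s"
        using Mod_hom_smult[OF q[OF that(2)], of a s] T a
        by (simp add: subset_iff del: in_lists_conv_set)
    qed
    have e: "q E' s = q E' t" if st: "s \<in> ?T E" "t \<in> ?T E" "consequence R TYPE('u) E s t" for s t
    proof -
      have "consequence R TYPE('u) E' s t"
        unfolding consequence_def
      proof (intro allI impI)
        fix Y :: "('r, 'u) module" and y
        assume "Mod_obj R Y \<and> y ` vars E' \<subseteq> carrier Y \<and> solves Y y E'"
        then have "Mod_obj R Y \<and> y ` vars E \<subseteq> carrier Y \<and> solves Y y E"
          using v \<open>E \<subseteq> E'\<close> unfolding solves_def by blast
        then show "ev Y y s = ev Y y t" using st(3) unfolding consequence_def by blast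
      qed
      then show ?thesis using qeq[OF \<open>E' \<in> J\<close>] st T by blast
    qed
    show "g E E' \<in> Mod_hom R (C E) (C E')"
      unfolding g_def by (rule out(1)[OF that(1) h e])
    show "g E E' (q E s) = q E' s" if "s \<in> ?T E" for s
      unfolding g_def by (rule out(2)[OF \<open>E \<in> J\<close> h e that])
  qed
  define \<mu> where "\<mu> E = out E (ev X id)" for E
  have \<mu>: "\<mu> E \<in> Mod_hom R (C E) X" "\<And>s. s \<in> ?T E \<Longrightarrow> \<mu> E (q E s) = ev X id s" if "E \<in> J" for E
    using solE[OF X, of id E] vars[OF that] that unfolding \<mu>_def J_def by auto
  have opC: "op_closed R (C E)" if "E \<in> J" for E
    using C[OF that] left_module_op_closed unfolding Mod_obj_def by blast
  have f\<mu>: "compose (carrier (C E)) f (\<mu> E) \<in> Mod_hom R (C E) M" if "E \<in> J" for E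
    by (rule Mod_hom_compose[OF \<mu>(1)[OF that] f opC[OF that]])
  \<comment> \<open>Realizability is stated for numbered variables, so the variables of \<open>E\<close> are renamed along an
    injection \<open>n\<close>; \<open>x\<close> is its inverse, with an arbitrary value off the range.\<close>
  have CI: "(C E, compose (carrier (C E)) f (\<mu> E), M) \<in> \<I>" if E: "E \<in> J" for E
  proof -
    have "finite (vars E)" using E unfolding J_def vars_def by auto
    then obtain n :: "'u \<Rightarrow> nat" where n: "inj_on n (vars E)"
      using finite_imp_inj_to_nat_seg by blast
    let ?ren = "map (map_prod id n) :: ('r \<times> 'u) list \<Rightarrow> _"
    define x where "x i = (if i \<in> n ` vars E then inv_into (vars E) n i else \<zero>\<^bsub>X\<^esub>)" for i
    have xn: "x (n v) = v" if "v \<in> vars E" for v using that n by (simp add: x_def)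
    have evx: "ev X x (?ren s) = ev X id s" if "s \<in> ?T E" for s
      unfolding ev_map by (rule ev_cong) (use that xn in auto)
    let ?E = "map_prod ?ren ?ren ` E"
    have ren: "?ren s \<in> terms R UNIV" if "s \<in> ?T E" for s
      using that by (auto simp: lists_eq_set simp del: in_lists_conv_set)
    have varE: "vars ?E = n ` vars E"
      unfolding vars_def by (force simp: image_Un image_UN)
    have "realizable ?E (f \<circ> x)"
    proof (rule loc)
      show "finite ?E" using E by (simp add: J_def)
      show "?E \<subseteq> terms R UNIV \<times> terms R UNIV"
      proof
        fix p assume "p \<in> ?E"
        then obtain s t where st: "(s, t) \<in> E" "p = (?ren s, ?ren t)" by auto
        then have "s \<in> ?T E" "t \<in> ?T E" using subT[OF E] by blast+
        then show "p \<in> terms R UNIV \<times> terms R UNIV" using ren st(2) by blast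
      qed
      show "range x \<subseteq> carrier X" using vars[OF E] inv_into_into[of _ n "vars E"] by (auto simp: x_def)
      show "solves X x ?E"
        unfolding solves_def
      proof safe
        fix s t assume st: "(s, t) \<in> E"
        then have "s \<in> ?T E" "t \<in> ?T E" using subT[OF E] by blast+
        then show "ev X x (?ren s) = ev X x (?ren t)"
          using evx st E unfolding J_def solves_def by (auto simp del: in_lists_conv_set)
      qed
    qed
    then obtain Y h y where Y: "(Y, h, M) \<in> \<I>" and y: "range y \<subseteq> carrier Y" "solves Y y ?E"
      and hy: "\<forall>i\<in>vars ?E. h (y i) = (f \<circ> x) i"
      unfolding realizable_def by blast
    let ?y = "y \<circ> n"
    have ys: "solves Y ?y E" "?y ` vars E \<subseteq> carrier Y"
    proof -
      have "ev Y ?y s = ev Y ?y t" if st: "(s, t) \<in> E" for s t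
      proof -
        have "(?ren s, ?ren t) \<in> ?E" using st by force
        then have "case (?ren s, ?ren t) of (s, t) \<Rightarrow> ev Y y s = ev Y y t"
          using y(2) unfolding solves_def by (rule bspec[rotated])
        then have "ev Y y (?ren s) = ev Y y (?ren t)" by (simp only: prod.case)
        then show ?thesis by (simp only: ev_map)
      qed
      then show "solves Y ?y E" unfolding solves_def by blast
      show "?y ` vars E \<subseteq> carrier Y" using y(1) by auto
    qed
    let ?\<psi> = "out E (ev Y ?y)"
    have \<psi>: "?\<psi> \<in> Mod_hom R (C E) Y" "\<And>s. s \<in> ?T E \<Longrightarrow> ?\<psi> (q E s) = ev Y ?y s"
      using solE[OF over_obj[OF Y] ys(2,1) E] by blast+
    have "h (?\<psi> u) = compose (carrier (C E)) f (\<mu> E) u" if u: "u \<in> carrier (C E)" for u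
    proof -
      obtain s where s: "s \<in> ?T E" "u = q E s" using qrep[OF E u] by blast
      have "h (?\<psi> u) = ev M (h \<circ> ?y) s"
        using \<psi>(2) s ev_hom[OF over_module[OF Y] M_module over_hom[OF Y] s(1) ys(2)] by simp
      also have "\<dots> = ev M (f \<circ> id) s"
      proof (rule ev_cong)
        fix v assume "v \<in> snd ` set s"
        then have "v \<in> vars E" using s by auto
        then show "(h \<circ> ?y) v = (f \<circ> id) v" using hy xn by (simp add: varE)
      qed
      also have "\<dots> = f (ev X id s)"
        using ev_hom[OF XM M_module f s(1), of id] vars[OF E] by simp
      also have "\<dots> = compose (carrier (C E)) f (\<mu> E) u"
        using u s \<mu>(2)[OF E] by (simp add: compose_def)
      finally show ?thesis .
    qed
    then show ?thesis by (rule over_pullback[OF C[OF E] \<psi>(1) Y f\<mu>[OF E]])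
  qed
  \<comment> \<open>index sets of directed systems are subsets of \<open>'u\<close>\<close>
  obtain enc :: "_ \<Rightarrow> 'u" where enc: "inj_on enc J" using small_embedding[OF smJ] by blast
  define dec where "dec = inv_into J enc"
  have dec[simp]: "dec (enc E) = E" if "E \<in> J" for E using that enc by (simp add: dec_def)
  let ?I = "enc ` J"
  define r where "r = {(enc E, enc E') |E E'. E \<in> J \<and> E' \<in> J \<and> E \<subseteq> E'}"
  have rE: "\<exists>E E'. i = enc E \<and> j = enc E' \<and> E \<in> J \<and> E' \<in> J \<and> E \<subseteq> E'" if "(i, j) \<in> r" for i j
    using that unfolding r_def by blast
  have empty: "{} \<in> J" by (simp add: J_def solves_def)
  have un: "E \<union> E' \<in> J" if "E \<in> J" "E' \<in> J" for E E'
    using that unfolding J_def solves_def by blast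
  have dir: "directed_set ?I r"
    unfolding directed_set_def preorder_on_def
  proof (intro conjI ballI)
    show "trans r"
    proof (rule transI)
      fix i j k assume "(i, j) \<in> r" "(j, k) \<in> r"
      then show "(i, k) \<in> r"
        unfolding r_def using inj_onD[OF enc] by blast
    qed
    show "\<exists>k\<in>?I. (i, k) \<in> r \<and> (j, k) \<in> r" if "i \<in> ?I" "j \<in> ?I" for i j
      using that un unfolding r_def by blast
  qed (use empty small_image[OF smJ] in \<open>auto simp: r_def refl_on_def\<close>)
  let ?G = "\<lambda>i. C (dec i)" and ?g = "\<lambda>i j. g (dec i) (dec j)" and ?\<mu> = "\<lambda>i. \<mu> (dec i)"
  let ?N = "\<lambda>i :: 'u. M" and ?h = "\<lambda>(i :: 'u) (j :: 'u). Mod_id M" and ?\<nu> = "\<lambda>i :: 'u. Mod_id M"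
  let ?f = "\<lambda>i. compose (carrier (?G i)) f (?\<mu> i)"
  have sysG: "directed_system R ?I r ?G ?g"
    unfolding directed_system_def
  proof (intro conjI ballI allI impI)
    fix i assume "i \<in> ?I"
    then obtain E where E: "E \<in> J" "i = enc E" by blast
    show "Mod_obj R (?G i)" using C E by simp
    show "?g i i = Mod_id (?G i)"
    proof (rule Mod_hom_eqI[OF _ Mod_hom_id])
      show "?g i i \<in> Mod_hom R (?G i) (?G i)" using g E by simp
      show "op_closed R (?G i)" using opC E by simp
      fix u assume "u \<in> carrier (?G i)"
      moreover from this obtain s where "s \<in> ?T E" "u = q E s" using E qrep[of E u] by auto
      ultimately show "?g i i u = Mod_id (?G i) u" using g(2)[of E E s] E by (simp add: Mod_id_def)
    qed
  next
    fix p assume "p \<in> r"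
    then show "case p of (i, j) \<Rightarrow> ?g i j \<in> Mod_hom R (?G i) (?G j)"
      using g(1) by (auto dest!: rE)
  next
    fix i j k assume ijk: "(i, j) \<in> r \<and> (j, k) \<in> r"
    obtain E E' where E: "E \<in> J" "E' \<in> J" "E \<subseteq> E'" "i = enc E" "j = enc E'" using ijk rE by blast
    obtain E'' where E'': "E'' \<in> J" "E' \<subseteq> E''" "k = enc E''"
      using ijk rE[of j k] E dec by metis
    have sub: "E \<subseteq> E''" using E E'' by blast
    show "compose (carrier (?G i)) (?g j k) (?g i j) = ?g i k"
    proof (rule Mod_hom_eqI)
      show "compose (carrier (?G i)) (?g j k) (?g i j) \<in> Mod_hom R (?G i) (?G k)"
        by (rule Mod_hom_compose[of _ _ _ "?G j"]) (use E E'' g opC in simp_all)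
      show "?g i k \<in> Mod_hom R (?G i) (?G k)" using g E E'' sub by simp
      fix u assume u: "u \<in> carrier (?G i)"
      then obtain s where s: "s \<in> ?T E" "u = q E s" using E qrep[of E u] by auto
      then have s': "s \<in> ?T E'" using Tmono[OF E(3)] by blast
      show "compose (carrier (?G i)) (?g j k) (?g i j) u = ?g i k u"
        using u E E'' sub g(2)[of E E' s] g(2)[of E' E'' s] g(2)[of E E'' s] s s'
        by (simp add: compose_def del: in_lists_conv_set)
    qed
  qed
  have coG: "cocone R ?I r ?G ?g X ?\<mu>"
    unfolding cocone_def
  proof (intro conjI ballI X)
    show "?\<mu> i \<in> Mod_hom R (?G i) X" if "i \<in> ?I" for i using that \<mu> by auto
    fix p assume p: "p \<in> r"
    then obtain E E' where E: "E \<in> J" "E' \<in> J" "E \<subseteq> E'" "p = (enc E, enc E')"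
      unfolding r_def by blast
    have "compose (carrier (C E)) (\<mu> E') (g E E') = \<mu> E"
    proof (rule Mod_hom_eqI)
      show "compose (carrier (C E)) (\<mu> E') (g E E') \<in> Mod_hom R (C E) X"
        by (rule Mod_hom_compose[OF g(1) \<mu>(1) opC]) (use E in simp_all)
      show "\<mu> E \<in> Mod_hom R (C E) X" using \<mu> E by simp
      fix u assume u: "u \<in> carrier (C E)"
      then obtain s where s: "s \<in> ?T E" "u = q E s" using E qrep[of E u] by blast
      then have s': "s \<in> ?T E'" using Tmono[OF E(3)] by blast
      show "compose (carrier (C E)) (\<mu> E') (g E E') u = \<mu> E u"
        using u E g(2)[of E E' s] \<mu>(2)[of E s] \<mu>(2)[of E' s] s s'
        by (simp add: compose_def del: in_lists_conv_set)
    qed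
    then show "case p of (i, j) \<Rightarrow> compose (carrier (?G i)) (?\<mu> j) (?g i j) = ?\<mu> i"
      using E by simp
  qed
  have limG: "direct_limit R ?I r ?G ?g X ?\<mu>"
  proof (rule direct_limitI[OF dir sysG coG])
    fix x assume x: "x \<in> carrier X"
    let ?s = "[(\<one>\<^bsub>R\<^esub>, x)]"
    let ?E = "{(?s, ?s)}"
    have E: "?E \<in> J" using x by (simp add: J_def solves_def)
    have s: "?s \<in> ?T ?E" by (simp add: vars_def)
    have "\<mu> ?E (q ?E ?s) = x" using \<mu>(2)[OF E s] x by (simp add: X.smult_one)
    moreover have "q ?E ?s \<in> carrier (C ?E)" using qsurj[OF E] s unfolding term_algebra_simps by blast
    ultimately show "\<exists>i\<in>?I. x \<in> ?\<mu> i ` carrier (?G i)"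
      using E by (intro bexI[of _ "enc ?E"]) (auto intro!: rev_image_eqI)
  next
    fix i a b assume i: "i \<in> ?I" and ab: "a \<in> carrier (?G i)" "b \<in> carrier (?G i)" "?\<mu> i a = ?\<mu> i b"
    then obtain E where E: "E \<in> J" "i = enc E" by blast
    then obtain s t where s: "s \<in> ?T E" "a = q E s" and t: "t \<in> ?T E" "b = q E t"
      using ab qrep[OF E(1), of a] qrep[OF E(1), of b] by (simp del: in_lists_conv_set) blast
    have eq: "ev X id s = ev X id t" using ab E s t \<mu>(2)[OF E(1)] by simp
    let ?E = "insert (s, t) E"
    have TX: "?T E \<subseteq> terms R (carrier X)" by (intro lists_mono Sigma_mono vars E subset_refl)
    have E': "?E \<in> J" using E s t eq TX unfolding J_def solves_def by auto
    have "consequence R TYPE('u) ?E s t" unfolding consequence_def solves_def by blast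
    then have "q ?E s = q ?E t" using qeq[OF E'] s t Tmono[of E ?E] by blast
    then have "g E ?E a = g E ?E b"
      using g(2)[OF E(1) E' subset_insertI s(1)] g(2)[OF E(1) E' subset_insertI t(1)] s(2) t(2) by simp
    then show "\<exists>j. (i, j) \<in> r \<and> ?g i j a = ?g i j b"
      using E E' by (intro exI[of _ "enc ?E"]) (auto simp: r_def)
  qed
  note opM = left_module_op_closed[OF M_module]
  have idM: "Mod_id M \<in> Mod_hom R M M" by (rule Mod_hom_id[OF opM])
  \<comment> \<open>on the side of \<open>M\<close> the system is constant\<close>
  have idid: "compose (carrier M) (Mod_id M) (Mod_id M) = Mod_id M"
    by (auto simp: compose_def Mod_id_def)
  have sysN: "directed_system R ?I r ?N ?h"
    unfolding directed_system_def using M idM idid by auto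
  have limN: "direct_limit R ?I r ?N ?h M ?\<nu>"
  proof (rule direct_limitI[OF dir sysN])
    show "cocone R ?I r ?N ?h M ?\<nu>" unfolding cocone_def using M idM idid by auto
  next
    fix x assume "x \<in> carrier M"
    then show "\<exists>i\<in>?I. x \<in> Mod_id M ` carrier M"
      using empty by (intro bexI[of _ "enc {}"]) (auto simp: Mod_id_def)
  next
    fix i x y assume "i \<in> ?I" "x \<in> carrier M" "y \<in> carrier M" "Mod_id M x = Mod_id M y"
    then show "\<exists>j. (i, j) \<in> r \<and> Mod_id M x = Mod_id M y"
      using directed_setD(1)[OF dir] by blast
  qed
  have Mid: "compose A (Mod_id M) (compose A f h) = compose A f h" if "h \<in> A \<rightarrow> carrier X" for A h
    using that Mod_hom_closed[OF f] by (auto simp: compose_def Mod_id_def fun_eq_iff Pi_iff)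
  have sm: "system_morphism R ?I r ?G ?g ?N ?h ?f"
    unfolding system_morphism_def
  proof (intro conjI ballI)
    show "?f i \<in> Mod_hom R (?G i) M" if "i \<in> ?I" for i using that f\<mu> by auto
    fix p assume p: "p \<in> r"
    then obtain E E' where E: "E \<in> J" "E' \<in> J" "E \<subseteq> E'" "p = (enc E, enc E')"
      unfolding r_def by blast
    have "compose (carrier (C E)) (Mod_id M) (compose (carrier (C E)) f (\<mu> E)) = compose (carrier (C E)) f (\<mu> E)"
      using \<mu>(1)[THEN Mod_hom_closed] E by (intro Mid) blast
    also have "\<dots> = compose (carrier (C E)) (compose (carrier (C E')) f (\<mu> E')) (g E E')"
    proof (rule ext)
      fix u
      have "\<mu> E' (g E E' u) = \<mu> E u" "g E E' u \<in> carrier (C E')" if u: "u \<in> carrier (C E)"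
      proof -
        show "g E E' u \<in> carrier (C E')" using Mod_hom_closed[OF g(1) u] E by blast
        obtain s where s: "s \<in> ?T E" "u = q E s" using E qrep[of E u] u by blast
        then have s': "s \<in> ?T E'" using Tmono[OF E(3)] by blast
        show "\<mu> E' (g E E' u) = \<mu> E u"
          using u E g(2)[of E E' s] \<mu>(2)[of E s] \<mu>(2)[of E' s] s s' by simp
      qed
      then show "compose (carrier (C E)) f (\<mu> E) u =
          compose (carrier (C E)) (compose (carrier (C E')) f (\<mu> E')) (g E E') u"
        by (simp add: compose_def)
    qed
    finally show "case p of (i, j) \<Rightarrow> compose (carrier (?G i)) (Mod_id M) (?f i) = compose (carrier (?G i)) (?f j) (?g i j)"
      using E by simp
  qed
  have comm: "\<forall>i\<in>?I. compose (carrier (?G i)) f (?\<mu> i) = compose (carrier (?G i)) (?\<nu> i) (?f i)"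
    using \<mu>(1)[THEN Mod_hom_closed] by (intro ballI Mid[symmetric]) auto
  have "limit_morphism R ?I r ?G ?g ?N ?h ?f (X, f, M)"
    unfolding limit_morphism_def prod.case
  proof (rule conjI[OF dir conjI[OF sysG conjI[OF sysN conjI[OF sm]]]], rule exI, rule exI)
    show "direct_limit R ?I r ?G ?g X ?\<mu> \<and> direct_limit R ?I r ?N ?h M ?\<nu> \<and> f \<in> Mod_hom R X M \<and>
        (\<forall>i\<in>?I. compose (carrier (?G i)) f (?\<mu> i) = compose (carrier (?G i)) (?\<nu> i) (?f i))"
      by (rule conjI[OF limG conjI[OF limN conjI[OF f comm]]])
  qed
  moreover have "\<forall>i\<in>?I. (?G i, ?f i, ?N i) \<in> \<I>" using CI by auto
  ultimately have "limit_morphism R ?I r ?G ?g ?N ?h ?f (X, f, M) \<and> (\<forall>i\<in>?I. (?G i, ?f i, ?N i) \<in> \<I>)"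
    by (rule conjI)
  with limits show ?thesis
    unfolding closed_under_direct_limits_def by (elim allE impE)
qed

end

section \<open>Rigid objects\<close>

context limit_closed_ideal
begin

definition over_map :: "('r, 'u) module \<Rightarrow> ('u \<Rightarrow> 'u) \<Rightarrow> ('r, 'u) module \<Rightarrow> ('u \<Rightarrow> 'u) \<Rightarrow> ('u \<Rightarrow> 'u) \<Rightarrow> bool" where
  "over_map X f Z g k \<longleftrightarrow> k \<in> Mod_hom R X Z \<and> (\<forall>x\<in>carrier X. g (k x) = f x)"

definition rigid :: "('r, 'u) module \<Rightarrow> ('u \<Rightarrow> 'u) \<Rightarrow> bool" where
  "rigid X f \<longleftrightarrow> (X, f, M) \<in> \<I> \<and>
     (\<forall>Z g k. (Z, g, M) \<in> \<I> \<and> over_map X f Z g k \<longrightarrow> inj_on k (carrier X))"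

lemma over_map_compose:
  assumes "Mod_obj R X" and "over_map X f Y g k" and "over_map Y g Z h l"
  shows "over_map X f Z h (compose (carrier X) l k)"
proof -
  have "op_closed R X" using assms(1) left_module_op_closed unfolding Mod_obj_def by blast
  then have "compose (carrier X) l k \<in> Mod_hom R X Z"
    using Mod_hom_compose assms(2,3) unfolding over_map_def by blast
  moreover have "h (compose (carrier X) l k x) = f x" if "x \<in> carrier X" for x
    using that assms(2,3) Mod_hom_closed[of k R X Y x] unfolding over_map_def by (simp add: compose_def)
  ultimately show ?thesis unfolding over_map_def by blast
qed

definition over_kernels :: "('r, 'u) module \<Rightarrow> ('u \<Rightarrow> 'u) \<Rightarrow> ('u \<times> 'u) set set" where
  "over_kernels X f = {kern X k |k Z g. (Z, g, M) \<in> \<I> \<and> over_map X f Z g k}"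

lemma quotient_over:
  assumes X: "Mod_obj R X" and f: "f \<in> Mod_hom R X M"
    and \<theta>: "congruence R X \<theta>" "\<theta> \<subseteq> kern X f"
  obtains Q g q where "Mod_obj R Q" "g \<in> Mod_hom R Q M" "over_map X f Q g q" "q ` carrier X = carrier Q" "kern X q = \<theta>"
proof -
  have opX: "op_closed R X" using X left_module_op_closed unfolding Mod_obj_def by blast
  obtain Q :: "('r, 'u) module" and q where Q: "Mod_obj R Q" and q: "q \<in> Mod_hom R X Q"
    "q ` carrier X = carrier Q" "kern X q = \<theta>"
    by (rule quotient_module[OF X \<theta>(1)]) (rule that)
  have f_eq: "f x = f y" if "x \<in> carrier X" "y \<in> carrier X" "q x = q y" for x y
    using that \<theta>(2) q(3) unfolding kern_def by blast
  show ?thesis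
  proof (rule that[OF Q _ _ q(2,3)])
    show "factor X q f \<in> Mod_hom R Q M" by (rule factor_Mod_hom[OF opX q(1,2) f f_eq])
    show "over_map X f Q (factor X q f) q"
      unfolding over_map_def using q(1) factor_apply[of X q f, OF f_eq] by blast
  qed
qed

text \<open>
  To check the local criterion for a quotient of \<open>X\<close>, its solutions are replaced by tuples of \<open>X\<close> which
  solve the system up to the congruence.
\<close>

lemma lift_solution:
  assumes X: "left_module R X" and Q: "left_module R Q" and q: "q \<in> Mod_hom R X Q" "q ` carrier X = carrier Q"
    and E: "E \<subseteq> terms R UNIV \<times> terms R UNIV" and x: "range (x :: nat \<Rightarrow> 'u) \<subseteq> carrier Q" "solves Q x E"
  obtains a where "range a \<subseteq> carrier X" "x = q \<circ> a" "\<And>s t. (s, t) \<in> E \<Longrightarrow> (ev X a s, ev X a t) \<in> kern X q"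
proof -
  have "\<forall>i. \<exists>a. a \<in> carrier X \<and> q a = x i" using x(1) q(2) by (metis image_iff range_subsetD)
  then obtain a where a: "\<And>i. a i \<in> carrier X" "\<And>i. q (a i) = x i" by metis
  have ra: "range a \<subseteq> carrier X" using a by blast
  have qa: "x = q \<circ> a" using a by (simp add: fun_eq_iff)
  have "(ev X a s, ev X a t) \<in> kern X q" if st: "(s, t) \<in> E" for s t
  proof -
    have T: "s \<in> terms R UNIV" "t \<in> terms R UNIV" using st E by blast+
    have "ev Q x s = ev Q x t" using x(2) st unfolding solves_def by blast
    then have "q (ev X a s) = q (ev X a t)" using ev_hom[OF X Q q(1) _ ra] T qa by simp
    then show ?thesis using ev_closed[OF X _ ra] T unfolding kern_def by blast
  qed
  then show ?thesis by (rule that[OF ra qa])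
qed

text \<open>
  A finite system involves only finitely many pairs of the union \<open>\<Union>\<C>\<close>, and these already lie in one member
  of the chain \<open>\<C>\<close>, that is, in the kernel of a map to an object over \<open>M\<close>. There the system is solved.
\<close>

lemma chain_quotient:
  assumes X: "(X, f, M) \<in> \<I>" and ne: "\<C> \<noteq> {}" and ch: "subset.chain (over_kernels X f) \<C>"
  obtains Q g q where "(Q, g, M) \<in> \<I>" "over_map X f Q g q" "q ` carrier X = carrier Q" "kern X q = \<Union>\<C>"
proof -
  note XM = over_module[OF X]
  have sub: "\<C> \<subseteq> over_kernels X f" using ch by (simp add: subset_chain_def)
  have ker: "\<exists>k Z g. \<theta> = kern X k \<and> (Z, g, M) \<in> \<I> \<and> over_map X f Z g k" if "\<theta> \<in> \<C>" for \<theta>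
    using sub that unfolding over_kernels_def by blast
  have "congruence R X (\<Union>\<C>)"
  proof (rule congruence_Union[OF ne ch])
    fix \<theta> assume "\<theta> \<in> \<C>"
    then obtain k Z g where "\<theta> = kern X k" "(Z, g, M) \<in> \<I>" "over_map X f Z g k" using ker by blast
    then show "congruence R X \<theta>"
      using congruence_kern[OF XM over_module] unfolding over_map_def by blast
  qed
  moreover have "\<Union>\<C> \<subseteq> kern X f"
  proof
    fix p assume "p \<in> \<Union>\<C>"
    then obtain k Z g where k: "p \<in> kern X k" "over_map X f Z g k" using ker by blast
    obtain x y where xy: "p = (x, y)" "x \<in> carrier X" "y \<in> carrier X" "k x = k y"
      using k(1) unfolding kern_def by blast
    then have "f x = f y" using k(2) unfolding over_map_def by metis
    then show "p \<in> kern X f" using xy by (simp add: kern_def)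
  qed
  ultimately obtain Q g q where Q: "Mod_obj R Q" and g: "g \<in> Mod_hom R Q M"
    and q: "over_map X f Q g q" "q ` carrier X = carrier Q" "kern X q = \<Union>\<C>"
    by (rule quotient_over[OF over_obj[OF X] over_hom[OF X]]) (rule that)
  have qh: "q \<in> Mod_hom R X Q" and gq: "\<And>x. x \<in> carrier X \<Longrightarrow> g (q x) = f x"
    using q(1) unfolding over_map_def by blast+
  have "(Q, g, M) \<in> \<I>"
  proof (rule over_if_locally_over[OF Q g])
    fix E x assume E: "finite E" "E \<subseteq> terms R UNIV \<times> terms R UNIV"
      and x: "range (x :: nat \<Rightarrow> 'u) \<subseteq> carrier Q" "solves Q x E"
    have QM: "left_module R Q" using Q by (simp add: Mod_obj_def)
    obtain a where a: "range a \<subseteq> carrier X" "x = q \<circ> a"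
      and st: "\<And>s t. (s, t) \<in> E \<Longrightarrow> (ev X a s, ev X a t) \<in> kern X q"
      by (rule lift_solution[OF XM QM qh q(2) E(2) x]) (rule that)
    have "map_prod (ev X a) (ev X a) ` E \<subseteq> \<Union>\<C>" using st q(3) by auto
    then obtain \<theta> where \<theta>: "\<theta> \<in> \<C>" "map_prod (ev X a) (ev X a) ` E \<subseteq> \<theta>"
      using finite_subset_Union_chain[OF _ _ ne ch] E(1) by (metis finite_imageI)
    obtain k Z h where k: "\<theta> = kern X k" and Z: "(Z, h, M) \<in> \<I>" and kh: "over_map X f Z h k"
      using ker[OF \<theta>(1)] by blast
    have kX: "k \<in> Mod_hom R X Z" and hk: "\<And>x. x \<in> carrier X \<Longrightarrow> h (k x) = f x"
      using kh unfolding over_map_def by blast+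
    show "realizable E (g \<circ> x)"
      unfolding realizable_def
    proof (intro exI conjI ballI)
      show "(Z, h, M) \<in> \<I>" by (rule Z)
      show "range (k \<circ> a) \<subseteq> carrier Z" using a(1) Mod_hom_closed[OF kX] by auto
      show "solves Z (k \<circ> a) E"
        unfolding solves_def
      proof safe
        fix s t assume "(s, t) \<in> E"
        then have "k (ev X a s) = k (ev X a t)" "s \<in> terms R UNIV" "t \<in> terms R UNIV"
          using \<theta>(2) E(2) unfolding k kern_def by auto
        then show "ev Z (k \<circ> a) s = ev Z (k \<circ> a) t"
          using ev_hom[OF XM over_module[OF Z] kX _ a(1)] by metis
      qed
      show "h ((k \<circ> a) i) = (g \<circ> x) i" for i
        using hk gq a by (simp add: image_subset_iff)
    qed
  qed
  then show ?thesis by (rule that[OF _ q])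
qed

text \<open>
  The quotient by a maximal kernel is rigid, since the kernel of a further map would pull back to a
  larger kernel. Zorn's lemma applies because unions of chains of kernels are kernels of quotient maps
  over \<open>M\<close>.
\<close>

lemma rigid_quotient:
  assumes X: "(X, f, M) \<in> \<I>"
  obtains Q g q where "rigid Q g" "over_map X f Q g q"
proof -
  let ?K = "over_kernels X f"
  have "over_map X f X f (Mod_id X)"
    using Mod_hom_id[OF left_module_op_closed[OF over_module[OF X]]] by (simp add: over_map_def Mod_id_def)
  then have "?K \<noteq> {}" unfolding over_kernels_def using X by blast
  moreover have "\<Union>\<C> \<in> ?K" if ne: "\<C> \<noteq> {}" and ch: "subset.chain ?K \<C>" for \<C>
  proof -
    obtain Q g q where "(Q, g, M) \<in> \<I>" "over_map X f Q g q" "kern X q = \<Union>\<C>"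
      by (rule chain_quotient[OF X ne ch]) (rule that)
    then show ?thesis unfolding over_kernels_def by blast
  qed
  ultimately have "\<exists>\<theta>\<in>?K. \<forall>\<theta>'\<in>?K. \<theta> \<subseteq> \<theta>' \<longrightarrow> \<theta>' = \<theta>" by (rule subset_Zorn_nonempty)
  then obtain \<theta> where \<theta>: "\<theta> \<in> ?K" and max: "\<forall>\<theta>'\<in>?K. \<theta> \<subseteq> \<theta>' \<longrightarrow> \<theta>' = \<theta>" by (rule bexE)
  have "{\<theta>} \<noteq> {}" "subset.chain ?K {\<theta>}" using \<theta> by (auto simp: subset_chain_def)
  then obtain Q g q where Q: "(Q, g, M) \<in> \<I>" and q: "over_map X f Q g q" "q ` carrier X = carrier Q" "kern X q = \<Union>{\<theta>}"
    by (rule chain_quotient[OF X]) (rule that)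
  have "rigid Q g"
    unfolding rigid_def
  proof (intro conjI allI impI Q inj_onI)
    fix Z h k u v assume Z: "(Z, h, M) \<in> \<I> \<and> over_map Q g Z h k"
      and uv: "u \<in> carrier Q" "v \<in> carrier Q" "k u = k v"
    let ?c = "compose (carrier X) k q"
    have "over_map X f Z h ?c" using over_map_compose[OF over_obj[OF X] q(1)] Z by blast
    then have "kern X ?c \<in> ?K" unfolding over_kernels_def using Z by blast
    moreover have "\<theta> \<subseteq> kern X ?c" using q(3) by (auto simp: kern_def compose_def)
    ultimately have c: "kern X ?c = \<theta>" using max by blast
    obtain x y where xy: "x \<in> carrier X" "y \<in> carrier X" "u = q x" "v = q y"
      using uv(1,2) q(2) by blast
    then have "(x, y) \<in> kern X ?c" using uv(3) by (simp add: kern_def compose_def)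
    then show "u = v" using c q(3) xy by (auto simp: kern_def)
  qed
  then show ?thesis by (rule that[OF _ q(1)])
qed

end

section \<open>Three-colourings by affine subsets\<close>

text \<open>
  Let \<open>S\<close> be a maximal subset of \<open>G\<close> without differences in \<open>D\<close>. By maximality \<open>G\<close> is covered by \<open>S\<close>, \<open>S + D\<close> and
  \<open>S - D\<close>, where \<open>0 \<notin> D\<close> ensures that an element outside \<open>S\<close> is in conflict with an element of \<open>S\<close>
  and not with itself. If \<open>x = s + d\<close> and \<open>y = s' + d'\<close> both lie in \<open>S + D\<close> and \<open>x - y \<in> D\<close>, then
  \<open>s - s' = (x - y) - d + d'\<close> is in \<open>D\<close> as well, which is impossible; likewise for \<open>S - D\<close>.
\<close>

lemma affine_colouring:
  assumes "abelian_group G" and D: "D \<subseteq> carrier G" and zero: "\<zero>\<^bsub>G\<^esub> \<notin> D"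
    and affine: "\<And>x y z. x \<in> D \<Longrightarrow> y \<in> D \<Longrightarrow> z \<in> D \<Longrightarrow> x \<ominus>\<^bsub>G\<^esub> y \<oplus>\<^bsub>G\<^esub> z \<in> D"
  obtains \<chi> :: "'a \<Rightarrow> nat" where "\<And>x. \<chi> x < 3"
    "\<And>x y. x \<in> carrier G \<Longrightarrow> y \<in> carrier G \<Longrightarrow> x \<ominus>\<^bsub>G\<^esub> y \<in> D \<Longrightarrow> \<chi> x \<noteq> \<chi> y"
proof -
  interpret G: abelian_group G by fact
  have diff_add: "(a \<ominus>\<^bsub>G\<^esub> b) \<oplus>\<^bsub>G\<^esub> (b \<ominus>\<^bsub>G\<^esub> c) = a \<ominus>\<^bsub>G\<^esub> c"
    if "a \<in> carrier G" "b \<in> carrier G" "c \<in> carrier G" for a b c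
    using that by (simp add: G.minus_eq G.a_assoc G.r_neg1)
  have diff_diff: "u \<ominus>\<^bsub>G\<^esub> (a \<ominus>\<^bsub>G\<^esub> b) = u \<oplus>\<^bsub>G\<^esub> (b \<ominus>\<^bsub>G\<^esub> a)"
    if "a \<in> carrier G" "b \<in> carrier G" "u \<in> carrier G" for a b u
    using that by (simp add: G.minus_eq G.minus_add G.a_ac)
  define \<A> where "\<A> = {S. S \<subseteq> carrier G \<and> (\<forall>x\<in>S. \<forall>y\<in>S. x \<ominus>\<^bsub>G\<^esub> y \<notin> D)}"
  have "\<exists>S\<in>\<A>. \<forall>S'\<in>\<A>. S \<subseteq> S' \<longrightarrow> S' = S"
  proof (rule subset_Zorn')
    fix \<C> assume "subset.chain \<A> \<C>"
    then have sub: "\<C> \<subseteq> \<A>" and ch: "\<forall>S\<in>\<C>. \<forall>S'\<in>\<C>. S \<subseteq> S' \<or> S' \<subseteq> S"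
      by (simp_all add: subset_chain_def)
    have "x \<ominus>\<^bsub>G\<^esub> y \<notin> D" if xy: "x \<in> \<Union>\<C>" "y \<in> \<Union>\<C>" for x y
    proof -
      obtain S S' where "S \<in> \<C>" "S' \<in> \<C>" "x \<in> S" "y \<in> S'" using xy by blast
      then obtain T where "T \<in> \<C>" "x \<in> T" "y \<in> T" using ch by blast
      then show ?thesis using sub unfolding \<A>_def by blast
    qed
    moreover have "\<Union>\<C> \<subseteq> carrier G" using sub unfolding \<A>_def by blast
    ultimately show "\<Union>\<C> \<in> \<A>" unfolding \<A>_def by blast
  qed
  then obtain S where S: "S \<in> \<A>" and max: "\<forall>S'\<in>\<A>. S \<subseteq> S' \<longrightarrow> S' = S" by (rule bexE)
  have SG: "x \<in> carrier G" if "x \<in> S" for x using S that unfolding \<A>_def by blast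
  have indep: "x \<ominus>\<^bsub>G\<^esub> y \<notin> D" if "x \<in> S" "y \<in> S" for x y using S that unfolding \<A>_def by blast
  have cover: "x \<in> S \<or> (\<exists>s\<in>S. x \<ominus>\<^bsub>G\<^esub> s \<in> D) \<or> (\<exists>s\<in>S. s \<ominus>\<^bsub>G\<^esub> x \<in> D)" if x: "x \<in> carrier G" for x
  proof (rule ccontr)
    assume n: "\<not> ?thesis"
    have "x \<ominus>\<^bsub>G\<^esub> x \<notin> D" using zero x by (simp add: G.minus_eq G.r_neg)
    then have "insert x S \<in> \<A>" using n S x unfolding \<A>_def by auto
    then have "insert x S = S" using max by blast
    then show False using n by blast
  qed
  define \<chi> :: "'a \<Rightarrow> nat" where
    "\<chi> x = (if x \<in> S then 0 else if \<exists>s\<in>S. x \<ominus>\<^bsub>G\<^esub> s \<in> D then 1 else 2)" for x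
  have "\<chi> x \<noteq> \<chi> y" if xy: "x \<in> carrier G" "y \<in> carrier G" and d: "x \<ominus>\<^bsub>G\<^esub> y \<in> D" for x y
  proof
    assume eq: "\<chi> x = \<chi> y"
    consider "x \<in> S" "y \<in> S" | s s' where "s \<in> S" "s' \<in> S" "x \<ominus>\<^bsub>G\<^esub> s \<in> D" "y \<ominus>\<^bsub>G\<^esub> s' \<in> D"
      | s s' where "s \<in> S" "s' \<in> S" "s \<ominus>\<^bsub>G\<^esub> x \<in> D" "s' \<ominus>\<^bsub>G\<^esub> y \<in> D"
      using eq cover[OF xy(1)] cover[OF xy(2)] unfolding \<chi>_def by (auto split: if_splits)
    then show False
    proof cases
      case 1 then show False using indep d by blast
    next
      case 2
      have "x \<ominus>\<^bsub>G\<^esub> y \<ominus>\<^bsub>G\<^esub> (x \<ominus>\<^bsub>G\<^esub> s) \<oplus>\<^bsub>G\<^esub> (y \<ominus>\<^bsub>G\<^esub> s') \<in> D" using affine d 2 by blast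
      moreover have "x \<ominus>\<^bsub>G\<^esub> y \<ominus>\<^bsub>G\<^esub> (x \<ominus>\<^bsub>G\<^esub> s) \<oplus>\<^bsub>G\<^esub> (y \<ominus>\<^bsub>G\<^esub> s') = s \<ominus>\<^bsub>G\<^esub> s'"
        using xy SG[OF 2(1)] SG[OF 2(2)]
        by (simp add: diff_diff G.a_comm[of "x \<ominus>\<^bsub>G\<^esub> y"] diff_add)
      ultimately show False using indep 2 by simp
    next
      case 3
      have "s \<ominus>\<^bsub>G\<^esub> x \<ominus>\<^bsub>G\<^esub> (s' \<ominus>\<^bsub>G\<^esub> y) \<oplus>\<^bsub>G\<^esub> (x \<ominus>\<^bsub>G\<^esub> y) \<in> D" using affine d 3 by blast
      moreover have "s \<ominus>\<^bsub>G\<^esub> x \<ominus>\<^bsub>G\<^esub> (s' \<ominus>\<^bsub>G\<^esub> y) \<oplus>\<^bsub>G\<^esub> (x \<ominus>\<^bsub>G\<^esub> y) = s \<ominus>\<^bsub>G\<^esub> s'"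
        using xy SG[OF 3(1)] SG[OF 3(2)]
        by (simp add: diff_diff G.a_assoc G.a_comm[of "y \<ominus>\<^bsub>G\<^esub> s'"])
          (simp add: G.a_assoc[symmetric] diff_add)
      ultimately show False using indep 3 by simp
    qed
  qed
  moreover have "\<chi> x < 3" for x by (simp add: \<chi>_def)
  ultimately show ?thesis using that by metis
qed

lemma affine_add:
  assumes "abelian_group G" and "a \<in> carrier G" "b \<in> carrier G" "c \<in> carrier G"
    "a' \<in> carrier G" "b' \<in> carrier G" "c' \<in> carrier G"
  shows "a \<ominus>\<^bsub>G\<^esub> b \<oplus>\<^bsub>G\<^esub> c \<oplus>\<^bsub>G\<^esub> (a' \<ominus>\<^bsub>G\<^esub> b' \<oplus>\<^bsub>G\<^esub> c') =
    a \<oplus>\<^bsub>G\<^esub> a' \<ominus>\<^bsub>G\<^esub> (b \<oplus>\<^bsub>G\<^esub> b') \<oplus>\<^bsub>G\<^esub> (c \<oplus>\<^bsub>G\<^esub> c')"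
proof -
  interpret G: abelian_group G by fact
  show ?thesis using assms(2-) by (simp add: G.minus_eq G.minus_add G.a_ac)
qed

lemma smult_affine:
  assumes "left_module R X" and "a \<in> carrier R" "x \<in> carrier X" "y \<in> carrier X" "z \<in> carrier X"
  shows "a \<odot>\<^bsub>X\<^esub> (x \<ominus>\<^bsub>X\<^esub> y \<oplus>\<^bsub>X\<^esub> z) = a \<odot>\<^bsub>X\<^esub> x \<ominus>\<^bsub>X\<^esub> a \<odot>\<^bsub>X\<^esub> y \<oplus>\<^bsub>X\<^esub> a \<odot>\<^bsub>X\<^esub> z"
proof -
  interpret X: left_module R X by fact
  have "a \<odot>\<^bsub>X\<^esub> y \<oplus>\<^bsub>X\<^esub> a \<odot>\<^bsub>X\<^esub> (\<ominus>\<^bsub>X\<^esub> y) = \<zero>\<^bsub>X\<^esub>"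
    using assms left_module_smult_zero[OF assms(1,2)]
    by (simp add: X.smult_r_distr[symmetric] X.M.r_neg)
  then have "a \<odot>\<^bsub>X\<^esub> (\<ominus>\<^bsub>X\<^esub> y) = \<ominus>\<^bsub>X\<^esub> (a \<odot>\<^bsub>X\<^esub> y)"
    using assms by (metis X.M.a_inv_closed X.M.minus_equality X.M.minus_minus X.smult_closed X.M.a_comm)
  then show ?thesis
    using assms by (simp add: a_minus_def X.smult_r_distr)
qed

lemma ev_affine:
  assumes "left_module R X" and "t \<in> terms R V"
    and "y1 ` V \<subseteq> carrier X" "y2 ` V \<subseteq> carrier X" "y3 ` V \<subseteq> carrier X"
  shows "ev X (\<lambda>v. y1 v \<ominus>\<^bsub>X\<^esub> y2 v \<oplus>\<^bsub>X\<^esub> y3 v) t = ev X y1 t \<ominus>\<^bsub>X\<^esub> ev X y2 t \<oplus>\<^bsub>X\<^esub> ev X y3 t"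
proof -
  interpret X: left_module R X by fact
  show ?thesis using assms(2)
  proof (induction t)
    case Nil
    have "\<zero>\<^bsub>X\<^esub> = \<zero>\<^bsub>X\<^esub> \<ominus>\<^bsub>X\<^esub> \<zero>\<^bsub>X\<^esub> \<oplus>\<^bsub>X\<^esub> \<zero>\<^bsub>X\<^esub>" by (simp add: X.M.minus_eq X.M.r_neg)
    then show ?case by simp
  next
    case (Cons p t)
    have e: "ev X y1 t \<in> carrier X" "ev X y2 t \<in> carrier X" "ev X y3 t \<in> carrier X"
      using ev_closed[OF assms(1)] Cons assms(3-) by blast+
    have p: "fst p \<in> carrier R" "y1 (snd p) \<in> carrier X" "y2 (snd p) \<in> carrier X" "y3 (snd p) \<in> carrier X"
      using Cons assms(3-) by auto
    show ?case
      using Cons e p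
      by (simp add: smult_affine[OF assms(1)] X.smult_closed affine_add[OF X.M.abelian_group_axioms])
  qed
qed

section \<open>The size of rigid objects\<close>

context limit_closed_ideal
begin

text \<open>
  A label records a system \<open>E\<close>, the intended images \<open>m\<close> in \<open>M\<close> of its variables, and for each equation the
  coefficient \<open>c\<close> of the error that is allowed in a solution. The systems that are realizable by \<open>m\<close> are
  excluded. The functions are extensional so that the labels form a small set.
\<close>

definition labels :: "((('r \<times> nat) list \<times> ('r \<times> nat) list) set \<times> (nat \<Rightarrow> 'u) \<times> (('r \<times> nat) list \<times> ('r \<times> nat) list \<Rightarrow> 'r)) set" where
  "labels = {(E, m, c). E \<subseteq> terms R UNIV \<times> terms R UNIV \<and> m \<in> UNIV \<rightarrow>\<^sub>E carrier M \<and>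
     c \<in> terms R UNIV \<times> terms R UNIV \<rightarrow>\<^sub>E carrier R \<and> \<not> realizable E m}"

text \<open>
  The values of \<open>f\<close> and of one colouring per label: a set, independent of the object, into which every
  rigid object will be seen to embed.
\<close>

definition rigid_bound where
  "rigid_bound = carrier M \<times> (labels \<rightarrow>\<^sub>E {..<3 :: nat})"

lemma small_rigid_bound: "small TYPE('u) rigid_bound"
proof -
  let ?T = "terms R (UNIV :: nat set)"
  have T: "small TYPE('u) (?T \<times> ?T)"
    by (intro small_lists small_Times universe small_ring small_nat)
  have M: "small TYPE('u) (carrier M)" using M by (simp add: Mod_obj_def)
  have "small TYPE('u) (Pow (?T \<times> ?T) \<times> ((UNIV :: nat set) \<rightarrow>\<^sub>E carrier M) \<times> (?T \<times> ?T \<rightarrow>\<^sub>E carrier R))"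
    by (intro small_Times small_Pow small_PiE universe T M small_ring small_nat)
  then have "small TYPE('u) labels" by (rule small_subset) (auto simp: labels_def)
  moreover have "small TYPE('u) {..<3 :: nat}" by (rule small_subset[OF small_nat[OF universe] subset_UNIV])
  ultimately show ?thesis
    unfolding rigid_bound_def by (intro small_Times small_PiE universe M)
qed

text \<open>
  The elements \<open>z\<close> of the kernel of \<open>f\<close> for which \<open>E\<close> has a solution modulo \<open>z\<close> with the prescribed error
  coefficients. If such a \<open>z\<close> were \<open>0\<close>, then \<open>E\<close> would be solved in \<open>X\<close> itself and hence be realizable, contrary to the choice of labels.
\<close>

definition obstructed where
  "obstructed X f l = (case l of (E, m, c) \<Rightarrow> {z \<in> carrier X. f z = \<zero>\<^bsub>M\<^esub> \<and>
     (\<exists>a. range a \<subseteq> carrier X \<and> (\<forall>i. f (a i) = m i) \<and>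
        (\<forall>(s, t)\<in>E. ev X a s = c (s, t) \<odot>\<^bsub>X\<^esub> z \<oplus>\<^bsub>X\<^esub> ev X a t))})"

lemma zero_not_obstructed:
  assumes X: "(X, f, M) \<in> \<I>" and l: "l \<in> labels"
  shows "\<zero>\<^bsub>X\<^esub> \<notin> obstructed X f l"
proof
  assume z: "\<zero>\<^bsub>X\<^esub> \<in> obstructed X f l"
  interpret X: left_module R X by (rule over_module[OF X])
  obtain E m c where lE: "l = (E, m, c)" by (cases l)
  with l have E: "E \<subseteq> terms R UNIV \<times> terms R UNIV" and n: "\<not> realizable E m"
    and c: "c \<in> terms R UNIV \<times> terms R UNIV \<rightarrow>\<^sub>E carrier R" by (auto simp: labels_def)
  obtain a where a: "range a \<subseteq> carrier X" "\<forall>i. f (a i) = m i"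
    "\<forall>(s, t)\<in>E. ev X a s = c (s, t) \<odot>\<^bsub>X\<^esub> \<zero>\<^bsub>X\<^esub> \<oplus>\<^bsub>X\<^esub> ev X a t"
    using z unfolding obstructed_def lE by auto
  have "solves X a E"
    unfolding solves_def
  proof safe
    fix s t assume st: "(s, t) \<in> E"
    then have T: "s \<in> terms R UNIV" "t \<in> terms R UNIV" using E by blast+
    then have "c (s, t) \<in> carrier R" using c by blast
    moreover have "ev X a t \<in> carrier X" by (rule ev_closed[OF over_module[OF X] T(2) a(1)])
    ultimately show "ev X a s = ev X a t"
      using a(3) st left_module_smult_zero[OF over_module[OF X]] by auto
  qed
  then have "realizable E m" unfolding realizable_def using X a(1,2) by blast
  with n show False by blast
qed

text \<open>
  If \<open>a\<^sub>1\<close>, \<open>a\<^sub>2\<close>, \<open>a\<^sub>3\<close> are solutions for \<open>x\<close>, \<open>y\<close>, \<open>z\<close>, then \<open>a\<^sub>1 - a\<^sub>2 + a\<^sub>3\<close> is one for \<open>x - y + z\<close>, and its image in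
  \<open>M\<close> is \<open>m - m + m = m\<close>.
\<close>

lemma obstructed_affine:
  assumes X: "(X, f, M) \<in> \<I>" and l: "l \<in> labels"
    and x: "x \<in> obstructed X f l" and y: "y \<in> obstructed X f l" and z: "z \<in> obstructed X f l"
  shows "x \<ominus>\<^bsub>X\<^esub> y \<oplus>\<^bsub>X\<^esub> z \<in> obstructed X f l"
proof -
  note XM = over_module[OF X]
  interpret X: left_module R X by (rule XM)
  interpret M: left_module R M by (rule M_module)
  obtain E m c where lE: "l = (E, m, c)" by (cases l)
  with l have E: "E \<subseteq> terms R UNIV \<times> terms R UNIV" and m: "\<And>i. m i \<in> carrier M"
    and c: "c \<in> terms R UNIV \<times> terms R UNIV \<rightarrow>\<^sub>E carrier R" by (auto simp: labels_def)
  have ex: "\<exists>a. range a \<subseteq> carrier X \<and> (\<forall>i. f (a i) = m i) \<and>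
      (\<forall>(s, t)\<in>E. ev X a s = c (s, t) \<odot>\<^bsub>X\<^esub> w \<oplus>\<^bsub>X\<^esub> ev X a t)" "w \<in> carrier X" "f w = \<zero>\<^bsub>M\<^esub>"
    if "w \<in> obstructed X f l" for w
    using that unfolding obstructed_def lE by auto
  note xyz = ex(2,3)[OF x] ex(2,3)[OF y] ex(2,3)[OF z]
  obtain a1 where a1: "range a1 \<subseteq> carrier X" "\<And>i. f (a1 i) = m i"
    "\<And>s t. (s, t) \<in> E \<Longrightarrow> ev X a1 s = c (s, t) \<odot>\<^bsub>X\<^esub> x \<oplus>\<^bsub>X\<^esub> ev X a1 t" using ex(1)[OF x] by blast
  obtain a2 where a2: "range a2 \<subseteq> carrier X" "\<And>i. f (a2 i) = m i"
    "\<And>s t. (s, t) \<in> E \<Longrightarrow> ev X a2 s = c (s, t) \<odot>\<^bsub>X\<^esub> y \<oplus>\<^bsub>X\<^esub> ev X a2 t" using ex(1)[OF y] by blast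
  obtain a3 where a3: "range a3 \<subseteq> carrier X" "\<And>i. f (a3 i) = m i"
    "\<And>s t. (s, t) \<in> E \<Longrightarrow> ev X a3 s = c (s, t) \<odot>\<^bsub>X\<^esub> z \<oplus>\<^bsub>X\<^esub> ev X a3 t" using ex(1)[OF z] by blast
  let ?a = "\<lambda>i. a1 i \<ominus>\<^bsub>X\<^esub> a2 i \<oplus>\<^bsub>X\<^esub> a3 i" and ?w = "x \<ominus>\<^bsub>X\<^esub> y \<oplus>\<^bsub>X\<^esub> z"
  have cl: "a1 i \<in> carrier X" "a2 i \<in> carrier X" "a3 i \<in> carrier X" for i using a1(1) a2(1) a3(1) by auto
  note fh = over_hom[OF X]
  have fd: "f (u \<ominus>\<^bsub>X\<^esub> v \<oplus>\<^bsub>X\<^esub> w) = f u \<ominus>\<^bsub>M\<^esub> f v \<oplus>\<^bsub>M\<^esub> f w"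
    if "u \<in> carrier X" "v \<in> carrier X" "w \<in> carrier X" for u v w
    using that Mod_hom_add[OF fh, of "u \<ominus>\<^bsub>X\<^esub> v" w] Mod_hom_diff[OF XM M_module fh, of u v] by simp
  have "ev X ?a s = c (s, t) \<odot>\<^bsub>X\<^esub> ?w \<oplus>\<^bsub>X\<^esub> ev X ?a t" if st: "(s, t) \<in> E" for s t
  proof -
    have T: "s \<in> terms R UNIV" "t \<in> terms R UNIV" using st E by blast+
    then have cst: "c (s, t) \<in> carrier R" using c by blast
    have e: "ev X a1 t \<in> carrier X" "ev X a2 t \<in> carrier X" "ev X a3 t \<in> carrier X"
      using ev_closed[OF XM T(2)] a1(1) a2(1) a3(1) by blast+
    show ?thesis
      using e cst xyz by (simp add: ev_affine[OF XM T(1) a1(1) a2(1) a3(1)]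
        ev_affine[OF XM T(2) a1(1) a2(1) a3(1)] a1(3)[OF st] a2(3)[OF st] a3(3)[OF st]
        smult_affine[OF XM] X.smult_closed affine_add[OF X.M.abelian_group_axioms, symmetric])
  qed
  moreover have "f (?a i) = m i" for i
    using cl m[of i] by (simp add: fd a1(2) a2(2) a3(2) M.M.minus_eq M.M.r_neg)
  moreover have "f ?w = \<zero>\<^bsub>M\<^esub>" using xyz by (simp add: fd M.M.minus_eq)
  ultimately show ?thesis
    unfolding obstructed_def lE using cl xyz
    by (auto intro!: exI[of _ ?a])
qed

text \<open>
  The quotient \<open>X/Rz \<rightarrow> M\<close> is not an object over \<open>M\<close>, because the projection from \<open>X\<close> is not injective. The
  label is a failure of the local criterion for this quotient, lifted to \<open>X\<close>.
\<close>

lemma rigid_kernel_obstructed: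
  assumes rigid: "rigid X f" and z: "z \<in> carrier X" "f z = \<zero>\<^bsub>M\<^esub>" "z \<noteq> \<zero>\<^bsub>X\<^esub>"
  shows "\<exists>l\<in>labels. z \<in> obstructed X f l"
proof -
  have X: "(X, f, M) \<in> \<I>" using rigid by (simp add: rigid_def)
  note XM = over_module[OF X] and fh = over_hom[OF X]
  interpret X: left_module R X by (rule XM)
  interpret M: left_module R M by (rule M_module)
  define \<theta> where "\<theta> = {(x, y). x \<in> carrier X \<and> y \<in> carrier X \<and> (\<exists>c\<in>carrier R. x = c \<odot>\<^bsub>X\<^esub> z \<oplus>\<^bsub>X\<^esub> y)}"
  have \<theta>I: "(x, y) \<in> \<theta>" if "y \<in> carrier X" "c \<in> carrier R" "x = c \<odot>\<^bsub>X\<^esub> z \<oplus>\<^bsub>X\<^esub> y" for x y c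
    using that z X.smult_closed unfolding \<theta>_def by auto
  have \<theta>D: "\<exists>c\<in>carrier R. x = c \<odot>\<^bsub>X\<^esub> z \<oplus>\<^bsub>X\<^esub> y" "x \<in> carrier X" "y \<in> carrier X" if "(x, y) \<in> \<theta>" for x y
    using that unfolding \<theta>_def by auto
  \<comment> \<open>the congruence modulo the submodule \<open>Rz\<close>\<close>
  have "congruence R X \<theta>"
    unfolding congruence_def equiv_def
  proof (intro conjI)
    show "\<theta> \<subseteq> carrier X \<times> carrier X" unfolding \<theta>_def by blast
    show "refl_on (carrier X) \<theta>" unfolding refl_on_def
      using \<theta>I[OF _ X.R.zero_closed] left_module_zero_smult[OF XM z(1)] by simp
    show "sym \<theta>"
    proof (rule symI)
      fix x y assume xy: "(x, y) \<in> \<theta>"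
      then obtain c where c: "c \<in> carrier R" "x = c \<odot>\<^bsub>X\<^esub> z \<oplus>\<^bsub>X\<^esub> y" using \<theta>D by blast
      have "y = (\<ominus>\<^bsub>R\<^esub> c) \<odot>\<^bsub>X\<^esub> z \<oplus>\<^bsub>X\<^esub> x"
        using \<theta>D(2,3)[OF xy] c z X.smult_l_distr[of "\<ominus>\<^bsub>R\<^esub> c" c z] left_module_zero_smult[OF XM z(1)]
        by (simp add: X.smult_closed X.M.a_assoc[symmetric] X.R.l_neg)
      then show "(y, x) \<in> \<theta>" using \<theta>I \<theta>D(2)[OF xy] c by (metis X.R.a_inv_closed)
    qed
    show "trans \<theta>"
    proof (rule transI)
      fix x y w assume xy: "(x, y) \<in> \<theta>" and yw: "(y, w) \<in> \<theta>"
      obtain c where c: "c \<in> carrier R" "x = c \<odot>\<^bsub>X\<^esub> z \<oplus>\<^bsub>X\<^esub> y" using \<theta>D xy by blast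
      obtain d where d: "d \<in> carrier R" "y = d \<odot>\<^bsub>X\<^esub> z \<oplus>\<^bsub>X\<^esub> w" using \<theta>D yw by blast
      have "x = (c \<oplus>\<^bsub>R\<^esub> d) \<odot>\<^bsub>X\<^esub> z \<oplus>\<^bsub>X\<^esub> w"
        using c d z \<theta>D[OF yw] by (simp add: X.smult_closed X.M.a_assoc X.smult_l_distr)
      then show "(x, w) \<in> \<theta>" using \<theta>I \<theta>D(3)[OF yw] c d by (metis X.R.a_closed)
    qed
    have "(x \<oplus>\<^bsub>X\<^esub> y, x' \<oplus>\<^bsub>X\<^esub> y') \<in> \<theta>" if xx: "(x, x') \<in> \<theta>" and yy: "(y, y') \<in> \<theta>" for x x' y y'
    proof -
      obtain c where c: "c \<in> carrier R" "x = c \<odot>\<^bsub>X\<^esub> z \<oplus>\<^bsub>X\<^esub> x'" using \<theta>D xx by blast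
      obtain d where d: "d \<in> carrier R" "y = d \<odot>\<^bsub>X\<^esub> z \<oplus>\<^bsub>X\<^esub> y'" using \<theta>D yy by blast
      have "x \<oplus>\<^bsub>X\<^esub> y = (c \<oplus>\<^bsub>R\<^esub> d) \<odot>\<^bsub>X\<^esub> z \<oplus>\<^bsub>X\<^esub> (x' \<oplus>\<^bsub>X\<^esub> y')"
        using c d z \<theta>D[OF xx] \<theta>D[OF yy] by (simp add: X.smult_closed X.M.a_ac X.smult_l_distr)
      then show ?thesis using \<theta>I[of "x' \<oplus>\<^bsub>X\<^esub> y'" "c \<oplus>\<^bsub>R\<^esub> d"] \<theta>D(3)[OF xx] \<theta>D(3)[OF yy] c d by simp
    qed
    then show "\<forall>(x, x')\<in>\<theta>. \<forall>(y, y')\<in>\<theta>. (x \<oplus>\<^bsub>X\<^esub> y, x' \<oplus>\<^bsub>X\<^esub> y') \<in> \<theta>" by blast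
    have "(a \<odot>\<^bsub>X\<^esub> x, a \<odot>\<^bsub>X\<^esub> x') \<in> \<theta>" if xx: "(x, x') \<in> \<theta>" and a: "a \<in> carrier R" for a x x'
    proof -
      obtain c where c: "c \<in> carrier R" "x = c \<odot>\<^bsub>X\<^esub> z \<oplus>\<^bsub>X\<^esub> x'" using \<theta>D xx by blast
      have "a \<odot>\<^bsub>X\<^esub> x = (a \<otimes>\<^bsub>R\<^esub> c) \<odot>\<^bsub>X\<^esub> z \<oplus>\<^bsub>X\<^esub> a \<odot>\<^bsub>X\<^esub> x'"
        using c a z \<theta>D[OF xx] by (simp add: X.smult_closed X.smult_assoc X.smult_r_distr)
      then show ?thesis using \<theta>I[of "a \<odot>\<^bsub>X\<^esub> x'" "a \<otimes>\<^bsub>R\<^esub> c"] \<theta>D(3)[OF xx] c a by (simp add: X.smult_closed)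
    qed
    then show "\<forall>a\<in>carrier R. \<forall>(x, x')\<in>\<theta>. (a \<odot>\<^bsub>X\<^esub> x, a \<odot>\<^bsub>X\<^esub> x') \<in> \<theta>" by blast
  qed
  moreover have "\<theta> \<subseteq> kern X f"
  proof (rule subrelI)
    fix x y assume xy: "(x, y) \<in> \<theta>"
    then obtain c where c: "c \<in> carrier R" "x = c \<odot>\<^bsub>X\<^esub> z \<oplus>\<^bsub>X\<^esub> y" using \<theta>D by blast
    then have "f x = f y"
      using \<theta>D(3)[OF xy] z(1,2) left_module_smult_zero[OF M_module c(1)] Mod_hom_closed[OF fh, of y]
      by (simp add: Mod_hom_add[OF fh] Mod_hom_smult[OF fh] X.smult_closed)
    then show "(x, y) \<in> kern X f" using \<theta>D[OF xy] by (simp add: kern_def)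
  qed
  ultimately obtain Q g q where Q: "Mod_obj R Q" and g: "g \<in> Mod_hom R Q M"
    and q: "over_map X f Q g q" "q ` carrier X = carrier Q" "kern X q = \<theta>"
    by (rule quotient_over[OF over_obj[OF X] fh]) (rule that)
  have qh: "q \<in> Mod_hom R X Q" and gq: "\<And>x. x \<in> carrier X \<Longrightarrow> g (q x) = f x"
    using q(1) unfolding over_map_def by blast+
  have "(Q, g, M) \<notin> \<I>"
  proof
    assume "(Q, g, M) \<in> \<I>"
    then have "inj_on q (carrier X)" using rigid q(1) unfolding rigid_def by blast
    moreover have "(z, \<zero>\<^bsub>X\<^esub>) \<in> kern X q"
      unfolding q(3) using \<theta>I[of "\<zero>\<^bsub>X\<^esub>" "\<one>\<^bsub>R\<^esub>" z] z by (simp add: X.smult_one)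
    ultimately show False using z(3) unfolding kern_def by (auto dest: inj_onD)
  qed
  then obtain E x where E: "E \<subseteq> terms R UNIV \<times> terms R UNIV"
    and x: "range (x :: nat \<Rightarrow> 'u) \<subseteq> carrier Q" "solves Q x E" and n: "\<not> realizable E (g \<circ> x)"
    using over_if_locally_over[OF Q g] by blast
  have QM: "left_module R Q" using Q by (simp add: Mod_obj_def)
  obtain a where a: "range a \<subseteq> carrier X" "x = q \<circ> a"
    and st: "\<And>s t. (s, t) \<in> E \<Longrightarrow> (ev X a s, ev X a t) \<in> kern X q"
    by (rule lift_solution[OF XM QM qh q(2) E x]) (rule that)
  have "\<forall>p\<in>terms R UNIV \<times> terms R UNIV. \<exists>c\<in>carrier R. p \<in> E \<longrightarrow>
      ev X a (fst p) = c \<odot>\<^bsub>X\<^esub> z \<oplus>\<^bsub>X\<^esub> ev X a (snd p)"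
    using st \<theta>D(1) X.R.zero_closed unfolding q(3) by fastforce
  then obtain c where c: "\<forall>p\<in>terms R UNIV \<times> terms R UNIV. c p \<in> carrier R \<and> (p \<in> E \<longrightarrow>
      ev X a (fst p) = c p \<odot>\<^bsub>X\<^esub> z \<oplus>\<^bsub>X\<^esub> ev X a (snd p))"
    by metis
  let ?c = "restrict c (terms R UNIV \<times> terms R UNIV)"
  have fa: "f (a i) = (g \<circ> x) i" for i using gq a by (simp add: image_subset_iff)
  have "(E, g \<circ> x, ?c) \<in> labels"
    using E n c x(1) Mod_hom_closed[OF g] unfolding labels_def
    by (auto simp: image_subset_iff simp del: in_lists_conv_set)
  moreover have "z \<in> obstructed X f (E, g \<circ> x, ?c)"
    unfolding obstructed_def prod.case
  proof (intro CollectI conjI z exI[of _ a] a allI fa ballI)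
    fix p assume p: "p \<in> E"
    then have "p \<in> terms R UNIV \<times> terms R UNIV" using E by blast
    then show "case p of (s, t) \<Rightarrow> ev X a s = ?c (s, t) \<odot>\<^bsub>X\<^esub> z \<oplus>\<^bsub>X\<^esub> ev X a t"
      using c p by (cases p) (simp del: in_lists_conv_set)
  qed
  ultimately show ?thesis by blast
qed

text \<open>
  Distinct \<open>x\<close>, \<open>y\<close> with \<open>f x = f y\<close> differ by an element that is obstructed for some label, hence have
  different colours for that label.
\<close>

lemma rigid_bounded:
  assumes "rigid X f"
  shows "\<exists>j. inj_on j (carrier X) \<and> j ` carrier X \<subseteq> rigid_bound"
proof -
  have X: "(X, f, M) \<in> \<I>" using assms by (simp add: rigid_def)
  interpret X: left_module R X by (rule over_module[OF X])
  interpret M: left_module R M by (rule M_module)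
  have "\<forall>l\<in>labels. \<exists>\<chi> :: 'u \<Rightarrow> nat. (\<forall>x. \<chi> x < 3) \<and>
     (\<forall>x\<in>carrier X. \<forall>y\<in>carrier X. x \<ominus>\<^bsub>X\<^esub> y \<in> obstructed X f l \<longrightarrow> \<chi> x \<noteq> \<chi> y)"
  proof
    fix l assume l: "l \<in> labels"
    have sub: "obstructed X f l \<subseteq> carrier X" unfolding obstructed_def by (cases l) auto
    show "\<exists>\<chi> :: 'u \<Rightarrow> nat. (\<forall>x. \<chi> x < 3) \<and>
       (\<forall>x\<in>carrier X. \<forall>y\<in>carrier X. x \<ominus>\<^bsub>X\<^esub> y \<in> obstructed X f l \<longrightarrow> \<chi> x \<noteq> \<chi> y)"
      by (rule affine_colouring[OF X.M.abelian_group_axioms sub zero_not_obstructed[OF X l]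
            obstructed_affine[OF X l]]) blast+
  qed
  then obtain \<chi> :: "_ \<Rightarrow> 'u \<Rightarrow> nat" where \<chi>: "\<forall>l\<in>labels. (\<forall>x. \<chi> l x < 3) \<and>
     (\<forall>x\<in>carrier X. \<forall>y\<in>carrier X. x \<ominus>\<^bsub>X\<^esub> y \<in> obstructed X f l \<longrightarrow> \<chi> l x \<noteq> \<chi> l y)"
    by (rule bchoice[THEN exE]) (rule that)
  let ?j = "\<lambda>x. (f x, \<lambda>l\<in>labels. \<chi> l x)"
  have "inj_on ?j (carrier X)"
  proof (rule inj_onI, rule ccontr)
    fix x y assume xy: "x \<in> carrier X" "y \<in> carrier X" and eq: "?j x = ?j y" and ne: "x \<noteq> y"
    have "f (x \<ominus>\<^bsub>X\<^esub> y) = \<zero>\<^bsub>M\<^esub>"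
      using eq xy Mod_hom_diff[OF over_module[OF X] M_module over_hom[OF X]] Mod_hom_closed[OF over_hom[OF X]]
      by (simp add: M.M.minus_eq M.M.r_neg)
    moreover have "x \<ominus>\<^bsub>X\<^esub> y \<noteq> \<zero>\<^bsub>X\<^esub>" using xy ne
      by (metis X.M.minus_eq X.M.minus_equality X.M.minus_minus X.M.a_inv_closed)
    ultimately obtain l where l: "l \<in> labels" "x \<ominus>\<^bsub>X\<^esub> y \<in> obstructed X f l"
      using rigid_kernel_obstructed[OF assms, of "x \<ominus>\<^bsub>X\<^esub> y"] xy by auto
    then have "\<chi> l x \<noteq> \<chi> l y" using \<chi> xy by blast
    moreover have "(\<lambda>l\<in>labels. \<chi> l x) l = (\<lambda>l\<in>labels. \<chi> l y) l" using eq by (metis prod.inject)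
    ultimately show False using l(1) by simp
  qed
  moreover have "?j ` carrier X \<subseteq> rigid_bound"
    using \<chi> Mod_hom_closed[OF over_hom[OF X]] unfolding rigid_bound_def by auto
  ultimately show ?thesis by blast
qed

end

section \<open>Maximal rigid objects\<close>

context limit_closed_ideal
begin

text \<open>The inclusion of carriers is a map over \<open>M\<close>.\<close>

definition extended_by :: "('r, 'u) module \<times> ('u \<Rightarrow> 'u) \<Rightarrow> ('r, 'u) module \<times> ('u \<Rightarrow> 'u) \<Rightarrow> bool" where
  "extended_by p p' \<longleftrightarrow> over_map (fst p) (snd p) (fst p') (snd p') (Mod_id (fst p))"

lemma
  assumes "extended_by p p'"
  shows extended_by_carrier: "carrier (fst p) \<subseteq> carrier (fst p')"
    and extended_by_hom: "Mod_id (fst p) \<in> Mod_hom R (fst p) (fst p')"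
    and extended_by_add: "op_closed R (fst p) \<Longrightarrow> x \<in> carrier (fst p) \<Longrightarrow> y \<in> carrier (fst p) \<Longrightarrow>
      x \<oplus>\<^bsub>fst p\<^esub> y = x \<oplus>\<^bsub>fst p'\<^esub> y"
    and extended_by_smult: "op_closed R (fst p) \<Longrightarrow> a \<in> carrier R \<Longrightarrow> x \<in> carrier (fst p) \<Longrightarrow>
      a \<odot>\<^bsub>fst p\<^esub> x = a \<odot>\<^bsub>fst p'\<^esub> x"
    and extended_by_map: "x \<in> carrier (fst p) \<Longrightarrow> snd p' x = snd p x"
proof -
  show h: "Mod_id (fst p) \<in> Mod_hom R (fst p) (fst p')"
    using assms by (simp add: extended_by_def over_map_def)
  show "carrier (fst p) \<subseteq> carrier (fst p')"
    using Mod_hom_closed[OF h] by (auto simp: Mod_id_def)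
  show "x \<oplus>\<^bsub>fst p\<^esub> y = x \<oplus>\<^bsub>fst p'\<^esub> y"
    if "op_closed R (fst p)" "x \<in> carrier (fst p)" "y \<in> carrier (fst p)"
    using Mod_hom_add[OF h that(2,3)] that by (simp add: Mod_id_def op_closed_def)
  show "a \<odot>\<^bsub>fst p\<^esub> x = a \<odot>\<^bsub>fst p'\<^esub> x"
    if "op_closed R (fst p)" "a \<in> carrier R" "x \<in> carrier (fst p)"
    using Mod_hom_smult[OF h that(2,3)] that by (simp add: Mod_id_def op_closed_def)
  show "snd p' x = snd p x" if "x \<in> carrier (fst p)"
    using assms that by (simp add: extended_by_def over_map_def Mod_id_def)
qed

lemma extended_by_trans:
  assumes "Mod_obj R (fst p)" and "extended_by p p'" and "extended_by p' p''"
  shows "extended_by p p''"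
proof -
  have "compose (carrier (fst p)) (Mod_id (fst p')) (Mod_id (fst p)) = Mod_id (fst p)"
    using extended_by_carrier[OF assms(2)] by (auto simp: compose_def Mod_id_def fun_eq_iff)
  then show ?thesis
    using over_map_compose[OF assms(1) assms(2,3)[unfolded extended_by_def]] by (simp add: extended_by_def)
qed

text \<open>
  A finite system and a solution of it in the union already live in one member of the chain, so the
  union is over \<open>M\<close> by the local criterion; and two elements that a map identifies already lie in
  one rigid member.
\<close>

lemma rigid_chain_union:
  assumes ne: "C \<noteq> {}" and rig: "\<And>p. p \<in> C \<Longrightarrow> rigid (fst p) (snd p)"
    and ch: "\<And>p p'. p \<in> C \<Longrightarrow> p' \<in> C \<Longrightarrow> extended_by p p' \<or> extended_by p' p"
    and sm: "small TYPE('u) (\<Union>p\<in>C. carrier (fst p))"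
  obtains U where "rigid (fst U) (snd U)" "carrier (fst U) = (\<Union>p\<in>C. carrier (fst p))"
    "\<And>p. p \<in> C \<Longrightarrow> extended_by p U"
proof -
  let ?\<Omega> = "\<Union>p\<in>C. carrier (fst p)"
  have over: "(fst p, snd p, M) \<in> \<I>" if "p \<in> C" for p using rig[OF that] by (simp add: rigid_def)
  have LM: "left_module R (fst p)" if "p \<in> C" for p by (rule over_module[OF over[OF that]])
  note op = left_module_op_closed[OF LM]
  have fin: "\<exists>p\<in>C. F \<subseteq> carrier (fst p)" if "finite F" "F \<subseteq> ?\<Omega>" for F
  proof -
    have "subset.chain UNIV ((\<lambda>p. carrier (fst p)) ` C)"
      using ch extended_by_carrier unfolding subset_chain_def by blast
    from finite_subset_Union_chain[OF that(1) _ _ this] that(2) ne show ?thesis by auto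
  qed
  have add_eq: "x \<oplus>\<^bsub>fst p\<^esub> y = x \<oplus>\<^bsub>fst p'\<^esub> y"
    if "p \<in> C" "p' \<in> C" "x \<in> carrier (fst p)" "y \<in> carrier (fst p)" "x \<in> carrier (fst p')" "y \<in> carrier (fst p')" for p p' x y
    using ch[OF that(1,2)] extended_by_add[OF _ op] that by metis
  have smult_eq: "a \<odot>\<^bsub>fst p\<^esub> x = a \<odot>\<^bsub>fst p'\<^esub> x"
    if "p \<in> C" "p' \<in> C" "a \<in> carrier R" "x \<in> carrier (fst p)" "x \<in> carrier (fst p')" for p p' a x
    using ch[OF that(1,2)] extended_by_smult[OF _ op] that by metis
  have map_eq: "snd p x = snd p' x"
    if "p \<in> C" "p' \<in> C" "x \<in> carrier (fst p)" "x \<in> carrier (fst p')" for p p' x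
    using ch[OF that(1,2)] extended_by_map that by metis
  have zero_eq: "\<zero>\<^bsub>fst p\<^esub> = \<zero>\<^bsub>fst p'\<^esub>" if ext: "extended_by p p'" and p: "p \<in> C" "p' \<in> C" for p p'
    using Mod_hom_zero[OF LM[OF p(1)] LM[OF p(2)] extended_by_hom[OF ext]] op[OF p(1)]
    by (simp add: Mod_id_def op_closed_def)
  obtain p0 where p0: "p0 \<in> C" using ne by blast
  \<comment> \<open>The operations of the union are computed in some member that contains the arguments; by
    \<open>add_eq\<close>, \<open>smult_eq\<close> and \<open>map_eq\<close> the choice does not matter.\<close>
  define pick where "pick x y = (SOME p. p \<in> C \<and> x \<in> carrier (fst p) \<and> y \<in> carrier (fst p))" for x y
  have pick: "pick x y \<in> C" "x \<in> carrier (fst (pick x y))" "y \<in> carrier (fst (pick x y))"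
    if "p \<in> C" "x \<in> carrier (fst p)" "y \<in> carrier (fst p)" for p x y
    using someI[of "\<lambda>p. p \<in> C \<and> x \<in> carrier (fst p) \<and> y \<in> carrier (fst p)" p] that
    unfolding pick_def by simp_all
  define U :: "('r, 'u) module" where "U = \<lparr>carrier = ?\<Omega>, mult = undefined, one = undefined, zero = \<zero>\<^bsub>fst p0\<^esub>,
     add = (\<lambda>x y. x \<oplus>\<^bsub>fst (pick x y)\<^esub> y), smult = (\<lambda>a x. a \<odot>\<^bsub>fst (pick x x)\<^esub> x)\<rparr>"
  define f where "f = (\<lambda>x\<in>?\<Omega>. snd (pick x x) x)"
  have Uc: "carrier U = ?\<Omega>" by (simp add: U_def)
  have U0: "\<zero>\<^bsub>U\<^esub> = \<zero>\<^bsub>fst p\<^esub>" if "p \<in> C" for p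
  proof -
    have "\<zero>\<^bsub>fst p0\<^esub> = \<zero>\<^bsub>fst p\<^esub>"
      using ch[OF p0 that] zero_eq[of p0 p] zero_eq[of p p0] p0 that by metis
    then show ?thesis by (simp add: U_def)
  qed
  have Uadd: "x \<oplus>\<^bsub>U\<^esub> y = x \<oplus>\<^bsub>fst p\<^esub> y" if "p \<in> C" "x \<in> carrier (fst p)" "y \<in> carrier (fst p)" for p x y
    using add_eq[OF pick(1)[OF that] that(1) pick(2,3)[OF that] that(2,3)] by (simp add: U_def)
  have Usmult: "a \<odot>\<^bsub>U\<^esub> x = a \<odot>\<^bsub>fst p\<^esub> x" if "p \<in> C" "x \<in> carrier (fst p)" "a \<in> carrier R" for p x a
    using smult_eq[OF pick(1)[OF that(1,2,2)] that(1,3) pick(2)[OF that(1,2,2)] that(2)] by (simp add: U_def)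
  have fp: "f x = snd p x" if "p \<in> C" "x \<in> carrier (fst p)" for p x
    using map_eq[OF pick(1)[OF that(1,2,2)] that(1) pick(2)[OF that(1,2,2)] that(2)] that by (auto simp: f_def)
  have common: "\<exists>p\<in>C. x \<in> carrier (fst p) \<and> y \<in> carrier (fst p) \<and> z \<in> carrier (fst p)"
    if "x \<in> carrier U" "y \<in> carrier U" "z \<in> carrier U" for x y z
    using fin[of "{x, y, z}"] that Uc by auto
  have "abelian_group U"
  proof (rule abelian_groupI)
    fix x y z assume xyz: "x \<in> carrier U" "y \<in> carrier U" "z \<in> carrier U"
    obtain p where p: "p \<in> C" "x \<in> carrier (fst p)" "y \<in> carrier (fst p)" "z \<in> carrier (fst p)"
      using common[OF xyz] by blast
    interpret P: left_module R "fst p" by (rule LM[OF p(1)])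
    show "x \<oplus>\<^bsub>U\<^esub> y \<oplus>\<^bsub>U\<^esub> z = x \<oplus>\<^bsub>U\<^esub> (y \<oplus>\<^bsub>U\<^esub> z)"
      using p by (simp add: Uadd[OF p(1)] P.M.a_assoc)
  next
    fix x y assume xy: "x \<in> carrier U" "y \<in> carrier U"
    obtain p where p: "p \<in> C" "x \<in> carrier (fst p)" "y \<in> carrier (fst p)"
      using common[OF xy xy(1)] by blast
    interpret P: left_module R "fst p" by (rule LM[OF p(1)])
    show "x \<oplus>\<^bsub>U\<^esub> y \<in> carrier U" using p P.M.a_closed by (auto simp: Uadd[OF p(1)] Uc)
    show "x \<oplus>\<^bsub>U\<^esub> y = y \<oplus>\<^bsub>U\<^esub> x" using p by (simp add: Uadd[OF p(1)] P.M.a_comm)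
  next
    fix x assume "x \<in> carrier U"
    then obtain p where p: "p \<in> C" "x \<in> carrier (fst p)" using Uc by blast
    interpret P: left_module R "fst p" by (rule LM[OF p(1)])
    show "\<zero>\<^bsub>U\<^esub> \<oplus>\<^bsub>U\<^esub> x = x" using p by (simp add: U0[OF p(1)] Uadd[OF p(1)])
    show "\<exists>y\<in>carrier U. y \<oplus>\<^bsub>U\<^esub> x = \<zero>\<^bsub>U\<^esub>"
    proof (rule bexI)
      show "(\<ominus>\<^bsub>fst p\<^esub> x) \<oplus>\<^bsub>U\<^esub> x = \<zero>\<^bsub>U\<^esub>" using p by (simp add: U0[OF p(1)] Uadd[OF p(1)] P.M.l_neg)
      show "\<ominus>\<^bsub>fst p\<^esub> x \<in> carrier U" using p P.M.a_inv_closed unfolding Uc by blast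
    qed
  next
    interpret P: left_module R "fst p0" by (rule LM[OF p0])
    show "\<zero>\<^bsub>U\<^esub> \<in> carrier U" unfolding U0[OF p0] Uc using p0 P.M.zero_closed by blast
  qed
  moreover have "left_module_axioms R U"
  proof
    fix a b x assume a: "a \<in> carrier R" and b: "b \<in> carrier R" and "x \<in> carrier U"
    then obtain p where p: "p \<in> C" "x \<in> carrier (fst p)" using Uc by blast
    interpret P: left_module R "fst p" by (rule LM[OF p(1)])
    show "(a \<oplus>\<^bsub>R\<^esub> b) \<odot>\<^bsub>U\<^esub> x = a \<odot>\<^bsub>U\<^esub> x \<oplus>\<^bsub>U\<^esub> b \<odot>\<^bsub>U\<^esub> x"
      using p a b by (simp add: Uadd[OF p(1)] Usmult[OF p(1)] P.smult_closed P.smult_l_distr)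
    show "(a \<otimes>\<^bsub>R\<^esub> b) \<odot>\<^bsub>U\<^esub> x = a \<odot>\<^bsub>U\<^esub> (b \<odot>\<^bsub>U\<^esub> x)"
      using p a b by (simp add: Usmult[OF p(1)] P.smult_closed P.smult_assoc)
  next
    fix a x y assume a: "a \<in> carrier R" and xy: "x \<in> carrier U" "y \<in> carrier U"
    obtain p where p: "p \<in> C" "x \<in> carrier (fst p)" "y \<in> carrier (fst p)"
      using common[OF xy xy(1)] by blast
    interpret P: left_module R "fst p" by (rule LM[OF p(1)])
    show "a \<odot>\<^bsub>U\<^esub> (x \<oplus>\<^bsub>U\<^esub> y) = a \<odot>\<^bsub>U\<^esub> x \<oplus>\<^bsub>U\<^esub> a \<odot>\<^bsub>U\<^esub> y"
      using p a by (simp add: Uadd[OF p(1)] Usmult[OF p(1)] P.smult_closed P.smult_r_distr)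
  next
    fix a x assume a: "a \<in> carrier R" and "x \<in> carrier U"
    then obtain p where p: "p \<in> C" "x \<in> carrier (fst p)" using Uc by blast
    interpret P: left_module R "fst p" by (rule LM[OF p(1)])
    show "a \<odot>\<^bsub>U\<^esub> x \<in> carrier U" using p a P.smult_closed by (auto simp: Usmult[OF p(1)] Uc)
  next
    fix x assume "x \<in> carrier U"
    then obtain p where p: "p \<in> C" "x \<in> carrier (fst p)" using Uc by blast
    interpret P: left_module R "fst p" by (rule LM[OF p(1)])
    show "\<one>\<^bsub>R\<^esub> \<odot>\<^bsub>U\<^esub> x = x" using p by (simp add: Usmult[OF p(1)] P.smult_one)
  qed
  ultimately have UM: "left_module R U" using ring by (simp add: left_module_def)
  have U: "Mod_obj R U" using UM sm by (simp add: Mod_obj_def Uc)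
  have f: "f \<in> Mod_hom R U M"
  proof (rule Mod_homI)
    show "f \<in> carrier U \<rightarrow>\<^sub>E carrier M"
    proof (rule PiE_I)
      fix x assume "x \<in> carrier U"
      then obtain p where p: "p \<in> C" "x \<in> carrier (fst p)" using Uc by blast
      then show "f x \<in> carrier M" using fp[OF p] Mod_hom_closed[OF over_hom[OF over[OF p(1)]] p(2)] by simp
    qed (simp add: f_def Uc)
  next
    fix x y assume xy: "x \<in> carrier U" "y \<in> carrier U"
    obtain p where p: "p \<in> C" "x \<in> carrier (fst p)" "y \<in> carrier (fst p)"
      using common[OF xy xy(1)] by blast
    interpret P: left_module R "fst p" by (rule LM[OF p(1)])
    show "f (x \<oplus>\<^bsub>U\<^esub> y) = f x \<oplus>\<^bsub>M\<^esub> f y"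
      using p by (simp add: Uadd[OF p(1)] fp[OF p(1)] Mod_hom_add[OF over_hom[OF over[OF p(1)]]])
  next
    fix a x assume a: "a \<in> carrier R" and "x \<in> carrier U"
    then obtain p where p: "p \<in> C" "x \<in> carrier (fst p)" using Uc by blast
    interpret P: left_module R "fst p" by (rule LM[OF p(1)])
    show "f (a \<odot>\<^bsub>U\<^esub> x) = a \<odot>\<^bsub>M\<^esub> f x"
      using p a by (simp add: Usmult[OF p(1)] fp[OF p(1)] P.smult_closed Mod_hom_smult[OF over_hom[OF over[OF p(1)]]])
  qed
  have ext: "extended_by p (U, f)" if p: "p \<in> C" for p
  proof -
    interpret P: left_module R "fst p" by (rule LM[OF p])
    have "Mod_id (fst p) \<in> Mod_hom R (fst p) U"
    proof (rule Mod_homI)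
      show "Mod_id (fst p) \<in> carrier (fst p) \<rightarrow>\<^sub>E carrier U" using p by (auto simp: Mod_id_def Uc)
    qed (simp_all add: Mod_id_def Uadd[OF p] Usmult[OF p] P.smult_closed)
    then show ?thesis using fp[OF p] by (simp add: extended_by_def over_map_def Mod_id_def)
  qed
  have UI: "(U, f, M) \<in> \<I>"
  proof (rule over_if_locally_over[OF U f])
    fix E x assume E: "finite E" "E \<subseteq> terms R UNIV \<times> terms R UNIV"
      and x: "range (x :: nat \<Rightarrow> 'u) \<subseteq> carrier U" "solves U x E"
    have "finite (vars E)" using E(1) unfolding vars_def by auto
    then obtain p where p: "p \<in> C" "x ` vars E \<subseteq> carrier (fst p)"
      using fin[of "x ` vars E"] x(1) Uc by (metis finite_imageI image_mono subset_UNIV subset_trans)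
    interpret P: left_module R "fst p" by (rule LM[OF p(1)])
    \<comment> \<open>only the values on \<open>vars E\<close> are known to lie in \<open>p\<close>, the others are replaced by \<open>0\<close>\<close>
    define y where "y i = (if i \<in> vars E then x i else \<zero>\<^bsub>fst p\<^esub>)" for i
    have y: "range y \<subseteq> carrier (fst p)" using p(2) by (auto simp: y_def)
    have evy: "ev (fst p) y s = ev U x s" if s: "s \<in> terms R UNIV" "snd ` set s \<subseteq> vars E" for s
    proof -
      have "ev (fst p) y s = Mod_id (fst p) (ev (fst p) y s)"
        using ev_closed[OF LM[OF p(1)] s(1) y] by (simp add: Mod_id_def)
      also have "\<dots> = ev U (Mod_id (fst p) \<circ> y) s"
        by (rule ev_hom[OF LM[OF p(1)] UM _ s(1) y]) (use extended_by_hom[OF ext[OF p(1)]] in simp)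
      also have "\<dots> = ev U x s"
        by (rule ev_cong) (use s(2) p(2) in \<open>auto simp: y_def Mod_id_def\<close>)
      finally show ?thesis .
    qed
    show "realizable E (f \<circ> x)"
      unfolding realizable_def
    proof (intro exI conjI ballI)
      show "(fst p, snd p, M) \<in> \<I>" by (rule over[OF p(1)])
      show "range y \<subseteq> carrier (fst p)" by (rule y)
      show "solves (fst p) y E"
        unfolding solves_def
      proof safe
        fix s t assume st: "(s, t) \<in> E"
        then have "s \<in> terms R UNIV" "t \<in> terms R UNIV" using E(2) by blast+
        moreover have "snd ` set s \<subseteq> vars E" "snd ` set t \<subseteq> vars E" using st unfolding vars_def by blast+
        moreover have "ev U x s = ev U x t" using x(2) st unfolding solves_def by blast
        ultimately show "ev (fst p) y s = ev (fst p) y t" by (metis evy)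
      qed
      show "snd p (y i) = (f \<circ> x) i" if "i \<in> vars E" for i
        using that p(2) fp[OF p(1), of "x i"] by (auto simp: y_def)
    qed
  qed
  have "rigid U f"
    unfolding rigid_def
  proof (intro conjI allI impI UI inj_onI)
    fix Z g k u v assume Z: "(Z, g, M) \<in> \<I> \<and> over_map U f Z g k"
      and uv: "u \<in> carrier U" "v \<in> carrier U" "k u = k v"
    obtain p where p: "p \<in> C" "u \<in> carrier (fst p)" "v \<in> carrier (fst p)"
      using common[OF uv(1,2,1)] by blast
    let ?k = "compose (carrier (fst p)) k (Mod_id (fst p))"
    have "over_map (fst p) (snd p) Z g ?k"
      using over_map_compose[OF over_obj[OF over[OF p(1)]]] ext[OF p(1)] Z unfolding extended_by_def by simp
    then have "inj_on ?k (carrier (fst p))"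
      using rig[OF p(1)] Z unfolding rigid_def by blast
    moreover have "?k u = ?k v" using p uv(3) by (simp add: compose_def Mod_id_def)
    ultimately show "u = v" using p by (meson inj_onD)
  qed
  then show ?thesis using that[of "(U, f)"] ext Uc by simp
qed

lemma rigid_transport:
  assumes Z: "rigid Z h" and b: "inj_on b (carrier Z)"
  obtains V g where "rigid V g" "carrier V = b ` carrier Z" "over_map Z h V g (restrict b (carrier Z))"
proof -
  have ZI: "(Z, h, M) \<in> \<I>" using Z by (simp add: rigid_def)
  note ZM = over_module[OF ZI]
  interpret Z: left_module R Z by (rule ZM)
  let ?\<theta> = "Id_on (carrier Z)" and ?V = "image_module Z b"
  have opZ: "op_closed R Z" by (rule left_module_op_closed[OF ZM])
  have c: "congruence R Z ?\<theta>"
    using opZ unfolding congruence_def equiv_def op_closed_def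
    by (auto simp: refl_on_def sym_def trans_def)
  have l: "module_laws R Z ?\<theta>" by (rule left_module_laws[OF ZM]) (auto simp: refl_on_def)
  have be: "b x = b y \<longleftrightarrow> (x, y) \<in> ?\<theta>" if "x \<in> carrier Z" "y \<in> carrier Z" for x y
    using that b by (auto dest: inj_onD)
  have V: "left_module R ?V" "restrict b (carrier Z) \<in> Mod_hom R Z ?V"
    using left_module_image[where q = b, OF ring opZ c l] be by blast+
  let ?b = "restrict b (carrier Z)"
  have VC: "carrier ?V = b ` carrier Z" by (simp add: image_module_def)
  have Vobj: "Mod_obj R ?V"
    using V(1) small_image[of "TYPE('u)" "carrier Z" b] over_obj[OF ZI] by (simp add: Mod_obj_def VC)
  have bi: "inj_on ?b (carrier Z)" "?b ` carrier Z = carrier ?V"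
    using b by (auto simp: VC inj_on_def)
  obtain b' where b': "b' \<in> Mod_hom R ?V Z" "\<And>x. x \<in> carrier Z \<Longrightarrow> b' (?b x) = x"
    by (rule Mod_hom_inverse[OF ZM V(2) bi]) (rule that)
  let ?g = "compose (carrier ?V) h b'"
  have g: "?g \<in> Mod_hom R ?V M"
    by (rule Mod_hom_compose[OF b'(1) over_hom[OF ZI] left_module_op_closed[OF V(1)]])
  have VI: "(?V, ?g, M) \<in> \<I>"
    by (rule over_pullback[OF Vobj b'(1) ZI g]) (simp add: compose_def)
  have bo: "over_map Z h ?V ?g ?b"
    using V(2) b'(2) unfolding over_map_def by (auto simp: compose_def VC)
  have "rigid ?V ?g"
    unfolding rigid_def
  proof (intro conjI allI impI VI inj_onI)
    fix W w l u v assume W: "(W, w, M) \<in> \<I> \<and> over_map ?V ?g W w l"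
      and uv: "u \<in> carrier ?V" "v \<in> carrier ?V" "l u = l v"
    have "over_map Z h W w (compose (carrier Z) l ?b)"
      using over_map_compose[OF over_obj[OF ZI] bo] W by blast
    then have inj: "inj_on (compose (carrier Z) l ?b) (carrier Z)" using Z W unfolding rigid_def by blast
    obtain x y where "x \<in> carrier Z" "y \<in> carrier Z" "u = b x" "v = b y" using uv VC by auto
    then show "u = v" using inj_onD[OF inj, of x y] uv(3) by (simp add: compose_def)
  qed
  then show ?thesis by (rule that[OF _ VC bo])
qed

lemma rigid_exists: "\<exists>Q g. rigid Q g"
proof -
  have "subgroup {f. (M, f, M) \<in> \<I>} (Hom_group R M M)"
    using ideal M unfolding Mod_ideal_def by blast
  then have "\<one>\<^bsub>Hom_group R M M\<^esub> \<in> {f. (M, f, M) \<in> \<I>}" by (rule subgroup.one_closed)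
  then have "(M, \<one>\<^bsub>Hom_group R M M\<^esub>, M) \<in> \<I>" by simp
  then show ?thesis by (rule rigid_quotient) blast
qed

text \<open>
  A maximal chain of rigid objects inside a fixed small set \<open>\<Omega>\<close> has a union \<open>U\<close> that cannot be properly
  extended within \<open>\<Omega>\<close>. A map from \<open>U\<close> to a rigid \<open>Z\<close> is injective, and since \<open>\<Omega>\<close> is large compared with \<open>U\<close> and
  \<open>Z\<close>, there is an isomorphic copy of \<open>Z\<close> in \<open>\<Omega>\<close> that extends \<open>U\<close>. So the map is surjective.
\<close>

lemma maximal_rigid:
  obtains U f where "rigid U f" "\<And>Z g k. rigid Z g \<Longrightarrow> over_map U f Z g k \<Longrightarrow> k ` carrier U = carrier Z"
proof -
  have "small TYPE('u) (rigid_bound \<times> Pow rigid_bound)"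
    by (intro small_Times small_Pow universe small_rigid_bound)
  then obtain e :: "_ \<Rightarrow> 'u" where e: "inj_on e (rigid_bound \<times> Pow rigid_bound)"
    using small_embedding by blast
  \<comment> \<open>Over each \<open>b\<close> in the bound, \<open>\<Omega>\<close> has as many elements as the bound has subsets. By Cantor's
    theorem a rigid object cannot exhaust any of these fibres, so another one fits beside it.\<close>
  define \<Omega> where "\<Omega> = e ` (rigid_bound \<times> Pow rigid_bound)"
  have sm\<Omega>: "small TYPE('u) \<Omega>"
    unfolding \<Omega>_def by (rule small_image) fact
  have room: "\<exists>j. inj_on j (carrier Z) \<and> j ` carrier Z \<subseteq> \<Omega> - carrier Y"
    if Z: "rigid Z h" and Y: "rigid Y f" for Z h Y f
  proof -
    obtain jZ where jZ: "inj_on jZ (carrier Z)" "jZ ` carrier Z \<subseteq> rigid_bound" using rigid_bounded[OF Z] by blast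
    obtain jY where jY: "inj_on jY (carrier Y)" "jY ` carrier Y \<subseteq> rigid_bound" using rigid_bounded[OF Y] by blast
    have "\<exists>S. S \<subseteq> rigid_bound \<and> e (b, S) \<notin> carrier Y" if b: "b \<in> rigid_bound" for b
    proof (rule ccontr)
      assume n: "\<not> ?thesis"
      have "|Pow rigid_bound| \<le>o |rigid_bound|"
      proof (rule card_of_ordLeqI)
        show "inj_on (\<lambda>S. jY (e (b, S))) (Pow rigid_bound)"
        proof (rule inj_onI)
          fix S S' assume S: "S \<in> Pow rigid_bound" "S' \<in> Pow rigid_bound" "jY (e (b, S)) = jY (e (b, S'))"
          then have "e (b, S) = e (b, S')" using n by (intro inj_onD[OF jY(1)]) auto
          then show "S = S'" using inj_onD[OF e, of "(b, S)" "(b, S')"] S b by auto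
        qed
        show "jY (e (b, S)) \<in> rigid_bound" if "S \<in> Pow rigid_bound" for S using n that jY(2) by blast
      qed
      then show False using card_of_Pow[of rigid_bound] not_ordLess_ordLeq by blast
    qed
    then obtain S where S: "\<And>b. b \<in> rigid_bound \<Longrightarrow> S b \<subseteq> rigid_bound \<and> e (b, S b) \<notin> carrier Y" by metis
    let ?j = "\<lambda>z. e (jZ z, S (jZ z))"
    have jr: "jZ z \<in> rigid_bound" if "z \<in> carrier Z" for z using jZ(2) that by blast
    have "inj_on ?j (carrier Z)"
    proof (rule inj_onI)
      fix y z assume yz: "y \<in> carrier Z" "z \<in> carrier Z" "?j y = ?j z"
      then have "(jZ y, S (jZ y)) = (jZ z, S (jZ z))"
        using S jr by (intro inj_onD[OF e]) auto
      then show "y = z" using inj_onD[OF jZ(1)] yz by simp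
    qed
    moreover have "?j ` carrier Z \<subseteq> \<Omega> - carrier Y" using S jr unfolding \<Omega>_def by blast
    ultimately show ?thesis by blast
  qed
  define \<P> where "\<P> = {p. rigid (fst p) (snd p) \<and> carrier (fst p) \<subseteq> \<Omega>}"
  have obj: "Mod_obj R (fst p)" if "p \<in> \<P>" for p
    using that over_obj unfolding \<P>_def rigid_def by blast
  have refl: "extended_by p p" if "p \<in> \<P>" for p
  proof -
    have "op_closed R (fst p)" using obj[OF that] left_module_op_closed unfolding Mod_obj_def by blast
    from Mod_hom_id[OF this] show ?thesis by (simp add: extended_by_def over_map_def Mod_id_def)
  qed
  obtain C where C: "pred_on.maxchain \<P> extended_by C"
    using pred_on.Hausdorff[of \<P> extended_by] by (rule exE)
  have Cch: "pred_on.chain \<P> extended_by C" using C by (simp add: pred_on.maxchain_def)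
  then have sub: "C \<subseteq> \<P>" by (simp add: pred_on.chain_def)
  have ch: "extended_by p p' \<or> extended_by p' p" if "p \<in> C" "p' \<in> C" for p p'
  proof -
    have "p = p' \<or> extended_by p p' \<or> extended_by p' p"
      using Cch that unfolding pred_on.chain_def by blast
    then show ?thesis using refl sub that(1) by blast
  qed
  have chI: "pred_on.chain \<P> extended_by D"
    if "D \<subseteq> \<P>" "\<And>p p'. p \<in> D \<Longrightarrow> p' \<in> D \<Longrightarrow> extended_by p p' \<or> extended_by p' p" for D
    unfolding pred_on.chain_def using that by blast
  have max: "p \<in> C" if p: "p \<in> \<P>" and up: "\<And>c. c \<in> C \<Longrightarrow> extended_by c p" for p
  proof (rule ccontr)
    assume "p \<notin> C"
    then have "C \<subset> insert p C" by blast
    moreover have "pred_on.chain \<P> extended_by (insert p C)"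
    proof (rule chI)
      show "insert p C \<subseteq> \<P>" using p sub by blast
      show "extended_by c c' \<or> extended_by c' c" if "c \<in> insert p C" "c' \<in> insert p C" for c c'
        using that ch up refl[OF p] by blast
    qed
    ultimately show False using C unfolding pred_on.maxchain_def by blast
  qed
  have ne: "C \<noteq> {}"
  proof
    assume "C = {}"
    moreover obtain Q g where Q: "rigid Q g" using rigid_exists by blast
    obtain j where j: "inj_on j (carrier Q)" "j ` carrier Q \<subseteq> \<Omega> - carrier Q" using room[OF Q Q] by blast
    obtain V g' where "rigid V g'" "carrier V = j ` carrier Q"
      by (rule rigid_transport[OF Q j(1)]) (rule that)
    then have "(V, g') \<in> \<P>" using j(2) by (auto simp: \<P>_def)
    ultimately show False using max by blast
  qed
  have C\<Omega>: "(\<Union>p\<in>C. carrier (fst p)) \<subseteq> \<Omega>" using sub unfolding \<P>_def by blast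
  have rigC: "rigid (fst p) (snd p)" if "p \<in> C" for p using that sub unfolding \<P>_def by blast
  obtain U where U: "rigid (fst U) (snd U)" "carrier (fst U) = (\<Union>p\<in>C. carrier (fst p))"
    and UC: "\<And>p. p \<in> C \<Longrightarrow> extended_by p U"
    by (rule rigid_chain_union[OF ne _ _ small_subset[OF sm\<Omega> C\<Omega>]]) (rule rigC ch that; blast)+
  have UP: "U \<in> \<P>" using U C\<Omega> by (simp add: \<P>_def)
  have "k ` carrier (fst U) = carrier Z" if Z: "rigid Z g" and k: "over_map (fst U) (snd U) Z g k" for Z g k
  proof -
    have ZI: "(Z, g, M) \<in> \<I>" using Z by (simp add: rigid_def)
    have kh: "k \<in> Mod_hom R (fst U) Z" using k by (simp add: over_map_def)
    have kinj: "inj_on k (carrier (fst U))" using U(1) ZI k unfolding rigid_def by blast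
    obtain j where j: "inj_on j (carrier Z)" "j ` carrier Z \<subseteq> \<Omega> - carrier (fst U)" using room[OF Z U(1)] by blast
    \<comment> \<open>identify the image of \<open>U\<close> with \<open>U\<close> and move the rest of \<open>Z\<close> outside \<open>U\<close>\<close>
    define b where "b z = (if z \<in> k ` carrier (fst U) then inv_into (carrier (fst U)) k z else j z)" for z
    have bk: "b (k x) = x" if "x \<in> carrier (fst U)" for x using that kinj by (simp add: b_def)
    have b1: "b z \<in> carrier (fst U)" if "z \<in> k ` carrier (fst U)" for z using that bk by auto
    have b2: "b z = j z" "b z \<in> \<Omega> - carrier (fst U)" if "z \<in> carrier Z" "z \<notin> k ` carrier (fst U)" for z
      using that j(2) by (auto simp: b_def)
    have binj: "inj_on b (carrier Z)"
    proof (rule inj_onI)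
      fix y z assume yz: "y \<in> carrier Z" "z \<in> carrier Z" "b y = b z"
      show "y = z"
      proof (cases "y \<in> k ` carrier (fst U)")
        case True
        then have "z \<in> k ` carrier (fst U)" using b1[of y] b2(2)[of z] yz by auto
        then show ?thesis using True bk yz(3) by auto
      next
        case False
        then have "z \<notin> k ` carrier (fst U)" using b1[of z] b2(2)[of y] yz by auto
        then show ?thesis using False b2(1) yz inj_onD[OF j(1)] by metis
      qed
    qed
    obtain V h where V: "rigid V h" "carrier V = b ` carrier Z" "over_map Z g V h (restrict b (carrier Z))"
      by (rule rigid_transport[OF Z binj]) (rule that)
    have "b z \<in> \<Omega>" if "z \<in> carrier Z" for z
      using that b1 b2(2) UP unfolding \<P>_def by blast
    then have VP: "(V, h) \<in> \<P>" using V(1,2) by (auto simp: \<P>_def)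
    have "compose (carrier (fst U)) (restrict b (carrier Z)) k = Mod_id (fst U)"
      using bk Mod_hom_closed[OF kh] by (auto simp: compose_def Mod_id_def fun_eq_iff)
    then have UV: "extended_by U (V, h)"
      using over_map_compose[OF obj[OF UP] k V(3)] by (simp add: extended_by_def)
    have "(V, h) \<in> C"
      by (rule max[OF VP]) (use UC UV sub obj extended_by_trans in blast)
    then have VU: "carrier V \<subseteq> carrier (fst U)" using extended_by_carrier[OF UC] by fastforce
    have "z \<in> k ` carrier (fst U)" if "z \<in> carrier Z" for z
      using b2(2)[OF that] VU V(2) that by blast
    then show ?thesis using Mod_hom_closed[OF kh] by blast
  qed
  then show ?thesis by (rule that[OF U(1)])
qed

section \<open>Covers\<close>

text \<open>
  The sum \<open>U \<oplus> X' \<rightarrow> M\<close> of the two structure maps is in \<open>\<I>\<close> because \<open>\<I>\<close> is an ideal. The composite of \<open>U\<close> with a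
  rigid quotient \<open>Q\<close> of this sum is bijective, so \<open>X' \<rightarrow> Q \<cong> U\<close> is a map over \<open>M\<close>.
\<close>

lemma cover_exists: "\<exists>X p. cover R \<I> (X, p, M)"
proof -
  obtain U f where U: "rigid U f"
    and max: "\<And>Z g k. rigid Z g \<Longrightarrow> over_map U f Z g k \<Longrightarrow> k ` carrier U = carrier Z"
    by (rule maximal_rigid) (rule that)
  have UI: "(U, f, M) \<in> \<I>" using U by (simp add: rigid_def)
  note UM = over_module[OF UI] and Uobj = over_obj[OF UI] and fh = over_hom[OF UI]
  have bij: "inj_on k (carrier U)" "k ` carrier U = carrier Z"
    if "rigid Z g" "over_map U f Z g k" for Z g k
    using U that max[OF that] unfolding rigid_def by blast+
  interpret M: left_module R M by (rule M_module)
  have pre: "\<exists>k\<in>Mod_hom R X' U. compose (carrier X') f k = p'" if X': "(X', p', M) \<in> \<I>" for X' p'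
  proof -
    note ph = over_hom[OF X'] and XM = over_module[OF X']
    obtain S :: "('r, 'u) module" and i j p q where S: "Mod_obj R S" and i: "i \<in> Mod_hom R U S" and j: "j \<in> Mod_hom R X' S"
      and p: "p \<in> Mod_hom R S U" and q: "q \<in> Mod_hom R S X'"
      and pi: "\<And>x. x \<in> carrier U \<Longrightarrow> p (i x) = x" and qi: "\<And>x. x \<in> carrier U \<Longrightarrow> q (i x) = \<zero>\<^bsub>X'\<^esub>"
      and pj: "\<And>y. y \<in> carrier X' \<Longrightarrow> p (j y) = \<zero>\<^bsub>U\<^esub>" and qj: "\<And>y. y \<in> carrier X' \<Longrightarrow> q (j y) = y"
      by (rule direct_sum[OF universe ring Uobj over_obj[OF X']]) (rule that)
    have SM: "left_module R S" using S by (simp add: Mod_obj_def)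
    note opS = left_module_op_closed[OF SM]
    have "(S, compose (carrier S) f p, M) \<in> \<I>"
      by (rule over_pullback[OF S p UI Mod_hom_compose[OF p fh opS]]) (simp add: compose_def)
    moreover have "(S, compose (carrier S) p' q, M) \<in> \<I>"
      by (rule over_pullback[OF S q X' Mod_hom_compose[OF q ph opS]]) (simp add: compose_def)
    moreover have "subgroup {f. (S, f, M) \<in> \<I>} (Hom_group R S M)"
      using ideal S M unfolding Mod_ideal_def by blast
    ultimately have "compose (carrier S) f p \<otimes>\<^bsub>Hom_group R S M\<^esub> compose (carrier S) p' q \<in> {f. (S, f, M) \<in> \<I>}"
      by (intro subgroup.m_closed) simp_all
    then obtain h where SI: "(S, h, M) \<in> \<I>" and h: "\<And>s. s \<in> carrier S \<Longrightarrow> h s = f (p s) \<oplus>\<^bsub>M\<^esub> p' (q s)"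
      by (auto simp: Hom_group_def compose_def)
    obtain Q g l where Q: "rigid Q g" and l: "over_map S h Q g l"
      by (rule rigid_quotient[OF SI]) (rule that)
    have QI: "(Q, g, M) \<in> \<I>" using Q by (simp add: rigid_def)
    have lh: "l \<in> Mod_hom R S Q" and gl: "\<And>s. s \<in> carrier S \<Longrightarrow> g (l s) = h s"
      using l unfolding over_map_def by blast+
    have "h (i x) = f x" if "x \<in> carrier U" for x
      using that Mod_hom_closed[OF i that] Mod_hom_closed[OF fh that]
      by (simp add: h pi qi Mod_hom_zero[OF XM M_module ph])
    then have "over_map U f S h i" using i by (simp add: over_map_def)
    then have k: "over_map U f Q g (compose (carrier U) l i)"
      by (rule over_map_compose[OF Uobj _ l])
    let ?k = "compose (carrier U) l i"
    have kh: "?k \<in> Mod_hom R U Q" and gk: "\<And>x. x \<in> carrier U \<Longrightarrow> g (?k x) = f x"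
      using k unfolding over_map_def by blast+
    obtain k' where k': "k' \<in> Mod_hom R Q U" "\<And>x. x \<in> carrier U \<Longrightarrow> k' (?k x) = x"
      "\<And>u. u \<in> carrier Q \<Longrightarrow> ?k (k' u) = u"
      by (rule Mod_hom_inverse[OF UM kh bij[OF Q k]]) (rule that)
    have fk': "f (k' u) = g u" if "u \<in> carrier Q" for u
      using gk[OF Mod_hom_closed[OF k'(1) that]] k'(3)[OF that] by simp
    let ?m = "compose (carrier X') k' (compose (carrier X') l j)"
    note opX = left_module_op_closed[OF XM]
    have "?m \<in> Mod_hom R X' U"
      by (intro Mod_hom_compose[OF Mod_hom_compose[OF j lh opX] k'(1) opX])
    moreover have "compose (carrier X') f ?m = p'"
    proof (rule Mod_hom_eqI[OF Mod_hom_compose[OF calculation fh opX] ph])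
      fix x assume x: "x \<in> carrier X'"
      have jx: "j x \<in> carrier S" by (rule Mod_hom_closed[OF j x])
      have "compose (carrier X') f ?m x = f (k' (l (j x)))" using x by (simp add: compose_def)
      also have "\<dots> = h (j x)" using fk'[OF Mod_hom_closed[OF lh jx]] gl[OF jx] by simp
      also have "\<dots> = p' x"
        using x jx Mod_hom_closed[OF ph x] by (simp add: h pj qj Mod_hom_zero[OF UM M_module fh])
      finally show "compose (carrier X') f ?m x = p' x" .
    qed
    ultimately show ?thesis by blast
  qed
  have "Mod_automorphism R U j" if j: "j \<in> Mod_hom R U U" and fj: "compose (carrier U) f j = f" for j
  proof -
    have "over_map U f U f j" using j compose_eqD[OF fj] by (simp add: over_map_def)
    note b = bij[OF U this]
    obtain k where k: "k \<in> Mod_hom R U U" "\<And>x. x \<in> carrier U \<Longrightarrow> k (j x) = x"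
      "\<And>x. x \<in> carrier U \<Longrightarrow> j (k x) = x"
      by (rule Mod_hom_inverse[OF UM j b]) (rule that)
    then have "compose (carrier U) k j = Mod_id U" "compose (carrier U) j k = Mod_id U"
      by (auto simp: compose_def Mod_id_def)
    then show ?thesis using j k(1) unfolding Mod_automorphism_def by blast
  qed
  then have "cover R \<I> (U, f, M)" using UI pre unfolding cover_def precover_def by simp
  then show ?thesis by blast
qed

end

theorem theorem3p2:
  fixes R :: "'r ring"
    and \<I> :: "('r, 'u) morphism set"
  assumes "universe TYPE('u)"
    and "ring R" and "small TYPE('u) (carrier R)"
    and "Mod_ideal R \<I>"
    and "closed_under_direct_limits R \<I>"
    and "\<exists>\<I>0. small TYPE('u) \<I>0 \<and> is_closure_under_direct_limits R \<I>0 \<I>"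
  shows "covering_ideal R \<I>"
  unfolding covering_ideal_def
proof (intro conjI allI impI assms(4))
  fix M :: "('r, 'u) module" assume "Mod_obj R M"
  then interpret limit_closed_ideal R \<I> M
    by (intro limit_closed_ideal.intro assms(1-5))
  show "\<exists>X p. cover R \<I> (X, p, M)" by (rule cover_exists)
qed

end
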